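(* Let $(M^{m+1},g(t),p(t))$, $t\in[t_0,t_1]\subset[0,T)$, $t_0<t_1$, be a solution to the conformal Ricci flow on a closed connected manifold of dimension $m+1\ge3$ with constant scalar curvature $R_g=-m(m+1)$, let $h,k$ be smooth functions of $t$ with $h(t)>0$, and suppose $$\mathscr{R}ic_f\le\Big(\frac{k(t)}{2h(t)}+\frac{R_g}{m+1}\Big)g .$$ Let $v:M^{m+1}\times[t_0,t_1]\to\mathbb{R}$ satisfy $$|(\partial_t-\Delta_{g(t)})v|\le\bar p(t)\big(|v|+|\nabla v|\big),\qquad \bar p(t)=\max_{x\in M}p(x,t),$$ along the flow. If $v(\cdot,t_1)=0$, then $v(\cdot,t)\equiv0$ for all $t\in[t_0,t_1]$.
   Context: $M$ is a closed (compact, without boundary) connected manifold of dimension $m+1\ge3$ and $T>0$. $(M^{m+1},g(t),p(t))$, $t\in[0,T)$, solves the conformal Ricci flow if $g(t)$ is a smooth family of Riemannian metrics and $p(t)=p(\cdot,t)\ge 0$ a family of functions (the conformal pressure) on $M$ with $$\partial_t g=-2\big(Ric(t)+(m+p(t))g(t)\big),\qquad (-\Delta_{g(t)}+(m+1))p(t)=\tfrac1m|Ric+mg|^2\quad\text{on }M\times[0,T),$$ $g(0)=g_0$, where $g_0$ has constant scalar curvature $-m(m+1)$; the flow preserves $R_{g(t)}\equiv-m(m+1)$. $Ric$, $\Delta_{g(t)}$, $\nabla$, $d\mu_{g(t)}$ are the Ricci tensor, Laplace-Beltrami operator, Levi-Civita connection/gradient and volume element of $g(t)$. Weighted measure: let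 $\tau(t)=T-t$ and let $H(t)=(4\pi\tau(t))^{-\frac{m+1}{2}}e^{-f(t)}$ be the (positive) fundamental solution of the conjugate heat equation $\partial_tH=-\Delta_{g(t)}H+(m+1)p(t)H$ along the flow; this defines $f=f(t)$, which satisfies $\partial_tf=-\Delta f+|\nabla f|^2-(m+1)\big(p-\frac{1}{2\tau}\big)$. The weighted measure is $dV_{g(t)}=H(t)\,d\mu_{g(t)}$, with $\int_M dV_{g(t)}=1$. Bakry-Émery Ricci tensor: $\mathscr{R}ic_f=Ric+\operatorname{Hess}f$. Inequalities between symmetric 2-tensors are in the sense of quadratic forms. The function $v$ is smooth with $v(\cdot,t),\partial_tv(\cdot,t)\in W^{2,2}_0(dV)$. *)

theory Defs
  imports "HOL-Probability.Probability"
begin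

section \<open>Smooth functions\<close>

text \<open>
  Derivatives are taken within \<open>S\<close>, so that one-sided smoothness up to the boundary of a time
  interval is covered.  The sets used below are open sets, intervals with non-empty interior, and
  products of the two; on these the derivative within \<open>S\<close> is unique.
\<close>

primrec Ck_on :: "nat \<Rightarrow> 'a::euclidean_space set \<Rightarrow> ('a \<Rightarrow> 'b::real_normed_vector) \<Rightarrow> bool" where
  "Ck_on 0 S F \<longleftrightarrow> continuous_on S F"
| "Ck_on (Suc k) S F \<longleftrightarrow>
     F differentiable_on S \<and>
     (\<forall>b\<in>Basis. Ck_on k S (\<lambda>x. frechet_derivative F (at x within S) b))"

definition smooth_on :: "'a::euclidean_space set \<Rightarrow> ('a \<Rightarrow> 'b::real_normed_vector) \<Rightarrow> bool" where
  "smooth_on S F \<longleftrightarrow> (\<forall>k. Ck_on k S F)"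


section \<open>Closed smooth manifolds\<close>

text \<open>
  A chart is a pair of its domain and its coordinate map; outside the domain the values of the
  coordinate map are irrelevant.  The dimension of the manifold is \<open>CARD('n)\<close>.
\<close>

type_synonym ('a, 'n) chart = "'a set \<times> ('a \<Rightarrow> real^'n)"

definition cdom :: "('a, 'n) chart \<Rightarrow> 'a set" where
  "cdom c = fst c"

definition cmap :: "('a, 'n) chart \<Rightarrow> 'a \<Rightarrow> real^'n" where
  "cmap c = snd c"

definition cimg :: "('a, 'n) chart \<Rightarrow> (real^'n) set" where
  "cimg c = cmap c ` cdom c"

definition cinv :: "('a, 'n) chart \<Rightarrow> real^'n \<Rightarrow> 'a" where
  "cinv c = inv_into (cdom c) (cmap c)"

definition smooth_atlas :: "'a topology \<Rightarrow> ('a, 'n::finite) chart set \<Rightarrow> bool" where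
  "smooth_atlas M A \<longleftrightarrow>
     (\<Union>c\<in>A. cdom c) = topspace M \<and>
     (\<forall>c\<in>A. openin M (cdom c) \<and> open (cimg c) \<and>
        homeomorphic_map (subtopology M (cdom c)) (top_of_set (cimg c)) (cmap c)) \<and>
     (\<forall>c\<in>A. \<forall>d\<in>A. smooth_on (cmap c ` (cdom c \<inter> cdom d)) (cmap d \<circ> cinv c))"

definition closed_manifold :: "'a topology \<Rightarrow> ('a, 'n::finite) chart set \<Rightarrow> bool" where
  "closed_manifold M A \<longleftrightarrow>
     Hausdorff_space M \<and> second_countable M \<and> compact_space M \<and> smooth_atlas M A"

definition smooth_fun :: "('a, 'n::finite) chart set \<Rightarrow> ('a \<Rightarrow> real) \<Rightarrow> bool" where
  "smooth_fun A u \<longleftrightarrow> (\<forall>c\<in>A. smooth_on (cimg c) (u \<circ> cinv c))"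

definition smooth_family ::
    "('a, 'n::finite) chart set \<Rightarrow> real set \<Rightarrow> (real \<Rightarrow> 'a \<Rightarrow> real) \<Rightarrow> bool" where
  "smooth_family A I u \<longleftrightarrow>
     (\<forall>c\<in>A. smooth_on (I \<times> cimg c) (\<lambda>(t, y). u t (cinv c y)))"

definition time_deriv :: "real set \<Rightarrow> (real \<Rightarrow> 'a \<Rightarrow> real) \<Rightarrow> real \<Rightarrow> 'a \<Rightarrow> real" where
  "time_deriv I u t x = vector_derivative (\<lambda>s. u s x) (at t within I)"

definition partial :: "('a, 'n::finite) chart \<Rightarrow> 'n \<Rightarrow> ('a \<Rightarrow> real) \<Rightarrow> 'a \<Rightarrow> real" where
  "partial c i u x = frechet_derivative (u \<circ> cinv c) (at (cmap c x)) (axis i 1)"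


section \<open>Riemannian metrics\<close>

text \<open>
  A covariant 2-tensor field \<open>S\<close> is given by its components: \<open>S c x $ i $ j\<close> is the value of
  the tensor at \<open>x\<close> on the pair of the \<open>i\<close>-th and the \<open>j\<close>-th coordinate vector of the chart \<open>c\<close>.
  The components in different charts are linked by the tensor transformation law.
\<close>

type_synonym ('a, 'n) tensor2 = "('a, 'n) chart \<Rightarrow> 'a \<Rightarrow> real^'n^'n"

definition jacobian_change ::
    "('a, 'n::finite) chart \<Rightarrow> ('a, 'n) chart \<Rightarrow> 'a \<Rightarrow> real^'n^'n" where
  "jacobian_change c d x = matrix (frechet_derivative (cmap c \<circ> cinv d) (at (cmap d x)))"

definition tensor_field :: "('a, 'n::finite) chart set \<Rightarrow> ('a, 'n) tensor2 \<Rightarrow> bool" where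
  "tensor_field A S \<longleftrightarrow>
     (\<forall>c\<in>A. \<forall>d\<in>A. \<forall>x\<in>cdom c \<inter> cdom d.
        S d x = transpose (jacobian_change c d x) ** S c x ** jacobian_change c d x)"

definition riemannian_metric :: "('a, 'n::finite) chart set \<Rightarrow> ('a, 'n) tensor2 \<Rightarrow> bool" where
  "riemannian_metric A g \<longleftrightarrow>
     tensor_field A g \<and>
     (\<forall>c\<in>A. smooth_on (cimg c) (g c \<circ> cinv c)) \<and>
     (\<forall>c\<in>A. \<forall>x\<in>cdom c. transpose (g c x) = g c x \<and> (\<forall>\<xi>. \<xi> \<noteq> 0 \<longrightarrow> \<xi> \<bullet> (g c x *v \<xi>) > 0))"

definition smooth_metric_family ::
    "('a, 'n::finite) chart set \<Rightarrow> real set \<Rightarrow> (real \<Rightarrow> ('a, 'n) tensor2) \<Rightarrow> bool" where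
  "smooth_metric_family A I g \<longleftrightarrow>
     (\<forall>t\<in>I. riemannian_metric A (g t)) \<and>
     (\<forall>c\<in>A. smooth_on (I \<times> cimg c) (\<lambda>(t, y). g t c (cinv c y)))"

definition ginv :: "('a, 'n::finite) tensor2 \<Rightarrow> ('a, 'n) tensor2" where
  "ginv g c x = matrix_inv (g c x)"

text \<open>\<open>christoffel g c k i j\<close> is \<open>\<Gamma>\<^sup>k\<^sub>i\<^sub>j\<close>, for the Levi-Civita connection of \<open>g\<close>.\<close>

definition christoffel ::
    "('a, 'n::finite) tensor2 \<Rightarrow> ('a, 'n) chart \<Rightarrow> 'n \<Rightarrow> 'n \<Rightarrow> 'n \<Rightarrow> 'a \<Rightarrow> real" where
  "christoffel g c k i j x =
     (1/2) * (\<Sum>l\<in>UNIV. ginv g c x $ k $ l *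
       (partial c i (\<lambda>z. g c z $ j $ l) x + partial c j (\<lambda>z. g c z $ i $ l) x
        - partial c l (\<lambda>z. g c z $ i $ j) x))"

text \<open>
  \<open>riemann g c k l i j\<close> is the coefficient of \<open>\<partial>\<^sub>k\<close> in \<open>R(\<partial>\<^sub>i, \<partial>\<^sub>j)\<partial>\<^sub>l\<close>, where
  \<open>R(X, Y)Z = \<nabla>\<^sub>X\<nabla>\<^sub>Y Z - \<nabla>\<^sub>Y\<nabla>\<^sub>X Z - \<nabla>\<^bsub>[X,Y]\<^esub>Z\<close>.  With the contraction
  below the round sphere has positive Ricci curvature.
\<close>

definition riemann ::
    "('a, 'n::finite) tensor2 \<Rightarrow> ('a, 'n) chart \<Rightarrow> 'n \<Rightarrow> 'n \<Rightarrow> 'n \<Rightarrow> 'n \<Rightarrow> 'a \<Rightarrow> real" where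
  "riemann g c k l i j x =
     partial c i (christoffel g c k j l) x - partial c j (christoffel g c k i l) x
     + (\<Sum>s\<in>UNIV. christoffel g c k i s x * christoffel g c s j l x
                 - christoffel g c k j s x * christoffel g c s i l x)"

definition ricci :: "('a, 'n::finite) tensor2 \<Rightarrow> ('a, 'n) tensor2" where
  "ricci g c x = (\<chi> l j. \<Sum>k\<in>UNIV. riemann g c k l k j x)"

definition tensor_trace ::
    "('a, 'n::finite) tensor2 \<Rightarrow> ('a, 'n) tensor2 \<Rightarrow> ('a, 'n) chart \<Rightarrow> 'a \<Rightarrow> real" where
  "tensor_trace g S c x = (\<Sum>i\<in>UNIV. \<Sum>j\<in>UNIV. ginv g c x $ i $ j * S c x $ i $ j)"

definition tensor_norm2 ::
    "('a, 'n::finite) tensor2 \<Rightarrow> ('a, 'n) tensor2 \<Rightarrow> ('a, 'n) chart \<Rightarrow> 'a \<Rightarrow> real" where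
  "tensor_norm2 g S c x =
     (\<Sum>i\<in>UNIV. \<Sum>j\<in>UNIV. \<Sum>k\<in>UNIV. \<Sum>l\<in>UNIV.
        ginv g c x $ i $ k * ginv g c x $ j $ l * S c x $ i $ j * S c x $ k $ l)"

definition tensor_le :: "real^'n^'n \<Rightarrow> real^'n^'n \<Rightarrow> bool" where
  "tensor_le S S' \<longleftrightarrow> (\<forall>\<xi>. \<xi> \<bullet> (S *v \<xi>) \<le> \<xi> \<bullet> (S' *v \<xi>))"

definition scalar_curvature ::
    "('a, 'n::finite) tensor2 \<Rightarrow> ('a, 'n) chart \<Rightarrow> 'a \<Rightarrow> real" where
  "scalar_curvature g = tensor_trace g (ricci g)"

definition grad ::
    "('a, 'n::finite) tensor2 \<Rightarrow> ('a \<Rightarrow> real) \<Rightarrow> ('a, 'n) chart \<Rightarrow> 'a \<Rightarrow> real^'n" where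
  "grad g u c x = (\<chi> i. \<Sum>j\<in>UNIV. ginv g c x $ i $ j * partial c j u x)"

definition grad_norm ::
    "('a, 'n::finite) tensor2 \<Rightarrow> ('a \<Rightarrow> real) \<Rightarrow> ('a, 'n) chart \<Rightarrow> 'a \<Rightarrow> real" where
  "grad_norm g u c x = sqrt (grad g u c x \<bullet> (g c x *v grad g u c x))"

definition hessian :: "('a, 'n::finite) tensor2 \<Rightarrow> ('a \<Rightarrow> real) \<Rightarrow> ('a, 'n) tensor2" where
  "hessian g u c x =
     (\<chi> i j. partial c i (partial c j u) x - (\<Sum>k\<in>UNIV. christoffel g c k i j x * partial c k u x))"

definition laplacian ::
    "('a, 'n::finite) tensor2 \<Rightarrow> ('a \<Rightarrow> real) \<Rightarrow> ('a, 'n) chart \<Rightarrow> 'a \<Rightarrow> real" where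
  "laplacian g u = tensor_trace g (hessian g u)"

definition bakry_emery_ricci ::
    "('a, 'n::finite) tensor2 \<Rightarrow> ('a \<Rightarrow> real) \<Rightarrow> ('a, 'n) tensor2" where
  "bakry_emery_ricci g f c x = ricci g c x + hessian g f c x"

text \<open>
  The volume measure of \<open>g\<close> is the unique Borel measure on \<open>M\<close> that has the density
  \<open>sqrt (det g\<^sub>i\<^sub>j)\<close> with respect to Lebesgue measure in every chart.
\<close>

definition volume_measure ::
    "'a topology \<Rightarrow> ('a, 'n::finite) chart set \<Rightarrow> ('a, 'n) tensor2 \<Rightarrow> 'a measure \<Rightarrow> bool" where
  "volume_measure M A g \<mu> \<longleftrightarrow>
     space \<mu> = topspace M \<and> sets \<mu> = sigma_sets (topspace M) {U. openin M U} \<and>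
     (\<forall>c\<in>A. \<forall>B\<in>sets \<mu>. B \<subseteq> cdom c \<longrightarrow>
        emeasure \<mu> B =
          (\<integral>\<^sup>+ y. ennreal (sqrt (det (g c (cinv c y)))) * indicator (cmap c ` B) y \<partial>lborel))"


section \<open>The conformal Ricci flow and the weighted measure\<close>

text \<open>
  The underlying manifold has dimension \<open>m + 1\<close>.  All scalar quantities are independent of the
  chart in which they are computed, and all tensor identities hold in one chart around a point iff
  they hold in every such chart.
\<close>

definition conformal_ricci_flow ::
    "('a, 'n::finite) chart set \<Rightarrow> nat \<Rightarrow> real \<Rightarrow> (real \<Rightarrow> ('a, 'n) tensor2) \<Rightarrow>
     (real \<Rightarrow> 'a \<Rightarrow> real) \<Rightarrow> bool" where
  "conformal_ricci_flow A m T g p \<longleftrightarrow>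
     smooth_metric_family A {0..<T} g \<and>
     smooth_family A {0..<T} p \<and>
     (\<forall>t\<in>{0..<T}. \<forall>c\<in>A. \<forall>x\<in>cdom c.
        p t x \<ge> 0 \<and>
        ((\<lambda>s. g s c x) has_vector_derivative
           (-2) *\<^sub>R (ricci (g t) c x + (real m + p t x) *\<^sub>R g t c x)) (at t within {0..<T}) \<and>
        - laplacian (g t) (p t) c x + real (m + 1) * p t x =
          (1 / real m) * tensor_norm2 (g t) (\<lambda>d z. ricci (g t) d z + real m *\<^sub>R g t d z) c x)"

definition max_pressure :: "'a topology \<Rightarrow> (real \<Rightarrow> 'a \<Rightarrow> real) \<Rightarrow> real \<Rightarrow> real" where
  "max_pressure M p t = (SUP x\<in>topspace M. p t x)"

text \<open>
  A positive fundamental solution of the conjugate heat equation on \<open>M \<times> [0, T)\<close>: the measures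
  \<open>H t d\<mu> t\<close> converge weakly to the Dirac measure at some point \<open>y\<close> as \<open>t\<close> tends to \<open>T\<close>.
\<close>

definition conjugate_fundamental_solution ::
    "'a topology \<Rightarrow> ('a, 'n::finite) chart set \<Rightarrow> nat \<Rightarrow> real \<Rightarrow> (real \<Rightarrow> ('a, 'n) tensor2) \<Rightarrow>
     (real \<Rightarrow> 'a \<Rightarrow> real) \<Rightarrow> (real \<Rightarrow> 'a measure) \<Rightarrow> (real \<Rightarrow> 'a \<Rightarrow> real) \<Rightarrow> bool" where
  "conjugate_fundamental_solution M A m T g p \<mu> H \<longleftrightarrow>
     smooth_family A {0..<T} H \<and>
     (\<forall>t\<in>{0..<T}. \<forall>c\<in>A. \<forall>x\<in>cdom c.
        H t x > 0 \<and>
        time_deriv {0..<T} H t x =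
          - laplacian (g t) (H t) c x + real (m + 1) * p t x * H t x) \<and>
     (\<exists>y\<in>topspace M. \<forall>\<phi>. continuous_map M euclideanreal \<phi> \<longrightarrow>
        ((\<lambda>t. \<integral>x. \<phi> x * H t x \<partial>\<mu> t) \<longlongrightarrow> \<phi> y) (at_left T))"

definition weighted_measure :: "'a measure \<Rightarrow> ('a \<Rightarrow> real) \<Rightarrow> 'a measure" where
  "weighted_measure \<mu> H = density \<mu> (\<lambda>x. ennreal (H x))"

definition chart_at :: "('a, 'n) chart set \<Rightarrow> 'a \<Rightarrow> ('a, 'n) chart" where
  "chart_at A x = (SOME c. c \<in> A \<and> x \<in> cdom c)"

text \<open>
  The square of the \<open>W\<^sup>2\<^sup>,\<^sup>2\<close> norm of a smooth function with respect to the measure \<open>V\<close>.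
  The chart selected by \<open>chart_at\<close> does not affect the integrand.
\<close>

definition W22_norm2 ::
    "('a, 'n::finite) chart set \<Rightarrow> ('a, 'n) tensor2 \<Rightarrow> 'a measure \<Rightarrow> ('a \<Rightarrow> real) \<Rightarrow> ennreal" where
  "W22_norm2 A g V u =
     (\<integral>\<^sup>+ x. ennreal ((u x)\<^sup>2 + (grad_norm g u (chart_at A x) x)\<^sup>2
                  + tensor_norm2 g (hessian g u) (chart_at A x) x) \<partial>V)"

text \<open>
  Membership of a smooth function in \<open>W\<^sup>2\<^sup>,\<^sup>2\<^sub>0(V)\<close>, the closure of the compactly supported smooth
  functions in the \<open>W\<^sup>2\<^sup>,\<^sup>2\<close> norm.  Only smooth elements of this space are considered, for which
  weak derivatives are classical ones.
\<close>

definition smooth_in_W22_0 ::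
    "'a topology \<Rightarrow> ('a, 'n::finite) chart set \<Rightarrow> ('a, 'n) tensor2 \<Rightarrow> 'a measure \<Rightarrow>
     ('a \<Rightarrow> real) \<Rightarrow> bool" where
  "smooth_in_W22_0 M A g V u \<longleftrightarrow>
     smooth_fun A u \<and>
     (\<exists>\<phi>. (\<forall>n. smooth_fun A (\<phi> n) \<and> compactin M (M closure_of {x \<in> topspace M. \<phi> n x \<noteq> 0})) \<and>
          (\<lambda>n. W22_norm2 A g V (\<lambda>x. u x - \<phi> n x)) \<longlonglongrightarrow> 0)"

end

theory Submission
  imports Defs
begin

text \<open>
  The reason for backward uniqueness is a bound on a frequency.  Let \<open>\<langle>\<cdot>, \<cdot>\<rangle>\<close> be the
  \<open>L\<^sup>2\<close> product of a positive measure on \<open>M\<close> that does not depend on time, put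
  \<open>E = \<langle>v, v\<rangle>\<close>, let \<open>D\<close> be the integral of \<open>|\<nabla>v|\<^sup>2\<close> for the metric at time \<open>t\<close>, and let \<open>P\<close> be
  the elliptic operator for which \<open>- \<langle>u, P v\<rangle>\<close> is the integral of \<open>g(\<nabla>u, \<nabla>v)\<close>.  The operators \<open>P\<close> and \<open>\<Delta>\<close>
  have the same second order part, so the assumed inequality gives
  \<open>\<bar>w\<bar> \<le> C (\<bar>v\<bar> + |\<nabla>v|)\<close> for \<open>w = \<partial>\<^sub>tv - P v\<close>; the constant exists because \<open>M \<times> [t\<^sub>0, t\<^sub>1]\<close> is
  compact.  With \<open>z = \<partial>\<^sub>tv - w/2 = P v + w/2\<close>,
    \<open>E' = 2\<langle>v, z\<rangle> + \<langle>v, w\<rangle>\<close>,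
    \<open>D = - \<langle>v, z\<rangle> + \<langle>v, w\<rangle>/2\<close>,
    \<open>D' \<le> C D - 2\<langle>\<partial>\<^sub>tv, P v\<rangle> = C D - 2\<langle>z, z\<rangle> + \<langle>w, w\<rangle>/2\<close>,
  where \<open>C D\<close> bounds the effect of the change of the metric.  Therefore
    \<open>D' E - D E' \<le> C D E + \<langle>w, w\<rangle> E/2 - \<langle>v, w\<rangle>\<^sup>2/2 + 2(\<langle>v, z\<rangle>\<^sup>2 - \<langle>v, v\<rangle>\<langle>z, z\<rangle>)\<close>,
  and the last bracket is nonpositive by the Cauchy-Schwarz inequality
  (\<open>frequency_inequalities\<close>).  So \<open>N = D/E\<close> satisfies \<open>N' \<le> C (1 + N)\<close> and stays bounded as long as
  \<open>E > 0\<close>.  As \<open>E' \<ge> - C (1 + N) E\<close>, the energy decays at most exponentially: if it is positive at some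
  time, it is positive at \<open>t\<^sub>1\<close>, where \<open>v\<close> vanishes (\<open>frequency_bound_imp_zero\<close>).

  The measure is chosen so that all integrals can be computed in Euclidean space.  Let \<open>\<mu>\<close> be the
  volume at time \<open>t\<^sub>0\<close>, and let \<open>\<beta>\<^sub>k\<close> be finitely many bump functions in charts whose supports cover \<open>M\<close>.
  The weight \<open>\<Phi>\<close> is the sum of the functions \<open>\<beta>\<^sub>k / sqrt (det g\<^sub>i\<^sub>j)\<close>; the denominator cancels the volume density,
  so \<open>\<integral> F \<Phi> d\<mu>\<close> is the sum of the Lebesgue integrals of \<open>\<beta>\<^sub>k F\<close> (\<open>\<Lambda>_charts\<close>), and
  integration by parts takes place chart by chart (\<open>Dirichlet_identity\<close>).  The bump functions do not form
  a partition of unity: their derivatives enter \<open>P\<close>, but only in its first order part, which belongs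
  to the error \<open>w\<close>.
\<close>

section \<open>Functions with a continuous gradient\<close>

text \<open>
  The derivative is taken within \<open>S\<close> and represented by a vector, so that at boundary times one-sided
  derivatives are meant and that continuity of the derivative is continuity of a vector field.
\<close>

definition C1_grad :: "'a::euclidean_space set \<Rightarrow> ('a \<Rightarrow> real) \<Rightarrow> ('a \<Rightarrow> 'a) \<Rightarrow> bool" where
  "C1_grad S F G \<longleftrightarrow>
     continuous_on S G \<and> (\<forall>z\<in>S. (F has_derivative (\<lambda>h. G z \<bullet> h)) (at z within S))"

definition C1 :: "'a::euclidean_space set \<Rightarrow> ('a \<Rightarrow> real) \<Rightarrow> bool" where
  "C1 S F \<longleftrightarrow> (\<exists>G. C1_grad S F G)"

lemma C1_grad_subset: "C1_grad S F G \<Longrightarrow> S' \<subseteq> S \<Longrightarrow> C1_grad S' F G"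
  unfolding C1_grad_def by (meson continuous_on_subset has_derivative_subset subsetD)

lemma C1_subset: "C1 S F \<Longrightarrow> S' \<subseteq> S \<Longrightarrow> C1 S' F"
  unfolding C1_def using C1_grad_subset by blast

lemma C1_grad_cong:
  assumes "C1_grad S F G" "\<And>z. z \<in> S \<Longrightarrow> F z = F' z" "\<And>z. z \<in> S \<Longrightarrow> G z = G' z"
  shows "C1_grad S F' G'"
  unfolding C1_grad_def
proof (intro conjI ballI)
  show "continuous_on S G'"
    using assms(1,3) unfolding C1_grad_def by (simp cong: continuous_on_cong)
  fix z assume z: "z \<in> S"
  have "(F has_derivative (\<lambda>h. G' z \<bullet> h)) (at z within S)"
    using assms(1,3) z unfolding C1_grad_def by simp
  then show "(F' has_derivative (\<lambda>h. G' z \<bullet> h)) (at z within S)"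
    using assms(2) z has_derivative_transform by (metis (no_types, lifting))
qed

lemma C1_cong: "C1 S F \<Longrightarrow> (\<And>z. z \<in> S \<Longrightarrow> F z = F' z) \<Longrightarrow> C1 S F'"
  unfolding C1_def using C1_grad_cong by metis

lemma C1_grad_continuous: "C1_grad S F G \<Longrightarrow> continuous_on S F"
  unfolding C1_grad_def continuous_on_eq_continuous_within
  using has_derivative_continuous by blast

lemma C1_continuous: "C1 S F \<Longrightarrow> continuous_on S F"
  unfolding C1_def using C1_grad_continuous by blast

lemma C1_grad_const: "C1_grad S (\<lambda>z. k) (\<lambda>z. 0)"
  unfolding C1_grad_def by (auto intro!: derivative_eq_intros)

lemma C1_grad_add:
  "C1_grad S F F' \<Longrightarrow> C1_grad S G G' \<Longrightarrow> C1_grad S (\<lambda>z. F z + G z) (\<lambda>z. F' z + G' z)"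
  unfolding C1_grad_def
  by (auto intro!: continuous_intros derivative_eq_intros simp: inner_add_left)

lemma C1_grad_mult:
  assumes "C1_grad S F F'" "C1_grad S G G'"
  shows "C1_grad S (\<lambda>z. F z * G z) (\<lambda>z. F z *\<^sub>R G' z + G z *\<^sub>R F' z)"
proof -
  have "continuous_on S F" "continuous_on S G"
    using assms C1_grad_continuous by blast+
  then show ?thesis
    using assms unfolding C1_grad_def
    by (auto intro!: continuous_intros derivative_eq_intros simp: inner_add_left algebra_simps)
qed

lemma C1_grad_sum:
  assumes "\<And>i. i \<in> I \<Longrightarrow> C1_grad S (F i) (F' i)"
  shows "C1_grad S (\<lambda>z. \<Sum>i\<in>I. F i z) (\<lambda>z. \<Sum>i\<in>I. F' i z)"
  using assms by (induction I rule: infinite_finite_induct) (auto intro: C1_grad_const C1_grad_add)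

lemma C1_grad_inverse:
  assumes "C1_grad S F F'" "\<And>z. z \<in> S \<Longrightarrow> F z \<noteq> 0"
  shows "C1_grad S (\<lambda>z. inverse (F z)) (\<lambda>z. - (inverse (F z) ^ 2) *\<^sub>R F' z)"
proof -
  have "continuous_on S F"
    using assms C1_grad_continuous by blast+
  then show ?thesis
    using assms unfolding C1_grad_def
    by (auto intro!: continuous_intros derivative_eq_intros simp: power2_eq_square)
qed

lemma C1_const: "C1 S (\<lambda>z. k)"
  unfolding C1_def using C1_grad_const by blast

lemma C1_mult: "C1 S F \<Longrightarrow> C1 S G \<Longrightarrow> C1 S (\<lambda>z. F z * G z)"
  unfolding C1_def using C1_grad_mult by blast

lemma C1_sum: "(\<And>i. i \<in> I \<Longrightarrow> C1 S (F i)) \<Longrightarrow> C1 S (\<lambda>z. \<Sum>i\<in>I. F i z)"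
  unfolding C1_def using C1_grad_sum[of I S F] by metis

lemma C1_prod: "(\<And>i. i \<in> I \<Longrightarrow> C1 S (F i)) \<Longrightarrow> C1 S (\<lambda>z. \<Prod>i\<in>I. F i z)"
  by (induction I rule: infinite_finite_induct) (auto intro: C1_const C1_mult)

lemma C1_divide:
  "C1 S F \<Longrightarrow> C1 S G \<Longrightarrow> (\<And>z. z \<in> S \<Longrightarrow> G z \<noteq> 0) \<Longrightarrow> C1 S (\<lambda>z. F z / G z)"
  unfolding divide_inverse by (intro C1_mult) (auto simp: C1_def intro: C1_grad_inverse)

lemma Ck_on_continuous: "Ck_on k S F \<Longrightarrow> continuous_on S F"
  by (cases k) (auto intro: differentiable_imp_continuous_on)

text \<open>
  The linear map \<open>l\<close> serves to extract an entry of a matrix-valued function.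
\<close>

lemma Ck_on_Suc_imp_C1_grad:
  assumes F: "Ck_on (Suc k) S F" and l: "bounded_linear l"
  shows "C1_grad S (\<lambda>z. l (F z))
    (\<lambda>z. \<Sum>b\<in>Basis. l (frechet_derivative F (at z within S) b) *\<^sub>R b)"
proof -
  let ?G = "\<lambda>z. \<Sum>b\<in>Basis. l (frechet_derivative F (at z within S) b) *\<^sub>R b"
  show ?thesis
    unfolding C1_grad_def
  proof (intro conjI ballI)
    show "continuous_on S ?G"
      using F Ck_on_continuous
      by (auto intro!: continuous_intros bounded_linear.continuous_on[OF l])
    fix z assume "z \<in> S"
    then have d: "(F has_derivative frechet_derivative F (at z within S)) (at z within S)"
      using F unfolding Ck_on.simps differentiable_on_def frechet_derivative_works by blast
    have e: "l (frechet_derivative F (at z within S) h) = ?G z \<bullet> h" for h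
    proof -
      interpret b: bounded_linear "\<lambda>h. l (frechet_derivative F (at z within S) h)"
        using bounded_linear_compose[OF l has_derivative_bounded_linear[OF d]] .
      show ?thesis
        by (subst (1) euclidean_representation[of h, symmetric], subst b.sum)
           (simp add: b.scaleR inner_sum_right inner_commute[of _ h] mult.commute)
    qed
    show "((\<lambda>z. l (F z)) has_derivative (\<lambda>h. ?G z \<bullet> h)) (at z within S)"
      by (rule has_derivative_eq_rhs[OF bounded_linear.has_derivative[OF l d]]) (rule ext, rule e)
  qed
qed

lemma Ck_on_Suc_imp_C1:
  "Ck_on (Suc k) S F \<Longrightarrow> bounded_linear l \<Longrightarrow> C1 S (\<lambda>z. l (F z))"
  unfolding C1_def using Ck_on_Suc_imp_C1_grad by blast

lemma C1_det:
  fixes B :: "'a::euclidean_space \<Rightarrow> real^'n^'n"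
  assumes "\<And>i j. C1 S (\<lambda>z. B z $ i $ j)"
  shows "C1 S (\<lambda>z. det (B z))"
  unfolding det_def by (intro C1_sum C1_mult C1_const C1_prod assms)

lemma matrix_inv_inverse:
  assumes "invertible B"
  shows "B ** matrix_inv B = mat 1" "matrix_inv B ** B = mat 1"
  using someI_ex[OF assms[unfolded invertible_def]] unfolding matrix_inv_def by auto

text \<open>
  Cramer's rule exhibits the entries of the inverse as rational functions of the entries of the matrix,
  which is how they inherit a continuous gradient (\<open>C1_matrix_inv\<close>).
\<close>

lemma matrix_inv_cramer:
  fixes B :: "real^'n^'n"
  assumes "det B \<noteq> 0"
  shows "matrix_inv B $ i $ j = det (\<chi> k l. if l = i then axis j 1 $ k else B $ k $ l) / det B"
proof -
  have "B ** matrix_inv B = mat 1"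
    using assms invertible_det_nz matrix_inv_inverse(1) by blast
  then have "B *v (matrix_inv B *v axis j 1) = axis j 1"
    by (simp add: matrix_vector_mul_assoc)
  then have "matrix_inv B *v axis j 1 =
      (\<chi> i. det (\<chi> k l. if l = i then axis j 1 $ k else B $ k $ l) / det B)"
    using cramer[OF assms] by blast
  then have "column j (matrix_inv B) =
      (\<chi> i. det (\<chi> k l. if l = i then axis j 1 $ k else B $ k $ l) / det B)"
    by (simp only: matrix_vector_mult_basis)
  then show ?thesis
    by (simp add: column_def vec_eq_iff)
qed

lemma C1_matrix_inv:
  fixes B :: "'a::euclidean_space \<Rightarrow> real^'n^'n"
  assumes B: "\<And>i j. C1 S (\<lambda>z. B z $ i $ j)" and nz: "\<And>z. z \<in> S \<Longrightarrow> det (B z) \<noteq> 0"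
  shows "C1 S (\<lambda>z. matrix_inv (B z) $ i $ j)"
proof (rule C1_cong)
  show "C1 S (\<lambda>z. det (\<chi> k l. if l = i then axis j 1 $ k else B z $ k $ l) / det (B z))"
  proof (intro C1_divide C1_det B nz)
    fix k l show "C1 S (\<lambda>z. (\<chi> k l. if l = i then axis j 1 $ k else B z $ k $ l) $ k $ l)"
      by (cases "l = i") (auto intro: C1_const B)
  qed
qed (simp add: matrix_inv_cramer nz)

lemma C1_grad_time:
  assumes "C1_grad (J \<times> W) F G" "t \<in> J" "y \<in> W"
  shows "((\<lambda>s. F (s, y)) has_vector_derivative fst (G (t, y))) (at t within J)"
proof -
  have "(F has_derivative (\<lambda>h. G (t, y) \<bullet> h)) (at (t, y) within (\<lambda>s. (s, y)) ` J)"
    using assms unfolding C1_grad_def by (auto elim!: has_derivative_subset)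
  then have "((\<lambda>s. F (s, y)) has_derivative (\<lambda>h. G (t, y) \<bullet> (h, 0))) (at t within J)"
    by (intro has_derivative_in_compose[of "\<lambda>s. (s, y)" "\<lambda>h. (h, 0)" t J F "\<lambda>h. G (t, y) \<bullet> h"])
      (auto intro!: derivative_eq_intros)
  then show ?thesis
    unfolding has_vector_derivative_def by (simp add: inner_prod_def mult.commute)
qed

lemma C1_grad_space:
  assumes "C1_grad (J \<times> W) F G" "t \<in> J"
  shows "C1_grad W (\<lambda>y. F (t, y)) (\<lambda>y. snd (G (t, y)))"
  unfolding C1_grad_def
proof (intro conjI ballI)
  show "continuous_on W (\<lambda>y. snd (G (t, y)))"
    using assms unfolding C1_grad_def
    by (auto intro!: continuous_intros elim!: continuous_on_compose2)
  fix y assume y: "y \<in> W"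
  have "(F has_derivative (\<lambda>h. G (t, y) \<bullet> h)) (at (t, y) within (\<lambda>y. (t, y)) ` W)"
    using assms y unfolding C1_grad_def by (auto elim!: has_derivative_subset)
  then have "((\<lambda>y. F (t, y)) has_derivative (\<lambda>h. G (t, y) \<bullet> (0, h))) (at y within W)"
    by (intro has_derivative_in_compose[of "\<lambda>y. (t, y)" "\<lambda>h. (0, h)" y W F "\<lambda>h. G (t, y) \<bullet> h"])
      (auto intro!: derivative_eq_intros)
  then show "((\<lambda>y. F (t, y)) has_derivative (\<bullet>) (snd (G (t, y)))) (at y within W)"
    by (simp add: inner_prod_def)
qed

lemma C1_grad_at: "C1_grad W F G \<Longrightarrow> open W \<Longrightarrow> y \<in> W \<Longrightarrow> (F has_derivative (\<lambda>h. G y \<bullet> h)) (at y)"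
  unfolding C1_grad_def by (metis at_within_open)

lemma C1_grad_unique:
  assumes "C1_grad W F G" "C1_grad W F G'" "open W" "y \<in> W"
  shows "G y = G' y"
proof -
  have "(\<bullet>) (G y) = (\<bullet>) (G' y)"
    by (rule has_derivative_unique[OF C1_grad_at[OF assms(1,3,4)] C1_grad_at[OF assms(2,3,4)]])
  then have "G y \<bullet> h = G' y \<bullet> h" for h by metis
  then show ?thesis using vector_eq_rdot by blast
qed

lemma has_derivative_along_line:
  fixes F :: "'b::euclidean_space \<Rightarrow> real"
  assumes "(F has_derivative (\<lambda>h. G \<bullet> h)) (at (y + s *\<^sub>R e))"
  shows "((\<lambda>s. F (y + s *\<^sub>R e)) has_vector_derivative G \<bullet> e) (at s within U)"
proof -
  have "((\<lambda>s. y + s *\<^sub>R e) has_derivative (\<lambda>h. h *\<^sub>R e)) (at s within U)"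
    by (auto intro!: derivative_eq_intros)
  from has_derivative_compose[OF this assms] show ?thesis
    unfolding has_vector_derivative_def by simp
qed

text \<open>
  Schwarz's theorem for one time and one space derivative, including the end points of the time
  interval.  By the fundamental theorem of calculus, \<open>F(\<tau>, \<cdot>) - F(t\<^sub>0, \<cdot>)\<close> is the time integral of
  \<open>\<partial>\<^sub>tF\<close>; the space derivative may be taken under this integral, and the
  result is differentiated in \<open>\<tau>\<close>.
\<close>

lemma C1_mixed_partials:
  fixes F :: "real \<times> (real^'n) \<Rightarrow> real"
  assumes t01: "t0 < t1" and W: "open W"
    and F: "C1_grad ({t0..t1} \<times> W) F G"
    and P: "C1_grad ({t0..t1} \<times> W) (\<lambda>z. fst (G z)) P"
    and Q: "C1_grad ({t0..t1} \<times> W) (\<lambda>z. snd (G z) $ i) Q"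
    and t: "t \<in> {t0..t1}" and y: "y \<in> W"
  shows "fst (Q (t, y)) = snd (P (t, y)) $ i"
proof -
  let ?e = "axis i 1 :: real^'n"
  obtain \<epsilon> where \<epsilon>: "\<epsilon> > 0" "cball y \<epsilon> \<subseteq> W"
    using W y open_contains_cball by blast
  let ?U = "{-\<epsilon>..\<epsilon>}"
  have inW: "y + s *\<^sub>R ?e \<in> W" if "s \<in> ?U" for s
    using that \<epsilon> by (auto simp: dist_norm intro!: subsetD[OF \<epsilon>(2)])
  have cP: "continuous_on ({t0..t1} \<times> W) P" and cG: "continuous_on ({t0..t1} \<times> W) (\<lambda>z. fst (G z))"
    using P C1_grad_continuous[OF P] unfolding C1_grad_def by auto
  \<comment> \<open>The space derivative of the time integral, computed in two ways.\<close>
  have eq: "snd (G (\<tau>, y)) $ i - snd (G (t0, y)) $ i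
      = integral {t0..\<tau>} (\<lambda>\<sigma>. snd (P (\<sigma>, y)) $ i)" if \<tau>: "\<tau> \<in> {t0..t1}" for \<tau>
  proof -
    have ftc: "integral {t0..\<tau>} (\<lambda>\<sigma>. fst (G (\<sigma>, y + s *\<^sub>R ?e)))
        = F (\<tau>, y + s *\<^sub>R ?e) - F (t0, y + s *\<^sub>R ?e)" if s: "s \<in> ?U" for s
    proof (rule integral_unique, rule fundamental_theorem_of_calculus)
      fix x assume "x \<in> {t0..\<tau>}"
      then show "((\<lambda>a. F (a, y + s *\<^sub>R ?e)) has_vector_derivative fst (G (x, y + s *\<^sub>R ?e)))
         (at x within {t0..\<tau>})"
        using \<tau> inW[OF s]
        by (auto intro!: has_vector_derivative_within_subset[OF C1_grad_time[OF F]])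
    qed (use \<tau> in auto)
    have "((\<lambda>s. integral (cbox t0 \<tau>) (\<lambda>\<sigma>. fst (G (\<sigma>, y + s *\<^sub>R ?e)))) has_vector_derivative
        integral (cbox t0 \<tau>) (\<lambda>\<sigma>. snd (P (\<sigma>, y + 0 *\<^sub>R ?e)) $ i)) (at 0 within ?U)"
    proof (rule leibniz_rule_vector_derivative)
      fix s \<sigma> assume s: "s \<in> ?U" and \<sigma>: "\<sigma> \<in> cbox t0 \<tau>"
      have "((\<lambda>y. fst (G (\<sigma>, y))) has_derivative (\<lambda>h. snd (P (\<sigma>, y + s *\<^sub>R ?e)) \<bullet> h))
            (at (y + s *\<^sub>R ?e))"
        by (rule C1_grad_at[OF C1_grad_space[OF P] W inW]) (use s \<sigma> \<tau> in auto)
      from has_derivative_along_line[OF this]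
      show "((\<lambda>s. fst (G (\<sigma>, y + s *\<^sub>R ?e))) has_vector_derivative
          snd (P (\<sigma>, y + s *\<^sub>R ?e)) $ i) (at s within ?U)"
        by (simp add: inner_axis)
    next
      fix s assume s: "s \<in> ?U"
      show "(\<lambda>\<sigma>. fst (G (\<sigma>, y + s *\<^sub>R ?e))) integrable_on cbox t0 \<tau>"
        by (rule integrable_continuous, rule continuous_on_compose2[OF cG])
           (use s \<tau> inW in \<open>auto intro!: continuous_intros\<close>)
    next
      show "continuous_on (?U \<times> cbox t0 \<tau>) (\<lambda>(s, \<sigma>). snd (P (\<sigma>, y + s *\<^sub>R ?e)) $ i)"
        unfolding split_beta
        by (intro continuous_intros continuous_on_compose2[OF cP])
           (use \<tau> inW in auto)
    qed (use \<epsilon> in auto)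
    then have 1: "((\<lambda>s. F (\<tau>, y + s *\<^sub>R ?e) - F (t0, y + s *\<^sub>R ?e)) has_vector_derivative
        integral {t0..\<tau>} (\<lambda>\<sigma>. snd (P (\<sigma>, y)) $ i)) (at 0 within ?U)"
      using ftc \<epsilon> by (auto intro: has_vector_derivative_transform[rotated 2])
    have "((\<lambda>s. F (\<tau>', y + s *\<^sub>R ?e)) has_vector_derivative snd (G (\<tau>', y)) $ i) (at 0 within ?U)"
      if "\<tau>' \<in> {t0..t1}" for \<tau>'
      using has_derivative_along_line[of "\<lambda>y. F (\<tau>', y)" "snd (G (\<tau>', y))" y 0 ?e ?U]
        C1_grad_at[OF C1_grad_space[OF F that] W y] by (simp add: inner_axis)
    from has_vector_derivative_diff[OF this[OF \<tau>] this[of t0]] t01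
    have 2: "((\<lambda>s. F (\<tau>, y + s *\<^sub>R ?e) - F (t0, y + s *\<^sub>R ?e)) has_vector_derivative
        snd (G (\<tau>, y)) $ i - snd (G (t0, y)) $ i) (at 0 within ?U)" by auto
    show ?thesis
      by (rule vector_derivative_unique_within_closed_interval[unfolded cbox_interval, of "-\<epsilon>" \<epsilon> 0, OF _ _ 2 1])
         (use \<epsilon> in auto)
  qed
  have "((\<lambda>\<tau>. integral {t0..\<tau>} (\<lambda>\<sigma>. snd (P (\<sigma>, y)) $ i)) has_vector_derivative snd (P (t, y)) $ i)
      (at t within {t0..t1})"
    by (rule integral_has_vector_derivative)
       (use t y in \<open>auto intro!: continuous_intros continuous_on_compose2[OF cP]\<close>)
  then have "((\<lambda>\<tau>. snd (G (\<tau>, y)) $ i - snd (G (t0, y)) $ i) has_vector_derivative snd (P (t, y)) $ i)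
      (at t within {t0..t1})"
    using eq t by (auto intro: has_vector_derivative_transform[rotated 2])
  moreover have "((\<lambda>\<tau>. snd (G (\<tau>, y)) $ i - snd (G (t0, y)) $ i) has_vector_derivative
       fst (Q (t, y)) - 0) (at t within {t0..t1})"
    by (intro has_vector_derivative_diff has_vector_derivative_const C1_grad_time[OF Q t y])
  ultimately show ?thesis
    using vector_derivative_unique_within_closed_interval[unfolded cbox_interval, of t0 t1 t] t t01 by force
qed

section \<open>Integrals of compactly supported functions\<close>

lemma lborel_integral_cbox:
  fixes f :: "'b::euclidean_space \<Rightarrow> real"
  assumes c: "continuous_on (cbox a b) f" and z: "\<And>y. y \<notin> cbox a b \<Longrightarrow> f y = 0"
  shows "integrable lborel f" "integral\<^sup>L lborel f = integral (cbox a b) f"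
proof -
  have e: "(\<lambda>x. indicator (cbox a b) x *\<^sub>R f x) = f"
    using z by (auto simp: indicator_def fun_eq_iff)
  have "integrable lborel (\<lambda>x. indicator (cbox a b) x *\<^sub>R f x)"
    by (rule borel_integrable_compact[OF compact_cbox c])
  then show "integrable lborel f" "integral\<^sup>L lborel f = integral (cbox a b) f"
    using set_borel_integral_eq_integral(2)[of "cbox a b" f] e
    unfolding set_integrable_def set_lebesgue_integral_def by auto
qed

lemma lborel_leibniz:
  fixes f :: "real \<Rightarrow> 'b::euclidean_space \<Rightarrow> real"
  assumes d: "\<And>t y. t \<in> U \<Longrightarrow> ((\<lambda>t. f t y) has_vector_derivative f' t y) (at t within U)"
    and c: "\<And>t. t \<in> U \<Longrightarrow> continuous_on UNIV (f t)"
    and c': "continuous_on (U \<times> UNIV) (\<lambda>(t, y). f' t y)"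
    and z: "\<And>t y. t \<in> U \<Longrightarrow> y \<notin> cbox a b \<Longrightarrow> f t y = 0"
           "\<And>t y. t \<in> U \<Longrightarrow> y \<notin> cbox a b \<Longrightarrow> f' t y = 0"
    and U: "convex U" "t \<in> U"
  shows "((\<lambda>t. \<integral>y. f t y \<partial>lborel) has_vector_derivative (\<integral>y. f' t y \<partial>lborel)) (at t within U)"
proof -
  have 1: "(\<integral>y. f t y \<partial>lborel) = integral (cbox a b) (f t)" if "t \<in> U" for t
    by (rule lborel_integral_cbox(2)[OF continuous_on_subset[OF c[OF that] subset_UNIV] z(1)[OF that]])
  have c2: "continuous_on UNIV (f' t)"
  proof -
    have "continuous_on UNIV (\<lambda>y. (t, y))" by (intro continuous_intros)
    from continuous_on_compose2[OF c' this] U(2) show ?thesis by auto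
  qed
  have 2: "(\<integral>y. f' t y \<partial>lborel) = integral (cbox a b) (f' t)"
    by (rule lborel_integral_cbox(2)[OF continuous_on_subset[OF c2 subset_UNIV] z(2)[OF U(2)]])
  have "((\<lambda>t. integral (cbox a b) (f t)) has_vector_derivative integral (cbox a b) (f' t)) (at t within U)"
    by (rule leibniz_rule_vector_derivative[OF d _ _ U(2,1)])
       (auto intro!: integrable_continuous continuous_on_subset[OF c] continuous_on_subset[OF c'])
  then show ?thesis
    using 1 2 U by (auto intro: has_vector_derivative_transform[rotated 2])
qed

text \<open>
  The integral of \<open>F(y + s e)\<close> over \<open>y\<close> does not depend on \<open>s\<close>, by translation invariance; its derivative at
  \<open>s = 0\<close> is the integral of the derivative of \<open>F\<close> in the direction \<open>e\<close>.
\<close>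

lemma lborel_integral_partial_eq_0:
  fixes F :: "'b::euclidean_space \<Rightarrow> real"
  assumes F: "C1_grad UNIV F G" and K: "bounded K"
    and z: "\<And>y. y \<notin> K \<Longrightarrow> F y = 0" "\<And>y. y \<notin> K \<Longrightarrow> G y = 0"
  shows "(\<integral>y. G y \<bullet> e \<partial>lborel) = 0"
proof -
  let ?U = "{-1..1::real}"
  have dF: "(F has_derivative (\<lambda>h. G y \<bullet> h)) (at y)" for y
    using C1_grad_at[OF F] by auto
  have cF: "continuous_on UNIV F" and cG: "continuous_on UNIV G"
    using F C1_grad_continuous unfolding C1_grad_def by auto
  obtain B where B: "\<And>y. y \<in> K \<Longrightarrow> norm y \<le> B"
    using K unfolding bounded_iff by blast
  \<comment> \<open>A box that contains the supports of all translates with \<open>\<bar>s\<bar> \<le> 1\<close>.\<close>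
  obtain a where a: "cball 0 (B + norm e) \<subseteq> cbox (-a) (a::'b)"
    using bounded_subset_cbox_symmetric[OF bounded_cball] by blast
  have out: "y + s *\<^sub>R e \<notin> K" if "s \<in> ?U" "y \<notin> cbox (-a) a" for s y
  proof
    assume "y + s *\<^sub>R e \<in> K"
    then have "norm (y + s *\<^sub>R e) \<le> B" using B by blast
    moreover have "norm (s *\<^sub>R e) \<le> norm e"
      using that(1) by (auto intro!: mult_left_le_one_le)
    moreover have "norm y \<le> norm (y + s *\<^sub>R e) + norm (s *\<^sub>R e)"
      by (metis add_diff_cancel_right' norm_triangle_ineq4)
    ultimately show False using that(2) a by (auto simp: subset_iff)
  qed
  have "((\<lambda>s. \<integral>y. F (y + s *\<^sub>R e) \<partial>lborel) has_vector_derivative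
      (\<integral>y. G (y + 0 *\<^sub>R e) \<bullet> e \<partial>lborel)) (at 0 within ?U)"
  proof (rule lborel_leibniz[where a = "-a" and b = a])
    show "((\<lambda>s. F (y + s *\<^sub>R e)) has_vector_derivative G (y + s *\<^sub>R e) \<bullet> e) (at s within ?U)" for s y
      by (rule has_derivative_along_line[OF dF])
    show "continuous_on UNIV (\<lambda>y. F (y + s *\<^sub>R e))" for s
      by (intro continuous_on_compose2[OF cF] continuous_intros) auto
    show "continuous_on (?U \<times> UNIV) (\<lambda>(s, y). G (y + s *\<^sub>R e) \<bullet> e)"
      unfolding split_beta by (intro continuous_intros continuous_on_compose2[OF cG]) auto
  qed (use out z in auto)
  moreover have "(\<integral>y. F (y + s *\<^sub>R e) \<partial>lborel) = (\<integral>y. F y \<partial>lborel)" for s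
  proof -
    have "F \<in> borel_measurable borel"
      using cF borel_measurable_continuous_onI by blast
    then have "(\<integral>y. F y \<partial>distr lborel borel ((+) (s *\<^sub>R e))) = (\<integral>y. F (s *\<^sub>R e + y) \<partial>lborel)"
      by (subst integral_distr) auto
    then show ?thesis
      by (simp add: lborel_distr_plus add.commute)
  qed
  ultimately have "((\<lambda>s. \<integral>y. F y \<partial>lborel) has_vector_derivative (\<integral>y. G y \<bullet> e \<partial>lborel)) (at (0::real) within ?U)"
    by simp
  then show ?thesis
    using vector_derivative_unique_within_closed_interval[unfolded cbox_interval, of "-1" 1 "0::real", OF _ _ _ has_vector_derivative_const]
    by simp
qed

section \<open>Cut-off functions and integration by parts\<close>

text \<open>
  One continuous derivative suffices for integrating by parts once, so a power of a truncated
  polynomial does instead of a smooth bump function.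
\<close>

definition bump :: "'b::euclidean_space \<Rightarrow> real \<Rightarrow> 'b \<Rightarrow> real" where
  "bump a r y = (max 0 (r\<^sup>2 - (norm (y - a))\<^sup>2))\<^sup>2"

definition bump_grad :: "'b::euclidean_space \<Rightarrow> real \<Rightarrow> 'b \<Rightarrow> 'b" where
  "bump_grad a r y = (- 4 * max 0 (r\<^sup>2 - (norm (y - a))\<^sup>2)) *\<^sub>R (y - a)"

text \<open>
  The square removes the corner of \<open>max 0 s\<close> at \<open>s = 0\<close>.
\<close>

lemma DERIV_pos_part_squared: "((\<lambda>s::real. (max 0 s)\<^sup>2) has_real_derivative 2 * max 0 s) (at s)"
proof -
  consider "s > 0" | "s < 0" | "s = 0" by linarith
  then show ?thesis
  proof cases
    case 1
    have "((\<lambda>s::real. s\<^sup>2) has_real_derivative 2 * max 0 s) (at s)"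
      using 1 by (auto intro!: derivative_eq_intros)
    then show ?thesis
      by (rule has_field_derivative_transform_within_open[of _ _ _ "{0<..}"]) (use 1 in auto)
  next
    case 2
    have "((\<lambda>s::real. 0) has_real_derivative 2 * max 0 s) (at s)"
      using 2 by auto
    then show ?thesis
      by (rule has_field_derivative_transform_within_open[of _ _ _ "{..<0}"]) (use 2 in auto)
  next
    case 3
    have "((\<lambda>s::real. (max 0 s)\<^sup>2 / s) \<longlongrightarrow> 0) (at 0)"
    proof (rule tendsto_sandwich)
      show "((\<lambda>s::real. - \<bar>s\<bar>) \<longlongrightarrow> 0) (at 0)" by (auto intro!: tendsto_eq_intros)
      show "((\<lambda>s::real. \<bar>s\<bar>) \<longlongrightarrow> 0) (at 0)" by (auto intro!: tendsto_eq_intros)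
    qed (auto simp: eventually_at_filter max_def power2_eq_square divide_simps)
    then show ?thesis
      unfolding has_field_derivative_iff using 3 by simp
  qed
qed

lemma bump_C1: "C1_grad UNIV (bump a r) (bump_grad a r)"
  unfolding C1_grad_def
proof (intro conjI ballI)
  show "continuous_on UNIV (bump_grad a r)"
    unfolding bump_grad_def by (intro continuous_intros)
  fix y
  have "((\<lambda>y. r\<^sup>2 - (norm (y - a))\<^sup>2) has_derivative (\<lambda>h. - (2 * ((y - a) \<bullet> h)))) (at y)"
    unfolding power2_norm_eq_inner
    by (auto intro!: derivative_eq_intros simp: inner_commute)
  from has_derivative_compose[OF this DERIV_pos_part_squared[unfolded has_field_derivative_def]]
  show "(bump a r has_derivative (\<bullet>) (bump_grad a r y)) (at y)"
    unfolding bump_def[abs_def] bump_grad_def by (rule has_derivative_eq_rhs) (auto simp: fun_eq_iff)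
qed

lemma bump_nonneg: "0 \<le> bump a r y"
  unfolding bump_def by simp

lemma bump_pos:
  assumes "y \<in> ball a r" shows "0 < bump a r y"
proof -
  have "norm (y - a) < r" using assms by (simp add: dist_norm norm_minus_commute)
  then have "(norm (y - a))\<^sup>2 < r\<^sup>2" by (intro power_strict_mono) auto
  then show ?thesis unfolding bump_def by simp
qed

lemma bump_outside:
  assumes "y \<notin> cball a r" "0 < r" shows "bump a r y = 0" "bump_grad a r y = 0"
proof -
  have "r < norm (y - a)" using assms by (simp add: dist_norm norm_minus_commute)
  then have "r\<^sup>2 < (norm (y - a))\<^sup>2" using assms(2) by (intro power_strict_mono) auto
  then show "bump a r y = 0" "bump_grad a r y = 0" unfolding bump_def bump_grad_def by auto
qed

text \<open>
  Functions given in a chart become functions on the whole space when they are multiplied by a cut-off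
  function.  The values outside \<open>W\<close> are those of the product, which vanish because the cut-off
  function does.
\<close>

lemma continuous_on_extend_zero:
  fixes f :: "'c::topological_space \<times> 'b::topological_space \<Rightarrow> 'd::real_normed_vector"
  assumes f: "continuous_on (J \<times> W) f" and W: "open W" "closed K" "K \<subseteq> W"
    and z: "\<And>t y. t \<in> J \<Longrightarrow> y \<notin> K \<Longrightarrow> f (t, y) = 0"
  shows "continuous_on (J \<times> UNIV) f"
  unfolding continuous_on_def
proof
  fix p assume p: "p \<in> J \<times> (UNIV :: 'b set)"
  show "(f \<longlongrightarrow> f p) (at p within J \<times> UNIV)"
  proof (cases "snd p \<in> W")
    case True
    have "at p within J \<times> W = at p within J \<times> UNIV"
      by (rule at_within_nhd[of _ "UNIV \<times> W"]) (use True W in \<open>auto intro: open_Times simp: mem_Times_iff\<close>)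
    then show ?thesis using f p True unfolding continuous_on_def by (metis mem_Times_iff)
  next
    case False
    have "at p within J \<times> (- K) = at p within J \<times> UNIV"
      by (rule at_within_nhd[of _ "UNIV \<times> (- K)"])
         (use False W in \<open>auto intro!: open_Times simp: mem_Times_iff\<close>)
    moreover have "continuous_on (J \<times> (- K)) (\<lambda>_. 0 :: 'd)" by simp
    then have "continuous_on (J \<times> (- K)) f"
      by (rule continuous_on_eq) (use z in auto)
    ultimately show ?thesis
      using p False W unfolding continuous_on_def by (metis ComplI mem_Times_iff subsetD)
  qed
qed

lemma continuous_on_extend_zero_UNIV:
  fixes f :: "'b::topological_space \<Rightarrow> 'd::real_normed_vector"
  assumes f: "continuous_on W f" and W: "open W" "closed K" "K \<subseteq> W"
    and z: "\<And>y. y \<notin> K \<Longrightarrow> f y = 0"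
  shows "continuous_on UNIV f"
proof -
  have "continuous_on (- K) (\<lambda>_. 0 :: 'd)" by simp
  then have "continuous_on (- K) f" by (rule continuous_on_eq) (use z in auto)
  then have "continuous_on (W \<union> - K) f"
    using f W by (intro continuous_on_open_Un) auto
  moreover have "W \<union> - K = UNIV" using W by auto
  ultimately show ?thesis by simp
qed

lemma C1_grad_cutoff_mult:
  fixes h :: "'b::euclidean_space \<Rightarrow> real"
  assumes b: "C1_grad UNIV b b'" and h: "C1_grad W h h'"
    and W: "open W" "closed K" "K \<subseteq> W"
    and z: "\<And>y. y \<notin> K \<Longrightarrow> b y = 0" "\<And>y. y \<notin> K \<Longrightarrow> b' y = 0"
  shows "C1_grad UNIV (\<lambda>y. b y * h y) (\<lambda>y. b y *\<^sub>R h' y + h y *\<^sub>R b' y)" (is "C1_grad UNIV ?F ?G")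
proof -
  have F: "C1_grad W ?F ?G"
    by (rule C1_grad_mult[OF C1_grad_subset[OF b] h]) auto
  show ?thesis unfolding C1_grad_def
  proof (intro conjI ballI)
    show "continuous_on UNIV ?G"
      by (rule continuous_on_extend_zero_UNIV[OF _ W]) (use F z in \<open>auto simp: C1_grad_def\<close>)
    fix y
    show "(?F has_derivative (\<bullet>) (?G y)) (at y)"
    proof (cases "y \<in> W")
      case True
      then show ?thesis using C1_grad_at[OF F W(1)] by blast
    next
      case False
      then have "b y = 0" "b' y = 0" using z W by auto
      then have "(\<bullet>) (?G y) = (\<lambda>_. 0)" by (simp add: fun_eq_iff)
      then have "((\<lambda>y. 0) has_derivative (\<bullet>) (?G y)) (at y)" by simp
      then show ?thesis
        by (rule has_derivative_transform_within_open[of _ _ _ _ "- K"]) (use False W z in auto)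
    qed
  qed
qed

lemma integrable_compact_support:
  fixes f :: "'b::euclidean_space \<Rightarrow> real"
  assumes "continuous_on UNIV f" "bounded K" "\<And>y. y \<notin> K \<Longrightarrow> f y = 0"
  shows "integrable lborel f"
proof -
  obtain a where "K \<subseteq> cbox (-a) a" using bounded_subset_cbox_symmetric[OF assms(2)] by blast
  then show ?thesis
    by (intro lborel_integral_cbox(1)[of "-a" a]) (use assms in \<open>auto intro: continuous_on_subset\<close>)
qed

text \<open>
  The divergence of \<open>b u X\<close>, where \<open>b\<close> is the cut-off function, has integral zero.
\<close>

lemma cutoff_integration_by_parts:
  fixes u :: "real^'n \<Rightarrow> real"
  assumes b: "C1_grad UNIV b b'" and X: "\<And>j. C1_grad W (X j) (X' j)" and u: "C1_grad W u u'"
    and W: "open W" "compact K" "K \<subseteq> W"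
    and z: "\<And>y. y \<notin> K \<Longrightarrow> b y = 0" "\<And>y. y \<notin> K \<Longrightarrow> b' y = 0"
  shows "(\<integral>y. b y * (\<Sum>j\<in>UNIV. X j y * u' y $ j) \<partial>lborel)
       = - (\<integral>y. u y * (\<Sum>j\<in>UNIV. b y * X' j y $ j + X j y * b' y $ j) \<partial>lborel)"
proof -
  note K = compact_imp_closed[OF W(2)] compact_imp_bounded[OF W(2)]
  have cb: "continuous_on W b" "continuous_on W b'"
    using b C1_grad_continuous[OF b] unfolding C1_grad_def by (auto elim: continuous_on_subset)
  have cX: "continuous_on W (X j)" "continuous_on W (X' j)" for j
    using X C1_grad_continuous[OF X] unfolding C1_grad_def by auto
  have cu: "continuous_on W u" "continuous_on W u'"
    using u C1_grad_continuous[OF u] unfolding C1_grad_def by auto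
  let ?L = "\<lambda>y. b y * (\<Sum>j\<in>UNIV. X j y * u' y $ j)"
  let ?R = "\<lambda>y. u y * (\<Sum>j\<in>UNIV. b y * X' j y $ j + X j y * b' y $ j)"
  define G where "G j y = b y *\<^sub>R (X j y *\<^sub>R u' y + u y *\<^sub>R X' j y) + (X j y * u y) *\<^sub>R b' y" for j y
  have F: "C1_grad UNIV (\<lambda>y. b y * (X j y * u y)) (G j)" for j
    unfolding G_def[abs_def]
    by (rule C1_grad_cutoff_mult[OF b C1_grad_mult[OF X u] W(1) K(1) W(3) z])
  have G0: "(\<integral>y. G j y \<bullet> axis j 1 \<partial>lborel) = 0" for j
    by (rule lborel_integral_partial_eq_0[OF F K(2)]) (auto simp: z G_def)
  have cG: "continuous_on UNIV (G j)" for j using F unfolding C1_grad_def by blast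
  have intG: "integrable lborel (\<lambda>y. G j y \<bullet> axis j 1)" for j
    by (rule integrable_compact_support[OF continuous_on_inner[OF cG continuous_on_const] K(2)])
      (simp add: z G_def)
  have iL: "integrable lborel ?L"
    by (rule integrable_compact_support[OF continuous_on_extend_zero_UNIV[OF _ W(1) K(1) W(3)] K(2)])
       (auto intro!: continuous_intros cb cX cu simp: z)
  have iR: "integrable lborel ?R"
    by (rule integrable_compact_support[OF continuous_on_extend_zero_UNIV[OF _ W(1) K(1) W(3)] K(2)])
       (auto intro!: continuous_intros cb cX cu simp: z)
  have "?L y + ?R y = (\<Sum>j\<in>UNIV. G j y \<bullet> axis j 1)" for y
    unfolding G_def inner_axis
    by (simp add: sum_distrib_left sum.distrib[symmetric] algebra_simps)
  then have "(\<integral>y. ?L y \<partial>lborel) + (\<integral>y. ?R y \<partial>lborel) = (\<integral>y. (\<Sum>j\<in>UNIV. G j y \<bullet> axis j 1) \<partial>lborel)"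
    by (simp add: Bochner_Integration.integral_add[OF iL iR, symmetric])
  also have "\<dots> = 0" using intG G0 by (simp add: Bochner_Integration.integral_sum)
  finally show ?thesis by simp
qed

lemma continuous_bounded_on_compact:
  fixes f :: "real \<times> 'b::euclidean_space \<Rightarrow> real"
  assumes "continuous_on ({t0..t1} \<times> W) f" "compact K" "K \<subseteq> W"
  shows "\<exists>B\<ge>0. \<forall>t\<in>{t0..t1}. \<forall>y\<in>K. \<bar>f (t, y)\<bar> \<le> B"
proof -
  have "compact (f ` ({t0..t1} \<times> K))"
    by (intro compact_continuous_image compact_Times continuous_on_subset[OF assms(1)])
       (use assms in auto)
  then obtain B where "\<forall>x\<in>f ` ({t0..t1} \<times> K). norm x \<le> B"
    using compact_imp_bounded bounded_iff by blast
  then show ?thesis by (intro exI[of _ "max 0 B"]) (auto simp: le_max_iff_disj)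
qed

section \<open>Charts of a compact manifold\<close>

locale compact_smooth_manifold =
  fixes M :: "'a topology" and A :: "('a, 'n::finite) chart set"
  assumes closed_manifold: "closed_manifold M A"
begin

lemma atlas:
  shows "\<Union>(cdom ` A) = topspace M"
    and "c \<in> A \<Longrightarrow> openin M (cdom c)" and "c \<in> A \<Longrightarrow> open (cimg c)"
    and "c \<in> A \<Longrightarrow> homeomorphic_map (subtopology M (cdom c)) (top_of_set (cimg c)) (cmap c)"
  using closed_manifold unfolding closed_manifold_def smooth_atlas_def by auto

lemma cdom_subset: "c \<in> A \<Longrightarrow> cdom c \<subseteq> topspace M"
  using atlas(1) by blast

lemma chart_inj: "c \<in> A \<Longrightarrow> inj_on (cmap c) (cdom c)"
  using atlas(4)[of c] cdom_subset[of c] unfolding homeomorphic_eq_everything_map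
  by (simp add: inf.absorb2)

lemma cinv_cmap: "c \<in> A \<Longrightarrow> x \<in> cdom c \<Longrightarrow> cinv c (cmap c x) = x"
  unfolding cinv_def by (simp add: chart_inj)

lemma cmap_cinv: "y \<in> cimg c \<Longrightarrow> cmap c (cinv c y) = y"
  unfolding cinv_def cimg_def by (simp add: f_inv_into_f)

lemma cinv_in: "y \<in> cimg c \<Longrightarrow> cinv c y \<in> cdom c"
  unfolding cinv_def cimg_def by (simp add: inv_into_into)

lemma cmap_in: "x \<in> cdom c \<Longrightarrow> cmap c x \<in> cimg c"
  unfolding cimg_def by blast

lemma open_cmap_image:
  assumes "c \<in> A" "openin M U" "U \<subseteq> cdom c"
  shows "open (cmap c ` U)"
proof -
  have "open_map (subtopology M (cdom c)) (top_of_set (cimg c)) (cmap c)"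
    using atlas(4)[OF assms(1)] homeomorphic_imp_open_map by blast
  then have "openin (top_of_set (cimg c)) (cmap c ` U)"
    unfolding open_map_def using assms atlas(2) by (simp add: openin_open_subtopology)
  then show ?thesis using atlas(3)[OF assms(1)] openin_open_trans by blast
qed

lemma continuous_map_cmap: "c \<in> A \<Longrightarrow> continuous_map (subtopology M (cdom c)) euclidean (cmap c)"
  using atlas(4)[of c] homeomorphic_imp_continuous_map continuous_map_into_fulltopology by blast

lemma continuous_map_cinv:
  assumes "c \<in> A" shows "continuous_map (top_of_set (cimg c)) M (cinv c)"
  unfolding continuous_map_def
proof (intro conjI allI impI)
  show "cinv c \<in> topspace (top_of_set (cimg c)) \<rightarrow> topspace M"
    using cinv_in[of _ c] cdom_subset[OF assms] unfolding Pi_iff topspace_euclidean_subtopology by blast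
  fix U assume U: "openin M U"
  have "{y \<in> cimg c. cinv c y \<in> U} = cmap c ` (U \<inter> cdom c)"
  proof (intro equalityI subsetI)
    fix y assume "y \<in> {y \<in> cimg c. cinv c y \<in> U}"
    then show "y \<in> cmap c ` (U \<inter> cdom c)"
      using cinv_in[of y c] cmap_cinv[of y c] by (intro image_eqI[of _ _ "cinv c y"]) auto
  next
    fix y assume "y \<in> cmap c ` (U \<inter> cdom c)"
    then show "y \<in> {y \<in> cimg c. cinv c y \<in> U}"
      using cinv_cmap[OF assms] cmap_in[of _ c] by auto
  qed
  moreover have "open (cmap c ` (U \<inter> cdom c))"
    using open_cmap_image[OF assms] U atlas(2)[OF assms] by (simp add: openin_Int)
  ultimately have "open {y \<in> cimg c. cinv c y \<in> U}" by simp
  then show "openin (top_of_set (cimg c)) {y \<in> topspace (top_of_set (cimg c)). cinv c y \<in> U}"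
    unfolding topspace_euclidean_subtopology by (intro open_subset) auto
qed

lemma continuous_on_chart:
  assumes "c \<in> A" "continuous_map M euclideanreal F"
  shows "continuous_on (cimg c) (\<lambda>y. F (cinv c y))"
  using continuous_map_compose[OF continuous_map_cinv[OF assms(1)] assms(2)]
  by (simp add: o_def)

lemma continuous_map_on_cdom:
  assumes "c \<in> A" "continuous_on (cimg c) f"
  shows "continuous_map (subtopology M (cdom c)) euclideanreal (\<lambda>x. f (cmap c x))"
proof -
  have "continuous_map (subtopology M (cdom c)) (top_of_set (cimg c)) (cmap c)"
    using atlas(4)[OF assms(1)] homeomorphic_imp_continuous_map by blast
  moreover have "continuous_map (top_of_set (cimg c)) euclideanreal f" using assms(2) by simp
  ultimately show ?thesis
    using continuous_map_compose[of _ _ "cmap c" euclideanreal f] by (simp add: o_def)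
qed

text \<open>
  The converse of \<open>continuous_on_chart\<close>: the domains of the charts are an open cover, and on each of them
  the function is a continuous function of the coordinates.
\<close>

lemma continuous_map_if_charts:
  assumes "\<And>c. c \<in> A \<Longrightarrow> continuous_on (cimg c) (\<lambda>y. F (cinv c y))"
  shows "continuous_map M euclideanreal F"
proof (rule pasting_lemma[of A M cdom _ "\<lambda>_. F"])
  fix c assume c: "c \<in> A"
  have "continuous_map (subtopology M (cdom c)) euclideanreal (\<lambda>x. F (cinv c (cmap c x)))"
    by (rule continuous_map_on_cdom[OF c assms[OF c]])
  then show "continuous_map (subtopology M (cdom c)) euclideanreal F"
    by (rule continuous_map_eq) (simp add: cinv_cmap[OF c])
next
  show "\<exists>c. c \<in> A \<and> x \<in> cdom c \<and> F x = F x" if "x \<in> topspace M" for x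
    using that atlas(1) by blast
qed (use atlas(2) in blast)+

text \<open>
  The density, with respect to the volume of \<open>g\<close>, of the measure that has the Lebesgue density \<open>G\<close> in the
  coordinates of the chart \<open>c\<close>.
\<close>

definition push :: "('a, 'n) tensor2 \<Rightarrow> ('a, 'n) chart \<Rightarrow> (real^'n \<Rightarrow> real) \<Rightarrow> 'a \<Rightarrow> real" where
  "push g c G x = (if x \<in> cdom c then G (cmap c x) / sqrt (det (g c x)) else 0)"

text \<open>
  Around each point, a closed coordinate ball fits into the image of a chart; compactness selects
  finitely many such balls whose interiors cover the manifold.
\<close>

lemma chart_cover:
  obtains N where "finite N"
    and "\<And>c a r. (c, a, r) \<in> N \<Longrightarrow> c \<in> A \<and> 0 < r \<and> cball a r \<subseteq> cimg c"
    and "\<And>x. x \<in> topspace M \<Longrightarrow> \<exists>(c, a, r)\<in>N. x \<in> cdom c \<and> cmap c x \<in> ball a r"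
proof -
  define P where "P = {(c, a, r). c \<in> A \<and> 0 < r \<and> cball a r \<subseteq> cimg c}"
  define B :: "('a, 'n) chart \<times> (real^'n) \<times> real \<Rightarrow> 'a set" where "B = (\<lambda>(c, a, r). {x \<in> cdom c. cmap c x \<in> ball a r})"
  have oB: "openin M (B p)" if p: "p \<in> P" for p
  proof -
    obtain c a r where [simp]: "p = (c, a, r)" by (cases p)
    have c: "c \<in> A" using p unfolding P_def by simp
    have "openin (subtopology M (cdom c)) {x \<in> topspace (subtopology M (cdom c)). cmap c x \<in> ball a r}"
      by (rule openin_continuous_map_preimage[OF continuous_map_cmap[OF c]]) simp
    moreover have "{x \<in> topspace (subtopology M (cdom c)). cmap c x \<in> ball a r} = B p"
      using cdom_subset[OF c] unfolding B_def by auto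
    ultimately show ?thesis using openin_trans_full atlas(2)[OF c] by metis
  qed
  have cov: "topspace M \<subseteq> \<Union>(B ` P)"
  proof
    fix x assume "x \<in> topspace M"
    then obtain c where c: "c \<in> A" "x \<in> cdom c" using atlas(1) by blast
    then obtain r where "0 < r" "cball (cmap c x) r \<subseteq> cimg c"
      using atlas(3) cmap_in open_contains_cball by metis
    then have "(c, cmap c x, r) \<in> P" "x \<in> B (c, cmap c x, r)"
      using c unfolding P_def B_def by auto
    then show "x \<in> \<Union>(B ` P)" by blast
  qed
  have "compact_space M" using closed_manifold unfolding closed_manifold_def by blast
  then have "\<exists>F. finite F \<and> F \<subseteq> B ` P \<and> topspace M \<subseteq> \<Union>F"
    unfolding compact_space_alt by (elim allE[of _ "B ` P"]) (use oB cov in simp)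
  then obtain F where F: "finite F" "F \<subseteq> B ` P" "topspace M \<subseteq> \<Union>F" by (elim exE conjE)
  obtain N where N: "finite N" "N \<subseteq> P" "topspace M \<subseteq> \<Union>(B ` N)"
    using finite_subset_image[OF F(1,2)] F(3) by blast
  show ?thesis
  proof (rule that[OF N(1)])
    show "\<And>c a r. (c, a, r) \<in> N \<Longrightarrow> c \<in> A \<and> 0 < r \<and> cball a r \<subseteq> cimg c"
      using N(2) unfolding P_def by auto
    show "\<exists>(c, a, r)\<in>N. x \<in> cdom c \<and> cmap c x \<in> ball a r" if "x \<in> topspace M" for x
      using N(3) that unfolding B_def by fastforce
  qed
qed

text \<open>
  Numbering the balls separates the chart, the centre and the radius, which can then be
  parameters of a locale.
\<close>

lemma chart_cover_indexed:
  "\<exists>(n::nat) ch ce ra.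
     (\<forall>k<n. ch k \<in> A \<and> 0 < ra k \<and> cball (ce k) (ra k) \<subseteq> cimg (ch k)) \<and>
     (\<forall>x\<in>topspace M. \<exists>k<n. x \<in> cdom (ch k) \<and> cmap (ch k) x \<in> ball (ce k) (ra k))"
proof -
  obtain N where N: "finite N"
    and P: "\<And>c a r. (c, a, r) \<in> N \<Longrightarrow> c \<in> A \<and> 0 < r \<and> cball a r \<subseteq> cimg c"
    and cov: "\<And>x. x \<in> topspace M \<Longrightarrow> \<exists>(c, a, r)\<in>N. x \<in> cdom c \<and> cmap c x \<in> ball a r"
    using chart_cover by blast
  obtain n :: nat and f where Nf: "N = f ` {i. i < n}"
    using finite_imp_nat_seg_image_inj_on[OF N] by blast
  have P': "fst (f k) \<in> A \<and> 0 < snd (snd (f k)) \<and> cball (fst (snd (f k))) (snd (snd (f k))) \<subseteq> cimg (fst (f k))"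
    if "k < n" for k
    using P[of "fst (f k)" "fst (snd (f k))" "snd (snd (f k))"] Nf that by simp
  have "\<exists>k<n. x \<in> cdom (fst (f k)) \<and> cmap (fst (f k)) x \<in> ball (fst (snd (f k))) (snd (snd (f k)))"
    if xM: "x \<in> topspace M" for x
  proof -
    obtain p where p: "p \<in> N" "x \<in> cdom (fst p) \<and> cmap (fst p) x \<in> ball (fst (snd p)) (snd (snd p))"
      using cov[OF xM] unfolding split_beta by blast
    then obtain k where "k < n" "p = f k" using Nf by blast
    then show ?thesis using p(2) by blast
  qed
  with P' show ?thesis
    by (intro exI[of _ n] exI[of _ "\<lambda>k. fst (f k)"] exI[of _ "\<lambda>k. fst (snd (f k))"]
        exI[of _ "\<lambda>k. snd (snd (f k))"]) blast
qed

end

context compact_smooth_manifold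
begin

text \<open>
  The domain of the chart and the complement of the compact image of \<open>K\<close> are an open cover;
  the function vanishes on the second of these sets.  The complement is open because \<open>M\<close> is a Hausdorff space.
\<close>

lemma push_continuous:
  assumes c: "c \<in> A" and G: "continuous_on (cimg c) G"
    and K: "compact K" "K \<subseteq> cimg c" and z: "\<And>y. y \<notin> K \<Longrightarrow> G y = 0"
    and det: "continuous_on (cimg c) (\<lambda>y. det (g c (cinv c y)))"
    and pos: "\<And>x. x \<in> cdom c \<Longrightarrow> 0 < det (g c x)"
  shows "continuous_map M euclideanreal (push g c G)"
proof -
  let ?K = "cinv c ` K" and ?h = "\<lambda>y. G y / sqrt (det (g c (cinv c y)))"
  have "compactin (top_of_set (cimg c)) K" using K by (simp add: compactin_subtopology)
  then have "closedin M ?K"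
    using closed_manifold image_compactin[OF _ continuous_map_cinv[OF c]] compactin_imp_closedin
    unfolding closed_manifold_def by blast
  then have o: "openin M (topspace M - ?K)" by blast
  have KD: "?K \<subseteq> cdom c" using K(2) cinv_in by blast
  have "0 < det (g c (cinv c y))" if "y \<in> cimg c" for y using pos cinv_in[OF that] by blast
  then have "continuous_on (cimg c) ?h"
    by (intro continuous_intros G det) (metis less_irrefl real_sqrt_gt_zero)
  from continuous_map_on_cdom[OF c this]
  have 1: "continuous_map (subtopology M (cdom c)) euclideanreal (push g c G)"
    by (rule continuous_map_eq) (auto simp: push_def cinv_cmap[OF c])
  have push0: "push g c G x = 0" if "x \<in> topspace M - ?K" for x
  proof -
    have "cmap c x \<notin> K" if "x \<in> cdom c"
      using \<open>x \<in> topspace M - ?K\<close> cinv_cmap[OF c that] by (metis DiffD2 image_eqI)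
    then show ?thesis by (simp add: push_def z)
  qed
  have 2: "continuous_map (subtopology M (topspace M - ?K)) euclideanreal (push g c G)"
  proof (rule continuous_map_eq[of _ _ "\<lambda>_. 0"])
    show "0 = push g c G x" if "x \<in> topspace (subtopology M (topspace M - ?K))" for x
      using push0[of x] that by simp
  qed simp
  let ?U = "{cdom c, topspace M - ?K}"
  show ?thesis
  proof (rule pasting_lemma[of ?U M "\<lambda>U. U" _ "\<lambda>_. push g c G"])
    show "openin M U" if "U \<in> ?U" for U using that o atlas(2)[OF c] by blast
    show "continuous_map (subtopology M U) euclideanreal (push g c G)" if "U \<in> ?U" for U
      using that 1 2 by blast
    show "\<exists>U. U \<in> ?U \<and> x \<in> U \<and> push g c G x = push g c G x" if "x \<in> topspace M" for x
    proof (cases "x \<in> ?K")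
      case True then show ?thesis using KD by (intro exI[of _ "cdom c"]) auto
    next
      case False then show ?thesis using that by (intro exI[of _ "topspace M - ?K"]) auto
    qed
  qed simp
qed

text \<open>
  The defining property of the volume measure says that the image of its restriction to \<open>cdom c\<close> under
  the coordinate map has the density \<open>sqrt (det g\<^sub>i\<^sub>j)\<close>, which is the denominator in
  \<open>push\<close>.
\<close>

lemma push_integral:
  assumes c: "c \<in> A" and \<mu>: "volume_measure M A g \<mu>"
    and G: "continuous_on (cimg c) G" and K: "compact K" "K \<subseteq> cimg c"
    and z: "\<And>y. y \<notin> K \<Longrightarrow> G y = 0"
    and det: "continuous_on (cimg c) (\<lambda>y. det (g c (cinv c y)))"
    and pos: "\<And>x. x \<in> cdom c \<Longrightarrow> 0 < det (g c x)"
  shows "has_bochner_integral \<mu> (push g c G) (\<integral>y. G y \<partial>lborel)"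
proof -
  let ?\<rho> = "\<lambda>y. indicator (cimg c) y *\<^sub>R sqrt (det (g c (cinv c y)))"
  let ?H = "\<lambda>y. indicator (cimg c) y *\<^sub>R (G y / sqrt (det (g c (cinv c y))))"
  let ?R = "restrict_space \<mu> (cdom c)"
  have sp: "space \<mu> = topspace M" and sm: "sets \<mu> = sigma_sets (topspace M) {U. openin M U}"
    using \<mu> unfolding volume_measure_def by auto
  have op: "U \<in> sets \<mu>" if "openin M U" for U
    unfolding sm using that by (auto intro: sigma_sets.Basic)
  note cd = op[OF atlas(2)[OF c]]
  have pos': "0 < det (g c (cinv c y))" if "y \<in> cimg c" for y using pos cinv_in[OF that] by blast
  have oc: "cimg c \<in> sets borel" using atlas(3)[OF c] by simp
  have \<rho>[measurable]: "?\<rho> \<in> borel_measurable borel"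
    by (intro borel_measurable_continuous_on_indicator oc continuous_intros det)
  have H[measurable]: "?H \<in> borel_measurable borel"
  proof (intro borel_measurable_continuous_on_indicator oc continuous_intros G det ballI)
    show "sqrt (det (g c (cinv c y))) \<noteq> 0" if "y \<in> cimg c" for y using pos'[OF that] by simp
  qed
  have sR: "space ?R = cdom c" using cdom_subset[OF c] sp by (auto simp: space_restrict_space)
  have pre: "{x \<in> cdom c. cmap c x \<in> E} \<in> sets \<mu>" if "open E" for E
  proof -
    have "openin (subtopology M (cdom c)) {x \<in> topspace (subtopology M (cdom c)). cmap c x \<in> E}"
      by (rule openin_continuous_map_preimage[OF continuous_map_cmap[OF c]]) (use that in simp)
    moreover have "topspace (subtopology M (cdom c)) = cdom c" using cdom_subset[OF c] by auto
    ultimately show ?thesis using op openin_trans_full atlas(2)[OF c] by metis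
  qed
  have cm[measurable]: "cmap c \<in> borel_measurable ?R"
  proof (rule borel_measurableI)
    fix E :: "(real^'n) set" assume "open E"
    moreover have "cmap c -` E \<inter> space ?R = {x \<in> cdom c. cmap c x \<in> E}" using sR by auto
    ultimately show "cmap c -` E \<inter> space ?R \<in> sets ?R"
      using pre cd sR by (auto simp: sets_restrict_space_iff sp cdom_subset[OF c] Int_absorb2)
  qed
  \<comment> \<open>The volume measure in coordinates.\<close>
  have distr: "distr ?R borel (cmap c) = density lborel (\<lambda>y. ennreal (?\<rho> y))"
  proof (rule measure_eqI)
    fix E assume "E \<in> sets (distr ?R borel (cmap c))"
    then have E[measurable]: "E \<in> sets borel" by simp
    let ?B = "{x \<in> cdom c. cmap c x \<in> E}"
    have B: "cmap c -` E \<inter> space ?R = ?B" using sR by auto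
    have "?B \<in> sets ?R" using measurable_sets[OF cm E] B by simp
    then have B\<mu>: "?B \<in> sets \<mu>" using cd sR by (auto simp: sets_restrict_space_iff sp cdom_subset[OF c] Int_absorb2)
    have im: "cmap c ` ?B = E \<inter> cimg c" unfolding cimg_def by auto
    have "emeasure (distr ?R borel (cmap c)) E = emeasure ?R ?B"
      by (simp add: emeasure_distr[OF cm E] B)
    also have "\<dots> = emeasure \<mu> ?B"
      by (rule emeasure_restrict_space) (use cd cdom_subset[OF c] sp in \<open>auto simp: Int_absorb2\<close>)
    also have "\<dots> = (\<integral>\<^sup>+ y. ennreal (sqrt (det (g c (cinv c y)))) * indicator (cmap c ` ?B) y \<partial>lborel)"
      using \<mu> c B\<mu> unfolding volume_measure_def by auto
    also have "\<dots> = (\<integral>\<^sup>+ y. ennreal (?\<rho> y) * indicator E y \<partial>lborel)"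
      unfolding im by (intro nn_integral_cong) (auto simp: indicator_def)
    also have "\<dots> = emeasure (density lborel (\<lambda>y. ennreal (?\<rho> y))) E"
    proof (rule emeasure_density[symmetric])
      show "(\<lambda>y. ennreal (?\<rho> y)) \<in> borel_measurable lborel"
        using \<rho> by (intro measurable_compose[OF _ measurable_ennreal]) simp
    qed simp
    finally show "emeasure (distr ?R borel (cmap c)) E = \<dots>" .
  qed simp
  have contG: "continuous_on UNIV G"
    by (rule continuous_on_extend_zero_UNIV[OF G atlas(3)[OF c] compact_imp_closed[OF K(1)] K(2) z])
  have "integrable lborel G"
    by (rule integrable_compact_support[OF contG compact_imp_bounded[OF K(1)] z])
  moreover have "?\<rho> y *\<^sub>R ?H y = G y" for y
    using pos'[of y] z[of y] K(2) by (auto simp: indicator_def)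
  ultimately have i: "has_bochner_integral lborel (\<lambda>y. ?\<rho> y *\<^sub>R ?H y) (\<integral>y. G y \<partial>lborel)"
    by (simp add: has_bochner_integral_integrable)
  have l: "?H \<in> borel_measurable lborel" "?\<rho> \<in> borel_measurable lborel" using H \<rho> by simp_all
  have "AE y in lborel. 0 \<le> ?\<rho> y"
    using pos' less_imp_le by (intro AE_I2) (auto simp: indicator_def)
  then have "has_bochner_integral (density lborel (\<lambda>y. ennreal (?\<rho> y))) ?H (\<integral>y. G y \<partial>lborel)"
    by (rule has_bochner_integral_density[OF l _ i])
  then have "has_bochner_integral ?R (\<lambda>x. ?H (cmap c x)) (\<integral>y. G y \<partial>lborel)"
    unfolding distr[symmetric] has_bochner_integral_iff
    by (simp only: integrable_distr_eq[OF cm H] integral_distr[OF cm H])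
  then have "has_bochner_integral \<mu> (\<lambda>x. indicator (cdom c) x *\<^sub>R ?H (cmap c x)) (\<integral>y. G y \<partial>lborel)"
    by (subst (asm) has_bochner_integral_restrict_space) (use cd cdom_subset[OF c] sp in \<open>auto simp: Int_absorb2\<close>)
  moreover have "indicator (cdom c) x *\<^sub>R ?H (cmap c x) = push g c G x" for x
    using cmap_in[of x c] cinv_cmap[OF c, of x] by (auto simp: push_def indicator_def)
  ultimately show ?thesis by simp
qed

end

section \<open>Chart independence of the gradient norm\<close>

lemma pos_def_det:
  fixes B :: "real^'n^'n"
  assumes "\<And>\<xi>. \<xi> \<noteq> 0 \<Longrightarrow> \<xi> \<bullet> (B *v \<xi>) > 0"
  shows "invertible B" "det B \<noteq> 0"
proof -
  have "inj ((*v) B)"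
  proof (rule injI)
    fix x y assume "B *v x = B *v y"
    then have "(x - y) \<bullet> (B *v (x - y)) = 0" by (simp add: matrix_vector_mult_diff_distrib)
    then show "x = y" using assms[of "x - y"] by force
  qed
  then show "invertible B"
    using invertible_left_inverse matrix_left_invertible_injective by blast
  then show "det B \<noteq> 0" using invertible_det_nz by blast
qed

text \<open>
  The determinant has no zero on the segment from the identity to \<open>B\<close>, because every matrix on it is
  positive definite.
\<close>

lemma pos_def_det_pos:
  fixes B :: "real^'n^'n"
  assumes "\<And>\<xi>. \<xi> \<noteq> 0 \<Longrightarrow> \<xi> \<bullet> (B *v \<xi>) > 0"
  shows "det B > 0"
proof -
  define P where "P s = (1 - s) *\<^sub>R mat 1 + s *\<^sub>R B" for s :: real
  have pd: "\<xi> \<bullet> (P s *v \<xi>) > 0" if "\<xi> \<noteq> 0" "s \<in> {0..1}" for \<xi> s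
  proof -
    have "\<xi> \<bullet> (P s *v \<xi>) = (1 - s) * (\<xi> \<bullet> \<xi>) + s * (\<xi> \<bullet> (B *v \<xi>))"
      by (simp add: P_def matrix_vector_mult_add_rdistrib scaleR_matrix_vector_assoc[symmetric] inner_add_right)
    moreover have "0 < \<xi> \<bullet> \<xi>" "0 < \<xi> \<bullet> (B *v \<xi>)" using that assms by auto
    ultimately show ?thesis using that(2)
      by (cases "s = 0") (auto intro: add_nonneg_pos)
  qed
  have nz: "det (P s) \<noteq> 0" if "s \<in> {0..1}" for s
    by (rule pos_def_det(2)) (use pd that in blast)
  have cont: "continuous_on {0..1} (\<lambda>s. det (P s))"
    unfolding det_def P_def by (intro continuous_intros)
  have d: "det (P 0) = 1" "P 1 = B" by (simp_all add: P_def)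
  show ?thesis
  proof (rule ccontr)
    assume "\<not> 0 < det B"
    then have "\<exists>s\<ge>0. s \<le> 1 \<and> det (P s) = 0"
      using cont d by (intro IVT2') auto
    then show False using nz by auto
  qed
qed

text \<open>
  Here \<open>J\<close> is the Jacobian of a coordinate change and \<open>pc\<close>, \<open>pd\<close> are the components of the same differential.
  The gradients \<open>a\<close> and \<open>b\<close> in the two coordinate systems are related by \<open>J b = a\<close>, since \<open>b\<close> solves
  \<open>J\<^sup>T g\<^sub>c J b = J\<^sup>T p\<^sub>c\<close> and \<open>J\<^sup>T\<close>, \<open>g\<^sub>c\<close> are injective.
\<close>

lemma grad_norm_invariant:
  fixes gc gd J :: "real^'n^'n" and pc pd :: "real^'n"
  assumes pd: "pd = transpose J *v pc" and gd: "gd = transpose J ** gc ** J"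
    and inv: "invertible gc" "invertible gd"
  shows "(matrix_inv gd *v pd) \<bullet> (gd *v (matrix_inv gd *v pd))
       = (matrix_inv gc *v pc) \<bullet> (gc *v (matrix_inv gc *v pc))"
proof -
  define a where "a = matrix_inv gc *v pc"
  define b where "b = matrix_inv gd *v pd"
  have ga: "gc *v a = pc" unfolding a_def
    by (simp add: matrix_vector_mul_assoc matrix_inv_inverse(1)[OF inv(1)])
  have gb: "gd *v b = pd" unfolding b_def
    by (simp add: matrix_vector_mul_assoc matrix_inv_inverse(1)[OF inv(2)])
  have "det gd \<noteq> 0" using inv(2) invertible_det_nz by blast
  then have "det (transpose J) \<noteq> 0" unfolding gd by (simp add: det_mul)
  then have iJ: "invertible (transpose J)" using invertible_det_nz by blast
  have "transpose J *v (gc *v (J *v b)) = transpose J *v (gc *v a)"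
    using gb unfolding gd pd ga by (simp add: matrix_vector_mul_assoc matrix_mul_assoc)
  then have "matrix_inv (transpose J) *v (transpose J *v (gc *v (J *v b)))
     = matrix_inv (transpose J) *v (transpose J *v (gc *v a))" by simp
  then have "gc *v (J *v b) = gc *v a"
    unfolding matrix_vector_mul_assoc[of "matrix_inv (transpose J)"] matrix_inv_inverse(2)[OF iJ] by simp
  then have "matrix_inv gc *v (gc *v (J *v b)) = matrix_inv gc *v (gc *v a)" by simp
  then have Jb: "J *v b = a"
    unfolding matrix_vector_mul_assoc[of "matrix_inv gc"] matrix_inv_inverse(2)[OF inv(1)] by simp
  have "b \<bullet> (gd *v b) = b \<bullet> (transpose J *v (gc *v (J *v b)))"
    unfolding gd by (simp add: matrix_vector_mul_assoc matrix_mul_assoc)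
  also have "\<dots> = (J *v b) \<bullet> (gc *v (J *v b))"
    unfolding transpose_matrix_vector
    by (subst inner_commute, subst dot_lmul_matrix, rule inner_commute)
  finally have "b \<bullet> (gd *v b) = a \<bullet> (gc *v a)" by (simp only: Jb)
  then show ?thesis unfolding a_def b_def .
qed

context compact_smooth_manifold
begin

lemma partial_chain:
  assumes c: "c \<in> A" and d: "d \<in> A" and x: "x \<in> cdom c \<inter> cdom d"
    and u: "(u \<circ> cinv c) differentiable (at (cmap c x))"
  shows "partial d j u x = (\<Sum>i\<in>UNIV. jacobian_change c d x $ i $ j * partial c i u x)"
proof -
  let ?W = "cmap d ` (cdom d \<inter> cdom c)" and ?\<phi> = "cmap c \<circ> cinv d"
  have oW: "open ?W"
    by (rule open_cmap_image[OF d]) (simp_all add: openin_Int atlas(2)[OF c] atlas(2)[OF d])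
  have xW: "cmap d x \<in> ?W" using x by blast
  have "smooth_on ?W ?\<phi>"
    using closed_manifold c d unfolding closed_manifold_def smooth_atlas_def by blast
  then have "Ck_on (Suc 0) ?W ?\<phi>" unfolding smooth_on_def by blast
  then have "?\<phi> differentiable (at (cmap d x) within ?W)"
    using xW unfolding Ck_on.simps differentiable_on_def by blast
  then have "?\<phi> differentiable (at (cmap d x))"
    by (simp only: at_within_open[OF xW oW])
  then have d1: "(?\<phi> has_derivative frechet_derivative ?\<phi> (at (cmap d x))) (at (cmap d x))"
    using frechet_derivative_works by blast
  have px: "?\<phi> (cmap d x) = cmap c x" using x d by (simp add: cinv_cmap)
  have d2: "((u \<circ> cinv c) has_derivative frechet_derivative (u \<circ> cinv c) (at (cmap c x))) (at (?\<phi> (cmap d x)))"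
    unfolding px using u frechet_derivative_works by blast
  let ?D = "frechet_derivative (u \<circ> cinv c) (at (cmap c x))" and ?J = "frechet_derivative ?\<phi> (at (cmap d x))"
  have "((u \<circ> cinv c) \<circ> ?\<phi> has_derivative ?D \<circ> ?J) (at (cmap d x))"
    by (rule diff_chain_at[OF d1 d2])
  then have "(u \<circ> cinv d has_derivative ?D \<circ> ?J) (at (cmap d x))"
  proof (rule has_derivative_transform_within_open[OF _ oW xW])
    show "((u \<circ> cinv c) \<circ> ?\<phi>) y = (u \<circ> cinv d) y" if y: "y \<in> ?W" for y
    proof -
      obtain z where "z \<in> cdom d" "z \<in> cdom c" "y = cmap d z" using y by blast
      then show ?thesis by (simp add: cinv_cmap[OF c] cinv_cmap[OF d])
    qed
  qed
  then have "frechet_derivative (u \<circ> cinv d) (at (cmap d x)) = ?D \<circ> ?J"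
    using frechet_derivative_at by metis
  then have "partial d j u x = ?D (?J (axis j 1))" unfolding partial_def by simp
  also have "?J (axis j 1) = (\<Sum>i\<in>UNIV. jacobian_change c d x $ i $ j *\<^sub>R axis i 1)"
    unfolding jacobian_change_def matrix_def by (simp add: vec_eq_iff axis_def if_distrib cong: if_cong)
  also have "?D \<dots> = (\<Sum>i\<in>UNIV. jacobian_change c d x $ i $ j * ?D (axis i 1))"
  proof -
    interpret D: bounded_linear ?D using d2 has_derivative_bounded_linear by blast
    show ?thesis by (simp add: D.sum D.scaleR)
  qed
  finally show ?thesis unfolding partial_def .
qed

lemma grad_norm_chart_independent:
  assumes g: "riemannian_metric A g" and c: "c \<in> A" and d: "d \<in> A" and x: "x \<in> cdom c \<inter> cdom d"
    and u: "(u \<circ> cinv c) differentiable (at (cmap c x))"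
  shows "grad_norm g u d x = grad_norm g u c x"
proof -
  have gr: "grad g u e x = matrix_inv (g e x) *v (\<chi> j. partial e j u x)" for e
    by (simp add: grad_def ginv_def matrix_vector_mult_def vec_eq_iff)
  have 1: "(\<chi> j. partial d j u x) = transpose (jacobian_change c d x) *v (\<chi> i. partial c i u x)"
    by (simp add: vec_eq_iff matrix_vector_mult_def transpose_def partial_chain[OF c d x u])
  have 2: "g d x = transpose (jacobian_change c d x) ** g c x ** jacobian_change c d x"
    using g c d x unfolding riemannian_metric_def tensor_field_def by blast
  have 3: "invertible (g e x)" if "e \<in> A" "x \<in> cdom e" for e
    by (rule pos_def_det(1)) (use g that in \<open>auto simp: riemannian_metric_def\<close>)
  show ?thesis
    unfolding grad_norm_def gr by (subst grad_norm_invariant[OF 1 2 3 3]) (use c d x in auto)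
qed

end

section \<open>Time-dependent functions in charts\<close>

definition chart_C1 :: "real set \<Rightarrow> ('a, 'n::finite) chart \<Rightarrow> (real \<Rightarrow> 'a \<Rightarrow> real) \<Rightarrow> bool" where
  "chart_C1 J c w \<longleftrightarrow> C1 (J \<times> cimg c) (\<lambda>z. w (fst z) (cinv c (snd z)))"

lemma chart_C1_mult: "chart_C1 J c f \<Longrightarrow> chart_C1 J c w \<Longrightarrow> chart_C1 J c (\<lambda>t x. f t x * w t x)"
  unfolding chart_C1_def by (rule C1_mult)

lemma chart_C1_sum: "(\<And>i. i \<in> I \<Longrightarrow> chart_C1 J c (f i)) \<Longrightarrow> chart_C1 J c (\<lambda>t x. \<Sum>i\<in>I. f i t x)"
  unfolding chart_C1_def by (rule C1_sum)

text \<open>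
  The gradient of a function of time and coordinates, assembled from the derivatives of the
  corresponding function on the manifold.
\<close>

definition coord_grad ::
    "real set \<Rightarrow> ('a, 'n::finite) chart \<Rightarrow> (real \<Rightarrow> 'a \<Rightarrow> real) \<Rightarrow> real \<times> (real^'n) \<Rightarrow> real \<times> (real^'n)" where
  "coord_grad J c w z =
     (time_deriv J w (fst z) (cinv c (snd z)), \<chi> i. partial c i (w (fst z)) (cinv c (snd z)))"

context compact_smooth_manifold
begin

text \<open>
  Derivatives in space-time become time and coordinate derivatives on the manifold.  As \<open>t0 < t1\<close>, the
  derivative within the time interval is unique, also at its ends.
\<close>

lemma coord_grad_unique:
  assumes t01: "t0 < t1" and c: "c \<in> A"
    and G: "C1_grad ({t0..t1} \<times> cimg c) (\<lambda>z. w (fst z) (cinv c (snd z))) G"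
    and z: "z \<in> {t0..t1} \<times> cimg c"
  shows "G z = coord_grad {t0..t1} c w z"
proof -
  obtain t y where [simp]: "z = (t, y)" by (cases z)
  have t: "t \<in> {t0..t1}" and y: "y \<in> cimg c" using z by auto
  have "((\<lambda>s. w s (cinv c y)) has_vector_derivative fst (G (t, y))) (at t within {t0..t1})"
    using C1_grad_time[OF G t y] by simp
  then have 1: "time_deriv {t0..t1} w t (cinv c y) = fst (G (t, y))"
    unfolding time_deriv_def
    by (rule vector_derivative_within_closed_interval[OF t01 t])
  have "((\<lambda>y. w t (cinv c y)) has_derivative (\<bullet>) (snd (G (t, y)))) (at y)"
    using C1_grad_at[OF C1_grad_space[OF G t] atlas(3)[OF c] y] by simp
  then have "frechet_derivative (w t \<circ> cinv c) (at y) = (\<bullet>) (snd (G (t, y)))"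
    unfolding o_def using frechet_derivative_at by metis
  then have 2: "partial c i (w t) (cinv c y) = snd (G (t, y)) $ i" for i
    unfolding partial_def cmap_cinv[OF y] by (simp add: inner_axis)
  show ?thesis unfolding coord_grad_def by (simp add: 1 2 prod_eq_iff)
qed

lemma chart_C1_grad:
  assumes t01: "t0 < t1" and c: "c \<in> A" and w: "chart_C1 {t0..t1} c w"
  shows "C1_grad ({t0..t1} \<times> cimg c) (\<lambda>z. w (fst z) (cinv c (snd z))) (coord_grad {t0..t1} c w)"
proof -
  obtain G where G: "C1_grad ({t0..t1} \<times> cimg c) (\<lambda>z. w (fst z) (cinv c (snd z))) G"
    using w unfolding chart_C1_def C1_def by blast
  show ?thesis
    by (rule C1_grad_cong[OF G refl coord_grad_unique[OF t01 c G]])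
qed

lemma chart_C1_continuous:
  "chart_C1 J c w \<Longrightarrow> continuous_on (J \<times> cimg c) (\<lambda>z. w (fst z) (cinv c (snd z)))"
  unfolding chart_C1_def by (rule C1_continuous)

lemma chart_C1_time_deriv:
  assumes t01: "t0 < t1" and c: "c \<in> A" and w: "chart_C1 {t0..t1} c w"
    and t: "t \<in> {t0..t1}" and x: "x \<in> cdom c"
  shows "((\<lambda>s. w s x) has_vector_derivative time_deriv {t0..t1} w t x) (at t within {t0..t1})"
  using C1_grad_time[OF chart_C1_grad[OF t01 c w] t cmap_in[OF x]]
  by (simp add: coord_grad_def cinv_cmap[OF c x])

lemma chart_C1_space:
  assumes t01: "t0 < t1" and c: "c \<in> A" and w: "chart_C1 {t0..t1} c w" and t: "t \<in> {t0..t1}"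
  shows "C1_grad (cimg c) (\<lambda>y. w t (cinv c y)) (\<lambda>y. \<chi> i. partial c i (w t) (cinv c y))"
  using C1_grad_space[OF chart_C1_grad[OF t01 c w] t] by (simp add: coord_grad_def)

lemma chart_C1_differentiable:
  assumes t01: "t0 < t1" and c: "c \<in> A" and w: "chart_C1 {t0..t1} c w"
    and t: "t \<in> {t0..t1}" and x: "x \<in> cdom c"
  shows "(w t \<circ> cinv c) differentiable (at (cmap c x))"
  using C1_grad_at[OF chart_C1_space[OF t01 c w t] atlas(3)[OF c] cmap_in[OF x]]
  unfolding differentiable_def o_def by blast

lemma continuous_on_time_deriv:
  assumes t01: "t0 < t1" and c: "c \<in> A" and w: "chart_C1 {t0..t1} c w"
  shows "continuous_on ({t0..t1} \<times> cimg c) (\<lambda>z. time_deriv {t0..t1} w (fst z) (cinv c (snd z)))"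
proof -
  have "continuous_on ({t0..t1} \<times> cimg c) (coord_grad {t0..t1} c w)"
    using chart_C1_grad[OF assms] unfolding C1_grad_def by blast
  from continuous_on_fst[OF this] show ?thesis by (simp add: coord_grad_def)
qed

lemma continuous_on_partial:
  assumes t01: "t0 < t1" and c: "c \<in> A" and w: "chart_C1 {t0..t1} c w"
  shows "continuous_on ({t0..t1} \<times> cimg c) (\<lambda>z. partial c i (w (fst z)) (cinv c (snd z)))"
proof -
  have "continuous_on ({t0..t1} \<times> cimg c) (coord_grad {t0..t1} c w)"
    using chart_C1_grad[OF assms] unfolding C1_grad_def by blast
  then have "continuous_on ({t0..t1} \<times> cimg c) (\<lambda>z. snd (coord_grad {t0..t1} c w z) $ i)"
    by (intro continuous_intros)
  then show ?thesis by (simp add: coord_grad_def)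
qed

lemma continuous_on_time_slice:
  assumes "continuous_on (J \<times> cimg c) (\<lambda>z. w (fst z) (cinv c (snd z)))" "t \<in> J"
  shows "continuous_on (cimg c) (\<lambda>y. w t (cinv c y))"
proof -
  have "continuous_on (cimg c) (\<lambda>y. (t, y))" by (intro continuous_intros)
  from continuous_on_compose2[OF assms(1) this] assms(2) show ?thesis by auto
qed

text \<open>
  The components of the derivative of a smooth function are again differentiable; by
  \<open>coord_grad_unique\<close> they are the time derivative and the coordinate derivatives on the manifold.
\<close>

lemma smooth_family_C1:
  assumes t01: "t0 < t1" and c: "c \<in> A" and v: "smooth_family A {t0..t1} v"
  shows "chart_C1 {t0..t1} c v"
    and "chart_C1 {t0..t1} c (time_deriv {t0..t1} v)"
    and "chart_C1 {t0..t1} c (\<lambda>t. partial c i (v t))"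
proof -
  let ?S = "{t0..t1} \<times> cimg c" and ?F = "\<lambda>(t, y). v t (cinv c y)"
  let ?G = "\<lambda>z. \<Sum>b\<in>Basis. frechet_derivative ?F (at z within ?S) b *\<^sub>R b"
  have "smooth_on ?S ?F" using v c unfolding smooth_family_def by blast
  then have F2: "Ck_on (Suc (Suc 0)) ?S ?F" unfolding smooth_on_def by blast
  have G: "C1_grad ?S (\<lambda>z. v (fst z) (cinv c (snd z))) ?G"
    using Ck_on_Suc_imp_C1_grad[OF F2 bounded_linear_ident] by (simp add: split_beta)
  then show "chart_C1 {t0..t1} c v" unfolding chart_C1_def C1_def by blast
  have Gb: "C1 ?S (\<lambda>z. ?G z \<bullet> b)" if b: "b \<in> Basis" for b
  proof -
    have "Ck_on (Suc 0) ?S (\<lambda>z. frechet_derivative ?F (at z within ?S) b)"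
      using F2 b unfolding Ck_on.simps(2)[of "Suc 0"] by blast
    from Ck_on_Suc_imp_C1[OF this bounded_linear_ident]
    show ?thesis
      by (rule C1_cong) (use b in \<open>simp add: inner_sum_left_Basis\<close>)
  qed
  have eq: "coord_grad {t0..t1} c v z \<bullet> b = ?G z \<bullet> b" if "z \<in> ?S" for z b
    using coord_grad_unique[OF t01 c G that] by simp
  have 0: "(1, 0) \<in> (Basis :: (real \<times> (real^'n)) set)" and 1: "(0, axis i 1) \<in> (Basis :: (real \<times> (real^'n)) set)"
    by (auto simp: Basis_prod_def Basis_vec_def)
  show "chart_C1 {t0..t1} c (time_deriv {t0..t1} v)"
    unfolding chart_C1_def
    by (rule C1_cong[OF Gb[OF 0]]) (subst eq[symmetric], auto simp: coord_grad_def)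
  show "chart_C1 {t0..t1} c (\<lambda>t. partial c i (v t))"
    unfolding chart_C1_def
    by (rule C1_cong[OF Gb[OF 1]]) (subst eq[symmetric], auto simp: coord_grad_def inner_axis)
qed

lemma time_deriv_partial:
  assumes t01: "t0 < t1" and c: "c \<in> A" and v: "smooth_family A {t0..t1} v"
    and t: "t \<in> {t0..t1}" and x: "x \<in> cdom c"
  shows "time_deriv {t0..t1} (\<lambda>t. partial c i (v t)) t x = partial c i (time_deriv {t0..t1} v t) x"
proof -
  note C = smooth_family_C1[OF t01 c v]
  have "fst (coord_grad {t0..t1} c (\<lambda>t. partial c i (v t)) (t, cmap c x))
      = snd (coord_grad {t0..t1} c (time_deriv {t0..t1} v) (t, cmap c x)) $ i"
  proof (rule C1_mixed_partials[OF t01 atlas(3)[OF c] chart_C1_grad[OF t01 c C(1)] _ _ t cmap_in[OF x]])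
    show "C1_grad ({t0..t1} \<times> cimg c) (\<lambda>z. fst (coord_grad {t0..t1} c v z))
       (coord_grad {t0..t1} c (time_deriv {t0..t1} v))"
      using chart_C1_grad[OF t01 c C(2)] by (simp add: coord_grad_def)
    show "C1_grad ({t0..t1} \<times> cimg c) (\<lambda>z. snd (coord_grad {t0..t1} c v z) $ i)
       (coord_grad {t0..t1} c (\<lambda>t. partial c i (v t)))"
      using chart_C1_grad[OF t01 c C(3)[of i]] by (simp add: coord_grad_def)
  qed
  then show ?thesis by (simp add: coord_grad_def cinv_cmap[OF c x])
qed

text \<open>
  Positivity passes to the inverse matrix because \<open>\<xi> \<bullet> g\<^bsup>-1\<^esup>\<xi> = \<eta> \<bullet> g\<eta>\<close> for \<open>\<eta> = g\<^bsup>-1\<^esup>\<xi>\<close>.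
\<close>

lemma riemannian_pos_def:
  assumes "riemannian_metric A g" "c \<in> A" "x \<in> cdom c"
  shows "invertible (g c x)" "0 < det (g c x)" "transpose (ginv g c x) = ginv g c x"
    and "\<xi> \<noteq> 0 \<Longrightarrow> 0 < \<xi> \<bullet> (ginv g c x *v \<xi>)"
proof -
  have sym: "transpose (g c x) = g c x" and pd: "\<And>\<xi>. \<xi> \<noteq> 0 \<Longrightarrow> \<xi> \<bullet> (g c x *v \<xi>) > 0"
    using assms unfolding riemannian_metric_def by blast+
  show inv: "invertible (g c x)" by (rule pos_def_det(1)[OF pd])
  show "0 < det (g c x)" by (rule pos_def_det_pos[OF pd])
  note gi = matrix_inv_inverse[OF inv, folded ginv_def]
  have "transpose (ginv g c x) ** g c x = mat 1"
    using arg_cong[OF gi(1), of transpose] by (simp add: matrix_transpose_mul sym)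
  then show "transpose (ginv g c x) = ginv g c x"
    using gi(1) by (metis matrix_mul_assoc matrix_mul_lid matrix_mul_rid)
  assume "\<xi> \<noteq> 0"
  have e: "g c x *v (ginv g c x *v \<xi>) = \<xi>" by (simp add: matrix_vector_mul_assoc gi(1))
  then have "ginv g c x *v \<xi> \<noteq> 0" using \<open>\<xi> \<noteq> 0\<close> by force
  from pd[OF this] e show "0 < \<xi> \<bullet> (ginv g c x *v \<xi>)" by (simp add: inner_commute)
qed

lemma grad_norm_squared:
  assumes "riemannian_metric A g" "c \<in> A" "x \<in> cdom c"
  shows "(grad_norm g u c x)\<^sup>2
    = (\<Sum>i\<in>UNIV. \<Sum>j\<in>UNIV. ginv g c x $ i $ j * partial c i u x * partial c j u x)"
proof -
  define p where "p = (\<chi> j. partial c j u x)"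
  have gr: "grad g u c x = ginv g c x *v p"
    by (simp add: p_def grad_def matrix_vector_mult_def vec_eq_iff)
  have gi: "g c x *v (ginv g c x *v p) = p"
    by (simp add: matrix_vector_mul_assoc ginv_def matrix_inv_inverse(1)[OF riemannian_pos_def(1)[OF assms]])
  have nn: "0 \<le> p \<bullet> (ginv g c x *v p)"
    using riemannian_pos_def(4)[OF assms, of p] by (cases "p = 0") auto
  have "(grad_norm g u c x)\<^sup>2 = p \<bullet> (ginv g c x *v p)"
    unfolding grad_norm_def gr gi using nn by (simp add: inner_commute)
  also have "\<dots> = (\<Sum>i\<in>UNIV. \<Sum>j\<in>UNIV. ginv g c x $ i $ j * partial c i u x * partial c j u x)"
    by (simp add: p_def inner_vec_def matrix_vector_mult_def sum_distrib_left mult_ac)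
  finally show ?thesis .
qed

lemma grad_norm_nonneg:
  assumes "riemannian_metric A g" "c \<in> A" "x \<in> cdom c"
  shows "0 \<le> grad_norm g w c x"
  unfolding grad_norm_def
proof (rule real_sqrt_ge_zero)
  let ?a = "grad g w c x"
  have "?a \<noteq> 0 \<Longrightarrow> 0 < ?a \<bullet> (g c x *v ?a)"
    using assms unfolding riemannian_metric_def by blast
  then show "0 \<le> ?a \<bullet> (g c x *v ?a)" by (cases "?a = 0") auto
qed

lemma smooth_metric_family_C1:
  assumes c: "c \<in> A" and g: "smooth_metric_family A S g" and J: "{t0..t1} \<subseteq> S"
  shows "chart_C1 {t0..t1} c (\<lambda>t x. g t c x $ i $ j)"
    and "chart_C1 {t0..t1} c (\<lambda>t x. ginv (g t) c x $ i $ j)"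
    and "continuous_on ({t0..t1} \<times> cimg c) (\<lambda>z. det (g (fst z) c (cinv c (snd z))))"
proof -
  have "smooth_on (S \<times> cimg c) (\<lambda>(t, y). g t c (cinv c y))"
    using g c unfolding smooth_metric_family_def by blast
  then have F: "Ck_on (Suc 0) (S \<times> cimg c) (\<lambda>(t, y). g t c (cinv c y))" unfolding smooth_on_def by blast
  have 1: "C1 ({t0..t1} \<times> cimg c) (\<lambda>z. g (fst z) c (cinv c (snd z)) $ i $ j)" for i j
  proof -
    have "bounded_linear (\<lambda>B::real^'n^'n. B $ i $ j)"
      using bounded_linear_compose[OF bounded_linear_vec_nth bounded_linear_vec_nth] .
    from C1_subset[OF Ck_on_Suc_imp_C1[OF F this] Sigma_mono[OF J subset_refl]]
    show ?thesis by (simp only: split_beta)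
  qed
  then show "chart_C1 {t0..t1} c (\<lambda>t x. g t c x $ i $ j)" unfolding chart_C1_def .
  show "continuous_on ({t0..t1} \<times> cimg c) (\<lambda>z. det (g (fst z) c (cinv c (snd z))))"
    by (intro C1_continuous C1_det 1)
  have "det (g (fst z) c (cinv c (snd z))) \<noteq> 0" if z: "z \<in> {t0..t1} \<times> cimg c" for z
  proof -
    have "riemannian_metric A (g (fst z))"
      using z J g unfolding smooth_metric_family_def by (auto simp: mem_Times_iff)
    from riemannian_pos_def(2)[OF this c cinv_in] z show ?thesis by (force simp: mem_Times_iff)
  qed
  then show "chart_C1 {t0..t1} c (\<lambda>t x. ginv (g t) c x $ i $ j)"
    unfolding chart_C1_def ginv_def by (intro C1_matrix_inv 1)
qed

text \<open>
  The minimum of the form over the compact set of all times in the interval, points in \<open>K\<close> and unit vectors \<open>\<xi>\<close>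
  is attained, hence positive; homogeneity gives the case of general \<open>\<xi>\<close>.
\<close>

lemma uniform_ellipticity:
  assumes c: "c \<in> A" and g: "smooth_metric_family A S g" and J: "{t0..t1} \<subseteq> S"
    and K: "compact K" "K \<subseteq> cimg c"
  shows "\<exists>l>0. \<forall>t\<in>{t0..t1}. \<forall>y\<in>K. \<forall>\<xi>. l * (\<xi> \<bullet> \<xi>) \<le> \<xi> \<bullet> (ginv (g t) c (cinv c y) *v \<xi>)"
proof (cases "{t0..t1} \<times> K = {}")
  case True
  then show ?thesis by (intro exI[of _ 1]) auto
next
  case False
  let ?D = "({t0..t1} \<times> K) \<times> sphere (0 :: real^'n) 1"
  define f where "f p = snd p \<bullet> (ginv (g (fst (fst p))) c (cinv c (snd (fst p))) *v snd p)"
    for p :: "(real \<times> (real^'n)) \<times> (real^'n)"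
  have co: "continuous_on ?D (\<lambda>p. ginv (g (fst (fst p))) c (cinv c (snd (fst p))) $ i $ j)" for i j
    by (rule continuous_on_compose2[OF chart_C1_continuous[OF smooth_metric_family_C1(2)[OF c g J]] continuous_on_fst[OF continuous_on_id]])
       (use K in auto)
  have fe: "f = (\<lambda>p. \<Sum>i\<in>UNIV. snd p $ i * (\<Sum>j\<in>UNIV. ginv (g (fst (fst p))) c (cinv c (snd (fst p))) $ i $ j * snd p $ j))"
    unfolding f_def by (simp add: inner_vec_def matrix_vector_mult_def)
  have cf: "continuous_on ?D f"
    unfolding fe by (intro continuous_intros co)
  have ne: "?D \<noteq> {}"
  proof -
    have "axis undefined 1 \<in> sphere (0 :: real^'n) 1" by simp
    then show ?thesis using False by blast
  qed
  have "compact ?D" by (intro compact_Times compact_Icc compact_sphere K(1))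
  then obtain p where p: "p \<in> ?D" "\<forall>q\<in>?D. f p \<le> f q"
    using continuous_attains_inf[OF _ ne cf] by metis
  have rm: "riemannian_metric A (g t)" if "t \<in> {t0..t1}" for t
    using that J g unfolding smooth_metric_family_def by blast
  have "0 < f p"
  proof -
    obtain t y \<xi> where pe: "p = ((t, y), \<xi>)" by (metis prod.collapse)
    have t: "t \<in> {t0..t1}" and y: "y \<in> cimg c" and \<xi>: "\<xi> \<noteq> 0" using p(1) K(2) unfolding pe by auto
    show ?thesis unfolding f_def pe using riemannian_pos_def(4)[OF rm[OF t] c cinv_in[OF y] \<xi>] by simp
  qed
  moreover have "f p * (\<xi> \<bullet> \<xi>) \<le> \<xi> \<bullet> (ginv (g t) c (cinv c y) *v \<xi>)"
    if t: "t \<in> {t0..t1}" and y: "y \<in> K" for t y \<xi>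
  proof (cases "\<xi> = 0")
    case False
    let ?e = "inverse (norm \<xi>) *\<^sub>R \<xi>"
    have "f p \<le> f ((t, y), ?e)" by (rule p(2)[rule_format]) (use t y False in auto)
    also have "\<dots> = (inverse (norm \<xi>))\<^sup>2 * (\<xi> \<bullet> (ginv (g t) c (cinv c y) *v \<xi>))"
      unfolding f_def by (simp add: matrix_vector_mult_scaleR power2_eq_square)
    finally show ?thesis
      using False by (simp add: power2_norm_eq_inner[symmetric] field_simps)
  qed simp
  ultimately show ?thesis by blast
qed

end

section \<open>A weighted integral computed in charts\<close>

lemma quadratic_nonneg_discriminant:
  fixes a b c :: real
  assumes q: "\<And>s. 0 \<le> a * s\<^sup>2 + 2 * b * s + c"
  shows "b\<^sup>2 \<le> a * c"
proof (cases "a = 0")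
  case True
  have "b = 0"
  proof (rule ccontr)
    assume "b \<noteq> 0"
    then show False using q[of "- (c + 1) / (2 * b)"] True by simp
  qed
  then show ?thesis using True by simp
next
  case False
  have "0 \<le> a"
  proof (rule ccontr)
    assume "\<not> 0 \<le> a"
    then have "a < 0" by simp
    \<comment> \<open>So large that the quadratic term dominates the others.\<close>
    define s where "s = (\<bar>2 * b\<bar> + \<bar>c\<bar> + 1) / (- a) + 1"
    have s1: "1 \<le> s" using \<open>a < 0\<close> by (simp add: s_def divide_simps)
    have "a * s = - (\<bar>2 * b\<bar> + \<bar>c\<bar> + 1) + a"
      using \<open>a < 0\<close> by (simp add: s_def field_simps)
    then have "a * s + 2 * b \<le> - \<bar>c\<bar> - 1" using \<open>a < 0\<close> by linarith
    then have "(a * s + 2 * b) * s \<le> (- \<bar>c\<bar> - 1) * s" using s1 by (intro mult_right_mono) auto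
    also have "\<dots> \<le> (- \<bar>c\<bar> - 1) * 1" using s1 by (intro mult_left_mono_neg) auto
    finally have "a * s\<^sup>2 + 2 * b * s + c < 0" by (simp add: power2_eq_square algebra_simps)
    with q[of s] show False by simp
  qed
  then have a: "0 < a" using False by simp
  have "0 \<le> a * (- b / a)\<^sup>2 + 2 * b * (- b / a) + c" by (rule q)
  then show ?thesis using a by (simp add: power2_eq_square field_simps)
qed

text \<open>
  The metric \<open>g0\<close> defines the measure and remains fixed while the metric of the flow evolves, so no time derivative of
  a volume element occurs.
\<close>

locale weighted_cover = compact_smooth_manifold M A
  for M :: "'a topology" and A :: "('a, 'n::finite) chart set" +
  fixes \<mu> :: "'a measure" and g0 :: "('a, 'n) tensor2"
    and n :: nat and ch :: "nat \<Rightarrow> ('a, 'n) chart" and ce :: "nat \<Rightarrow> real^'n" and ra :: "nat \<Rightarrow> real"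
  assumes metric0: "riemannian_metric A g0"
    and vol: "volume_measure M A g0 \<mu>"
    and det0: "\<And>c. c \<in> A \<Longrightarrow> continuous_on (cimg c) (\<lambda>y. det (g0 c (cinv c y)))"
    and cover: "\<And>k. k < n \<Longrightarrow> ch k \<in> A" "\<And>k. k < n \<Longrightarrow> 0 < ra k"
      "\<And>k. k < n \<Longrightarrow> cball (ce k) (ra k) \<subseteq> cimg (ch k)"
      "\<And>x. x \<in> topspace M \<Longrightarrow> \<exists>k<n. x \<in> cdom (ch k) \<and> cmap (ch k) x \<in> ball (ce k) (ra k)"
begin

definition \<beta> where "\<beta> k = bump (ce k) (ra k)"
definition \<beta>' where "\<beta>' k = bump_grad (ce k) (ra k)"

lemma \<beta>_C1: "C1_grad UNIV (\<beta> k) (\<beta>' k)"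
  unfolding \<beta>_def \<beta>'_def by (rule bump_C1)

lemma \<beta>_continuous: "continuous_on S (\<beta> k)" "continuous_on S (\<beta>' k)"
  using \<beta>_C1[of k] C1_grad_continuous[OF \<beta>_C1, of k] unfolding C1_grad_def
  by (auto elim: continuous_on_subset)

lemma \<beta>_nonneg: "0 \<le> \<beta> k y"
  unfolding \<beta>_def by (rule bump_nonneg)

lemma \<beta>_outside: "k < n \<Longrightarrow> y \<notin> cball (ce k) (ra k) \<Longrightarrow> \<beta> k y = 0"
  "k < n \<Longrightarrow> y \<notin> cball (ce k) (ra k) \<Longrightarrow> \<beta>' k y = 0"
  unfolding \<beta>_def \<beta>'_def using bump_outside cover(2) by blast+

lemma det0_pos: "c \<in> A \<Longrightarrow> x \<in> cdom c \<Longrightarrow> 0 < det (g0 c x)"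
  using riemannian_pos_def(2)[OF metric0] by blast

text \<open>
  The functions on a chart which \<open>push\<close> turns into continuous functions on the manifold.
\<close>

definition local_weight where
  "local_weight k G \<longleftrightarrow> continuous_on (cimg (ch k)) G \<and> (\<forall>y. y \<notin> cball (ce k) (ra k) \<longrightarrow> G y = 0)"

lemma \<beta>_local_weight: "k < n \<Longrightarrow> local_weight k (\<beta> k)"
  unfolding local_weight_def using \<beta>_continuous \<beta>_outside by blast

lemma push_continuous_map:
  assumes "k < n" "local_weight k G"
  shows "continuous_map M euclideanreal (push g0 (ch k) G)"
  using assms unfolding local_weight_def
  by (intro push_continuous[OF _ _ compact_cball cover(3)] cover(1) det0 det0_pos) auto

lemma push_mult_integral:
  assumes k: "k < n" and G: "local_weight k G" and F: "continuous_map M euclideanreal F"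
  shows "has_bochner_integral \<mu> (\<lambda>x. F x * push g0 (ch k) G x)
     (\<integral>y. G y * F (cinv (ch k) y) \<partial>lborel)"
proof -
  note c = cover(1)[OF k]
  have "has_bochner_integral \<mu> (push g0 (ch k) (\<lambda>y. G y * F (cinv (ch k) y)))
     (\<integral>y. G y * F (cinv (ch k) y) \<partial>lborel)"
    using G unfolding local_weight_def
    by (intro push_integral[OF c vol _ compact_cball cover(3)[OF k]] continuous_on_mult
        continuous_on_chart[OF c F] det0 det0_pos c) auto
  moreover have "push g0 (ch k) (\<lambda>y. G y * F (cinv (ch k) y)) = (\<lambda>x. F x * push g0 (ch k) G x)"
    by (simp add: fun_eq_iff push_def cinv_cmap[OF c])
  ultimately show ?thesis by (simp only:)
qed

lemma push_sum_integral:
  assumes G: "\<And>k. k < n \<Longrightarrow> local_weight k (G k)" and F: "continuous_map M euclideanreal F"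
  shows "has_bochner_integral \<mu> (\<lambda>x. F x * (\<Sum>k<n. push g0 (ch k) (G k) x))
     (\<Sum>k<n. \<integral>y. G k y * F (cinv (ch k) y) \<partial>lborel)"
  unfolding sum_distrib_left
  by (intro has_bochner_integral_sum) (use push_mult_integral[OF _ G F] in auto)

definition \<Phi> where "\<Phi> x = (\<Sum>k<n. push g0 (ch k) (\<beta> k) x)"

lemma \<Phi>_continuous: "continuous_map M euclideanreal \<Phi>"
  unfolding \<Phi>_def[abs_def]
  by (intro continuous_map_sum push_continuous_map \<beta>_local_weight) auto

lemma push_\<beta>_nonneg: "k < n \<Longrightarrow> 0 \<le> push g0 (ch k) (\<beta> k) x"
  using det0_pos[OF cover(1), of k x] \<beta>_nonneg[of k "cmap (ch k) x"] unfolding push_def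
  by (cases "x \<in> cdom (ch k)") (simp_all add: zero_le_divide_iff)

lemma \<Phi>_pos: assumes "x \<in> topspace M" shows "0 < \<Phi> x"
proof -
  obtain k where k: "k < n" "x \<in> cdom (ch k)" "cmap (ch k) x \<in> ball (ce k) (ra k)"
    using cover(4)[OF assms] by blast
  have "0 < push g0 (ch k) (\<beta> k) x"
    unfolding push_def \<beta>_def using k det0_pos[OF cover(1)[OF k(1)] k(2)] bump_pos[OF k(3)] by simp
  then show ?thesis unfolding \<Phi>_def using k(1) push_\<beta>_nonneg by (intro sum_pos2) auto
qed

text \<open>
  Needed because the error terms, which arise as sums over the charts, have to be divided by \<open>\<Phi>\<close>.
\<close>

lemma \<Phi>_lower_bound: "\<exists>\<delta>>0. \<forall>x\<in>topspace M. \<delta> \<le> \<Phi> x"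
proof (cases "topspace M = {}")
  case True then show ?thesis by (intro exI[of _ 1]) auto
next
  case False
  have "compactin M (topspace M)"
    using closed_manifold unfolding closed_manifold_def compact_space_def by blast
  from image_compactin[OF this \<Phi>_continuous] have "compact (\<Phi> ` topspace M)" by simp
  then obtain x where "x \<in> topspace M" "\<forall>z\<in>topspace M. \<Phi> x \<le> \<Phi> z"
    using compact_attains_inf[of "\<Phi> ` topspace M"] False by auto
  then show ?thesis using \<Phi>_pos by blast
qed

definition \<Lambda> where "\<Lambda> F = (\<integral>x. F x * \<Phi> x \<partial>\<mu>)"

lemma \<Lambda>_charts:
  assumes "continuous_map M euclideanreal F"
  shows "integrable \<mu> (\<lambda>x. F x * \<Phi> x)"
    and "\<Lambda> F = (\<Sum>k<n. \<integral>y. \<beta> k y * F (cinv (ch k) y) \<partial>lborel)"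
  using push_sum_integral[OF \<beta>_local_weight assms]
  unfolding \<Lambda>_def \<Phi>_def[symmetric] by (simp_all add: has_bochner_integral_iff)

lemma \<Lambda>_add:
  assumes "continuous_map M euclideanreal F" "continuous_map M euclideanreal G"
  shows "\<Lambda> (\<lambda>x. F x + G x) = \<Lambda> F + \<Lambda> G"
  unfolding \<Lambda>_def distrib_right
  by (rule Bochner_Integration.integral_add) (intro \<Lambda>_charts(1) assms)+

lemma \<Lambda>_scale: "\<Lambda> (\<lambda>x. s * F x) = s * \<Lambda> F"
  unfolding \<Lambda>_def by (simp add: mult.assoc)

lemma space_\<mu>: "space \<mu> = topspace M"
  using vol unfolding volume_measure_def by blast

lemma \<Lambda>_mono:
  assumes "continuous_map M euclideanreal F" "continuous_map M euclideanreal G"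
    and "\<And>x. x \<in> topspace M \<Longrightarrow> F x \<le> G x"
  shows "\<Lambda> F \<le> \<Lambda> G"
  unfolding \<Lambda>_def
  by (intro integral_mono \<Lambda>_charts(1) assms mult_right_mono)
     (use \<Phi>_pos space_\<mu> in \<open>auto intro: less_imp_le\<close>)

lemma \<Lambda>_cong:
  assumes "\<And>x. x \<in> topspace M \<Longrightarrow> F x = G x"
  shows "\<Lambda> F = \<Lambda> G"
  unfolding \<Lambda>_def by (intro Bochner_Integration.integral_cong) (simp_all add: space_\<mu> assms)

lemma \<Lambda>_nonneg:
  assumes "continuous_map M euclideanreal F" "\<And>x. x \<in> topspace M \<Longrightarrow> 0 \<le> F x"
  shows "0 \<le> \<Lambda> F"
  using \<Lambda>_mono[of "\<lambda>_. 0" F] assms by (simp add: \<Lambda>_def)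

lemma \<Lambda>_Cauchy_Schwarz:
  assumes F: "continuous_map M euclideanreal F" and G: "continuous_map M euclideanreal G"
  shows "(\<Lambda> (\<lambda>x. F x * G x))\<^sup>2 \<le> \<Lambda> (\<lambda>x. (F x)\<^sup>2) * \<Lambda> (\<lambda>x. (G x)\<^sup>2)"
proof (rule quadratic_nonneg_discriminant)
  fix s :: real
  have "0 \<le> \<Lambda> (\<lambda>x. (F x * s + G x)\<^sup>2)"
    by (intro \<Lambda>_nonneg continuous_intros F G continuous_map_real_mult_right) auto
  also have "(\<lambda>x. (F x * s + G x)\<^sup>2) = (\<lambda>x. s\<^sup>2 * (F x)\<^sup>2 + ((2 * s) * (F x * G x) + (G x)\<^sup>2))"
    by (simp add: fun_eq_iff power2_eq_square algebra_simps)
  also have "\<Lambda> \<dots> = s\<^sup>2 * \<Lambda> (\<lambda>x. (F x)\<^sup>2) + ((2 * s) * \<Lambda> (\<lambda>x. F x * G x) + \<Lambda> (\<lambda>x. (G x)\<^sup>2))"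
    by (subst \<Lambda>_add, (intro continuous_intros F G continuous_map_real_mult_left)+)+
       (simp only: \<Lambda>_scale)
  finally show "0 \<le> \<Lambda> (\<lambda>x. (F x)\<^sup>2) * s\<^sup>2 + 2 * \<Lambda> (\<lambda>x. F x * G x) * s + \<Lambda> (\<lambda>x. (G x)\<^sup>2)"
    by (simp add: algebra_simps)
qed

text \<open>
  All summands in \<open>\<Lambda>_charts\<close> are nonnegative, so each of the Lebesgue integrals is zero, and so are the
  continuous nonnegative integrands.  At each point, one of the cut-off functions is positive.
\<close>

lemma \<Lambda>_square_eq_0:
  assumes F: "continuous_map M euclideanreal F" and z: "\<Lambda> (\<lambda>x. (F x)\<^sup>2) = 0" and x: "x \<in> topspace M"
  shows "F x = 0"
proof -
  obtain k where k: "k < n" "x \<in> cdom (ch k)" "cmap (ch k) x \<in> ball (ce k) (ra k)"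
    using cover(4)[OF x] by blast
  let ?f = "\<lambda>k y. \<beta> k y * (F (cinv (ch k) y))\<^sup>2"
  have "(\<Sum>k<n. \<integral>y. ?f k y \<partial>lborel) = 0"
    using \<Lambda>_charts(2)[of "\<lambda>x. (F x)\<^sup>2"] z F by (simp add: continuous_map_real_pow)
  moreover have "0 \<le> (\<integral>y. ?f k y \<partial>lborel)" for k
    by (intro integral_nonneg_AE) (simp add: \<beta>_nonneg)
  ultimately have i0: "(\<integral>y. ?f k y \<partial>lborel) = 0"
    using k(1) by (subst (asm) sum_nonneg_eq_0_iff) auto
  have "continuous_on UNIV (?f k)"
    by (rule continuous_on_extend_zero_UNIV[OF _ atlas(3)[OF cover(1)[OF k(1)]] closed_cball cover(3)[OF k(1)]])
       (auto intro!: continuous_intros \<beta>_continuous continuous_on_chart[OF cover(1)[OF k(1)] F] simp: \<beta>_outside[OF k(1)])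
  then have cf: "continuous_on S (?f k)" for S by (rule continuous_on_subset) simp
  obtain a where a: "cball (ce k) (ra k) \<subseteq> cbox (-a) a"
    using bounded_subset_cbox_symmetric[OF bounded_cball] by blast
  have "integral (cbox (-a) a) (?f k) = 0"
    using lborel_integral_cbox(2)[of "-a" a "?f k", OF cf] i0 a \<beta>_outside[OF k(1)] by (auto simp: subset_iff)
  then have hi: "(?f k has_integral 0) (cbox (-a) a)"
    using integrable_continuous[OF cf] has_integral_integral by metis
  have "ball (ce k) (ra k) \<subseteq> interior (cbox (-a) a)"
    by (rule interior_maximal) (use a ball_subset_cball in auto)
  then have "cmap (ch k) x \<in> box (-a) a" using k(3) by auto
  then have "?f k (cmap (ch k) x) = 0"
    by (intro has_integral_0_cbox_imp_0[OF cf _ hi]) (use box_subset_cbox in \<open>auto simp: \<beta>_nonneg\<close>)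
  then show ?thesis
    using bump_pos[OF k(3)] by (simp add: \<beta>_def cinv_cmap[OF cover(1)[OF k(1)] k(2)])
qed

lemma chart_integral_deriv:
  assumes k: "k < n" and t01: "t0 < t1" and w: "chart_C1 {t0..t1} (ch k) w" and t: "t \<in> {t0..t1}"
  shows "((\<lambda>t. \<integral>y. \<beta> k y * w t (cinv (ch k) y) \<partial>lborel) has_vector_derivative
     (\<integral>y. \<beta> k y * time_deriv {t0..t1} w t (cinv (ch k) y) \<partial>lborel)) (at t within {t0..t1})"
proof -
  note c = cover(1)[OF k] and W = atlas(3)[OF cover(1)[OF k]] closed_cball cover(3)[OF k]
  obtain a where a: "cball (ce k) (ra k) \<subseteq> cbox (-a) a"
    using bounded_subset_cbox_symmetric[OF bounded_cball] by blast
  have out: "\<beta> k y = 0" if "y \<notin> cbox (-a) a" for y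
    using \<beta>_outside(1)[OF k] a that by blast
  show ?thesis
  proof (rule lborel_leibniz[where a = "-a" and b = a])
    fix s y assume s: "s \<in> {t0..t1}"
    show "((\<lambda>t. \<beta> k y * w t (cinv (ch k) y)) has_vector_derivative
        \<beta> k y * time_deriv {t0..t1} w s (cinv (ch k) y)) (at s within {t0..t1})"
    proof (cases "y \<in> cimg (ch k)")
      case True
      show ?thesis
        using has_vector_derivative_mult_right[OF chart_C1_time_deriv[OF t01 c w s cinv_in[OF True]]] .
    next
      case False
      then have "\<beta> k y = 0" using \<beta>_outside(1)[OF k] cover(3)[OF k] by blast
      then show ?thesis by simp
    qed
  next
    fix s assume s: "s \<in> {t0..t1}"
    show "continuous_on UNIV (\<lambda>y. \<beta> k y * w s (cinv (ch k) y))"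
      by (rule continuous_on_extend_zero_UNIV[OF _ W])
         (auto intro!: continuous_on_mult \<beta>_continuous continuous_on_time_slice[OF chart_C1_continuous[OF w] s]
            simp: \<beta>_outside[OF k])
  next
    have "continuous_on ({t0..t1} \<times> UNIV) (\<lambda>z. \<beta> k (snd z) * time_deriv {t0..t1} w (fst z) (cinv (ch k) (snd z)))"
    proof (rule continuous_on_extend_zero[OF _ W])
      show "continuous_on ({t0..t1} \<times> cimg (ch k))
          (\<lambda>z. \<beta> k (snd z) * time_deriv {t0..t1} w (fst z) (cinv (ch k) (snd z)))"
        by (intro continuous_on_mult continuous_on_time_deriv[OF t01 c w]
            continuous_on_compose2[OF \<beta>_continuous(1) continuous_on_snd[OF continuous_on_id]]) auto
    qed (simp add: \<beta>_outside[OF k])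
    then show "continuous_on ({t0..t1} \<times> UNIV) (\<lambda>(t, y). \<beta> k y * time_deriv {t0..t1} w t (cinv (ch k) y))"
      by (simp add: split_beta)
  qed (use t out in auto)
qed

end

section \<open>The Dirichlet form of an evolving metric\<close>

locale heat_inequality = weighted_cover M A \<mu> "g t0" n ch ce ra
  for M :: "'a topology" and A :: "('a, 'n::finite) chart set"
    and \<mu> :: "'a measure" and g :: "real \<Rightarrow> ('a, 'n) tensor2" and t0 :: real
    and n :: nat and ch :: "nat \<Rightarrow> ('a, 'n) chart" and ce :: "nat \<Rightarrow> real^'n" and ra :: "nat \<Rightarrow> real" +
  fixes S :: "real set" and t1 C0 :: real and v :: "real \<Rightarrow> 'a \<Rightarrow> real"
  assumes t01: "t0 < t1" and metric: "smooth_metric_family A S g" and JS: "{t0..t1} \<subseteq> S"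
    and smooth_v: "smooth_family A {t0..t1} v" and C0: "0 \<le> C0"
    and ineq: "\<And>t c x. t \<in> {t0..t1} \<Longrightarrow> c \<in> A \<Longrightarrow> x \<in> cdom c \<Longrightarrow>
          \<bar>time_deriv {t0..t1} v t x - laplacian (g t) (v t) c x\<bar>
            \<le> C0 * (\<bar>v t x\<bar> + grad_norm (g t) (v t) c x)"
begin

abbreviation "J \<equiv> {t0..t1}"
abbreviation "u \<equiv> time_deriv J v"
abbreviation "\<gamma> c i j t x \<equiv> ginv (g t) c x $ i $ j"
abbreviation "dx c i t x \<equiv> partial c i (v t) x"

definition grad_sq where "grad_sq t x = (grad_norm (g t) (v t) (chart_at A x) x)\<^sup>2"
definition grad_form where "grad_form c t x = (\<Sum>i\<in>UNIV. \<Sum>j\<in>UNIV. \<gamma> c i j t x * dx c i t x * dx c j t x)"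

text \<open>
  The components of the gradient of \<open>v\<close>.
\<close>

definition flux where "flux c j t x = (\<Sum>i\<in>UNIV. \<gamma> c i j t x * dx c i t x)"

text \<open>
  The Euclidean divergence of \<open>\<beta> k\<close> times the gradient field.
\<close>

definition flux_div where
  "flux_div k t y = (\<Sum>j\<in>UNIV. \<beta> k y * partial (ch k) j (flux (ch k) j t) (cinv (ch k) y)
                        + flux (ch k) j t (cinv (ch k) y) * \<beta>' k y $ j)"

text \<open>
  The operator which represents the Dirichlet form: \<open>Dirichlet_identity\<close> holds with it.  Its
  terms of different charts need not agree at a point; only their sum has a meaning.
\<close>

definition weighted_lap where "weighted_lap t x = (\<Sum>k<n. push (g t0) (ch k) (flux_div k t) x) / \<Phi> x"

lemma metric_at: "t \<in> J \<Longrightarrow> riemannian_metric A (g t)"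
  using metric JS unfolding smooth_metric_family_def by blast

lemma v_C1: "c \<in> A \<Longrightarrow> chart_C1 J c v" and u_C1: "c \<in> A \<Longrightarrow> chart_C1 J c u"
  and dx_C1: "c \<in> A \<Longrightarrow> chart_C1 J c (dx c i)"
  using smooth_family_C1[OF t01 _ smooth_v] by blast+

lemma \<gamma>_C1: "c \<in> A \<Longrightarrow> chart_C1 J c (\<gamma> c i j)"
  using smooth_metric_family_C1(2)[OF _ metric JS] .

lemma \<gamma>_sym: "c \<in> A \<Longrightarrow> x \<in> cdom c \<Longrightarrow> t \<in> J \<Longrightarrow> \<gamma> c i j t x = \<gamma> c j i t x"
  using arg_cong[OF riemannian_pos_def(3)[OF metric_at], of t c x "\<lambda>B. B $ j $ i"]
  by (simp add: transpose_def)

lemma flux_C1: "c \<in> A \<Longrightarrow> chart_C1 J c (flux c j)"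
  unfolding flux_def[abs_def] by (intro chart_C1_sum chart_C1_mult \<gamma>_C1 dx_C1)

lemma grad_form_C1: "c \<in> A \<Longrightarrow> chart_C1 J c (grad_form c)"
  unfolding grad_form_def[abs_def] by (intro chart_C1_sum chart_C1_mult \<gamma>_C1 dx_C1)

text \<open>
  Makes the choice of a chart in \<open>grad_sq\<close> irrelevant, so that the gradient terms of all charts are
  controlled by one function on the manifold.
\<close>

lemma grad_sq_eq_grad_norm:
  assumes t: "t \<in> J" and c: "c \<in> A" and x: "x \<in> cdom c"
  shows "grad_sq t x = (grad_norm (g t) (v t) c x)\<^sup>2"
proof -
  have "chart_at A x \<in> A \<and> x \<in> cdom (chart_at A x)"
    unfolding chart_at_def by (rule someI[of _ c]) (use c x in blast)
  then have "grad_norm (g t) (v t) (chart_at A x) x = grad_norm (g t) (v t) c x"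
    using grad_norm_chart_independent[OF metric_at[OF t] c _ _ chart_C1_differentiable[OF t01 c v_C1[OF c] t x]] x
    by blast
  then show ?thesis unfolding grad_sq_def by simp
qed

lemma grad_sq_eq_form: "t \<in> J \<Longrightarrow> c \<in> A \<Longrightarrow> x \<in> cdom c \<Longrightarrow> grad_sq t x = grad_form c t x"
  unfolding grad_sq_eq_grad_norm grad_form_def using grad_norm_squared metric_at by blast

lemma grad_norm_eq_sqrt: "t \<in> J \<Longrightarrow> c \<in> A \<Longrightarrow> x \<in> cdom c \<Longrightarrow> grad_norm (g t) (v t) c x = sqrt (grad_sq t x)"
  using grad_sq_eq_grad_norm[of t c x] grad_norm_nonneg[OF metric_at[of t], of c x "v t"] by simp

lemma continuous_map_if_chart_C1:
  assumes "\<And>c. c \<in> A \<Longrightarrow> chart_C1 J c w" "t \<in> J"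
  shows "continuous_map M euclideanreal (w t)"
  by (intro continuous_map_if_charts continuous_on_time_slice[OF chart_C1_continuous[OF assms(1)] assms(2)])

lemma v_continuous: "t \<in> J \<Longrightarrow> continuous_map M euclideanreal (v t)"
  and u_continuous: "t \<in> J \<Longrightarrow> continuous_map M euclideanreal (u t)"
  using continuous_map_if_chart_C1 v_C1 u_C1 by blast+

lemma grad_sq_continuous:
  assumes t: "t \<in> J" shows "continuous_map M euclideanreal (grad_sq t)"
proof (rule continuous_map_if_charts)
  fix c assume c: "c \<in> A"
  have "continuous_on (cimg c) (\<lambda>y. grad_form c t (cinv c y))"
    by (rule continuous_on_time_slice[OF chart_C1_continuous[OF grad_form_C1[OF c]] t])
  then show "continuous_on (cimg c) (\<lambda>y. grad_sq t (cinv c y))"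
    by (rule continuous_on_eq) (simp add: grad_sq_eq_form[OF t c cinv_in])
qed

lemma grad_sq_nonneg: "0 \<le> grad_sq t x"
  unfolding grad_sq_def by simp

lemma flux_div_continuous: "k < n \<Longrightarrow> continuous_on (J \<times> cimg (ch k)) (\<lambda>z. flux_div k (fst z) (snd z))"
  unfolding flux_div_def
  by (intro continuous_on_sum continuous_on_add continuous_on_mult continuous_on_component
      continuous_on_partial[OF t01] chart_C1_continuous flux_C1 cover(1)
      continuous_on_compose2[OF \<beta>_continuous(1) continuous_on_snd[OF continuous_on_id]]
      continuous_on_compose2[OF \<beta>_continuous(2) continuous_on_snd[OF continuous_on_id]]) auto

lemma flux_div_local_weight:
  assumes "k < n" "t \<in> J" shows "local_weight k (flux_div k t)"
  unfolding local_weight_def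
proof (intro conjI allI impI)
  have "continuous_on (cimg (ch k)) (\<lambda>y. (t, y))" by (intro continuous_intros)
  moreover have "(\<lambda>y. (t, y)) ` cimg (ch k) \<subseteq> J \<times> cimg (ch k)" using assms(2) by blast
  ultimately show "continuous_on (cimg (ch k)) (flux_div k t)"
    using continuous_on_compose2[OF flux_div_continuous[OF assms(1)]] by fastforce
  show "flux_div k t y = 0" if "y \<notin> cball (ce k) (ra k)" for y
    unfolding flux_div_def using \<beta>_outside[OF assms(1) that] by simp
qed

lemma weighted_lap_continuous: "t \<in> J \<Longrightarrow> continuous_map M euclideanreal (weighted_lap t)"
  unfolding weighted_lap_def[abs_def] using \<Phi>_pos
  by (intro continuous_map_real_divide continuous_map_sum push_continuous_map flux_div_local_weight \<Phi>_continuous)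
     (auto simp: less_imp_neq[symmetric])

lemma \<Lambda>_weighted_lap:
  assumes t: "t \<in> J" and F: "continuous_map M euclideanreal F"
  shows "\<Lambda> (\<lambda>x. F x * weighted_lap t x) = (\<Sum>k<n. \<integral>y. flux_div k t y * F (cinv (ch k) y) \<partial>lborel)"
proof -
  have "\<Lambda> (\<lambda>x. F x * weighted_lap t x) = (\<integral>x. F x * (\<Sum>k<n. push (g t0) (ch k) (flux_div k t) x) \<partial>\<mu>)"
    unfolding \<Lambda>_def weighted_lap_def using \<Phi>_pos
    by (intro Bochner_Integration.integral_cong) (auto simp: space_\<mu> less_imp_neq[symmetric])
  also have "\<dots> = (\<Sum>k<n. \<integral>y. flux_div k t y * F (cinv (ch k) y) \<partial>lborel)"
    using push_sum_integral[OF flux_div_local_weight[OF _ t] F] by (simp add: has_bochner_integral_iff)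
  finally show ?thesis .
qed

lemma local_integration_by_parts:
  assumes k: "k < n" and t: "t \<in> J" and w: "chart_C1 J (ch k) w"
  shows "(\<integral>y. \<beta> k y * (\<Sum>j\<in>UNIV. flux (ch k) j t (cinv (ch k) y) * partial (ch k) j (w t) (cinv (ch k) y)) \<partial>lborel)
     = - (\<integral>y. flux_div k t y * w t (cinv (ch k) y) \<partial>lborel)"
  using cutoff_integration_by_parts[OF \<beta>_C1 chart_C1_space[OF t01 cover(1)[OF k] flux_C1[OF cover(1)[OF k]] t]
      chart_C1_space[OF t01 cover(1)[OF k] w t] atlas(3)[OF cover(1)[OF k]] compact_cball cover(3)[OF k]
      \<beta>_outside[OF k]]
  unfolding flux_div_def by (simp add: mult.commute)

text \<open>
  Integration by parts chart by chart: since the \<open>k\<close>-th integral carries the weight \<open>\<beta> k\<close>, there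
  are no boundary terms, and \<open>\<Lambda>_weighted_lap\<close> collects the results.
\<close>

lemma Dirichlet_identity:
  assumes t: "t \<in> J" and w: "\<And>c. c \<in> A \<Longrightarrow> chart_C1 J c w"
  shows "(\<Sum>k<n. \<integral>y. \<beta> k y * (\<Sum>j\<in>UNIV. flux (ch k) j t (cinv (ch k) y) * partial (ch k) j (w t) (cinv (ch k) y)) \<partial>lborel)
     = - \<Lambda> (\<lambda>x. w t x * weighted_lap t x)"
proof -
  have F: "continuous_map M euclideanreal (w t)" by (rule continuous_map_if_chart_C1[OF w t])
  show ?thesis
    unfolding \<Lambda>_weighted_lap[OF t F] sum_negf[symmetric]
    by (intro sum.cong refl local_integration_by_parts t w cover(1)) auto
qed

lemma \<Lambda>_grad_sq: assumes t: "t \<in> J" shows "\<Lambda> (grad_sq t) = - \<Lambda> (\<lambda>x. v t x * weighted_lap t x)"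
proof -
  have "\<Lambda> (grad_sq t) = (\<Sum>k<n. \<integral>y. \<beta> k y * grad_sq t (cinv (ch k) y) \<partial>lborel)"
    by (rule \<Lambda>_charts(2)[OF grad_sq_continuous[OF t]])
  also have "\<dots> = (\<Sum>k<n. \<integral>y. \<beta> k y * (\<Sum>j\<in>UNIV. flux (ch k) j t (cinv (ch k) y) * dx (ch k) j t (cinv (ch k) y)) \<partial>lborel)"
  proof (intro sum.cong refl Bochner_Integration.integral_cong)
    fix k y assume k: "k \<in> {..<n}"
    show "\<beta> k y * grad_sq t (cinv (ch k) y) = \<beta> k y * (\<Sum>j\<in>UNIV. flux (ch k) j t (cinv (ch k) y) * dx (ch k) j t (cinv (ch k) y))"
    proof (cases "y \<in> cimg (ch k)")
      case True
      have "grad_form (ch k) t x = (\<Sum>j\<in>UNIV. flux (ch k) j t x * dx (ch k) j t x)" for x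
        unfolding grad_form_def flux_def by (subst sum.swap) (simp only: sum_distrib_right)
      then show ?thesis using grad_sq_eq_form[OF t cover(1) cinv_in[OF True]] k by simp
    next
      case False
      have "k < n" using k by simp
      then have "\<beta> k y = 0" using False \<beta>_outside(1)[of k y] cover(3)[of k] by blast
      then show ?thesis by simp
    qed
  qed
  also have "\<dots> = - \<Lambda> (\<lambda>x. v t x * weighted_lap t x)"
    by (rule Dirichlet_identity[OF t v_C1])
  finally show ?thesis .
qed

text \<open>
  The derivative falls on the metric and on the two differentials.  The symmetry of the form makes the
  last two terms equal, and \<open>time_deriv_partial\<close> turns them into derivatives of \<open>\<partial>\<^sub>tv\<close>.
\<close>

lemma grad_form_time_deriv:
  assumes t: "t \<in> J" and c: "c \<in> A" and x: "x \<in> cdom c"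
  shows "time_deriv J (grad_form c) t x
    = (\<Sum>i\<in>UNIV. \<Sum>j\<in>UNIV. time_deriv J (\<gamma> c i j) t x * dx c i t x * dx c j t x)
      + 2 * (\<Sum>j\<in>UNIV. flux c j t x * partial c j (u t) x)"
proof -
  have d1: "((\<lambda>s. \<gamma> c i j s x) has_vector_derivative time_deriv J (\<gamma> c i j) t x) (at t within J)" for i j
    by (rule chart_C1_time_deriv[OF t01 c \<gamma>_C1[OF c] t x])
  have d2: "((\<lambda>s. dx c i s x) has_vector_derivative partial c i (u t) x) (at t within J)" for i
    using chart_C1_time_deriv[OF t01 c dx_C1[OF c] t x] time_deriv_partial[OF t01 c smooth_v t x] by simp
  note d = d1[folded has_real_derivative_iff_has_vector_derivative] d2[folded has_real_derivative_iff_has_vector_derivative]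
  have "((\<lambda>s. grad_form c s x) has_real_derivative
      (\<Sum>i\<in>UNIV. \<Sum>j\<in>UNIV. (time_deriv J (\<gamma> c i j) t x * dx c i t x + partial c i (u t) x * \<gamma> c i j t x) * dx c j t x
         + partial c j (u t) x * (\<gamma> c i j t x * dx c i t x))) (at t within J)"
    unfolding grad_form_def by (intro DERIV_sum DERIV_mult d)
  then have "time_deriv J (grad_form c) t x = (\<Sum>i\<in>UNIV. \<Sum>j\<in>UNIV.
      (time_deriv J (\<gamma> c i j) t x * dx c i t x + partial c i (u t) x * \<gamma> c i j t x) * dx c j t x
         + partial c j (u t) x * (\<gamma> c i j t x * dx c i t x))"
    unfolding time_deriv_def has_real_derivative_iff_has_vector_derivative
    by (rule vector_derivative_within_closed_interval[OF t01 t])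
  also have "\<dots> = (\<Sum>i\<in>UNIV. \<Sum>j\<in>UNIV. time_deriv J (\<gamma> c i j) t x * dx c i t x * dx c j t x)
      + (\<Sum>i\<in>UNIV. \<Sum>j\<in>UNIV. \<gamma> c j i t x * dx c j t x * partial c i (u t) x)
      + (\<Sum>i\<in>UNIV. \<Sum>j\<in>UNIV. \<gamma> c i j t x * dx c i t x * partial c j (u t) x)"
    by (simp add: sum.distrib[symmetric] \<gamma>_sym[OF c x t] algebra_simps)
  also have "(\<Sum>i\<in>UNIV. \<Sum>j\<in>UNIV. \<gamma> c i j t x * dx c i t x * partial c j (u t) x)
      = (\<Sum>i\<in>UNIV. \<Sum>j\<in>UNIV. \<gamma> c j i t x * dx c j t x * partial c i (u t) x)"
    by (rule sum.swap)
  also have "(\<Sum>i\<in>UNIV. \<Sum>j\<in>UNIV. \<gamma> c j i t x * dx c j t x * partial c i (u t) x)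
      = (\<Sum>i\<in>UNIV. flux c i t x * partial c i (u t) x)"
    unfolding flux_def by (simp add: sum_distrib_right)
  finally show ?thesis by simp
qed

end

section \<open>Estimates of the error terms\<close>

text \<open>
  The comparison of the Laplacian with the divergence of the gradient field, in coordinates and at one point:
  \<open>G\<close> is the inverse metric, \<open>dG j i\<close> the \<open>j\<close>-th derivative of \<open>G i j\<close>, \<open>Gam\<close> are the Christoffel symbols, \<open>p\<close> is the
  differential of the function, \<open>H i j\<close> the \<open>i\<close>-th derivative of \<open>p j\<close>, and \<open>b\<close> the cut-off function with
  gradient \<open>b'\<close>.  The second derivatives \<open>H\<close> cancel by the symmetry of \<open>G\<close>, so only multiples of \<open>p\<close> remain.
\<close>

lemma first_order_remainder:
  fixes G H dG :: "'n::finite \<Rightarrow> 'n \<Rightarrow> real" and Gam :: "'n \<Rightarrow> 'n \<Rightarrow> 'n \<Rightarrow> real" and p b' :: "'n \<Rightarrow> real"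
  assumes sym: "\<And>i j. G i j = G j i"
  shows "b * (\<Sum>i\<in>UNIV. \<Sum>j\<in>UNIV. G i j * (H i j - (\<Sum>k\<in>UNIV. Gam k i j * p k)))
       - (\<Sum>j\<in>UNIV. b * (\<Sum>i\<in>UNIV. dG j i * p i + G i j * H j i) + (\<Sum>i\<in>UNIV. G i j * p i) * b' j)
     = - (\<Sum>k\<in>UNIV. p k * (b * ((\<Sum>i\<in>UNIV. \<Sum>j\<in>UNIV. G i j * Gam k i j) + (\<Sum>j\<in>UNIV. dG j k))
                              + (\<Sum>j\<in>UNIV. G k j * b' j)))"
proof -
  have 1: "(\<Sum>i\<in>UNIV. \<Sum>j\<in>UNIV. G i j * (H i j - (\<Sum>k\<in>UNIV. Gam k i j * p k)))
     = (\<Sum>i\<in>UNIV. \<Sum>j\<in>UNIV. G i j * H i j) - (\<Sum>k\<in>UNIV. p k * (\<Sum>i\<in>UNIV. \<Sum>j\<in>UNIV. G i j * Gam k i j))"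
  proof -
    have "(\<Sum>k\<in>UNIV. p k * (\<Sum>i\<in>UNIV. \<Sum>j\<in>UNIV. G i j * Gam k i j))
        = (\<Sum>k\<in>UNIV. \<Sum>i\<in>UNIV. \<Sum>j\<in>UNIV. G i j * (Gam k i j * p k))"
      by (simp add: sum_distrib_left mult_ac)
    also have "\<dots> = (\<Sum>i\<in>UNIV. \<Sum>k\<in>UNIV. \<Sum>j\<in>UNIV. G i j * (Gam k i j * p k))"
      by (rule sum.swap)
    also have "\<dots> = (\<Sum>i\<in>UNIV. \<Sum>j\<in>UNIV. \<Sum>k\<in>UNIV. G i j * (Gam k i j * p k))"
      by (intro sum.cong refl sum.swap)
    finally show ?thesis
      by (simp add: right_diff_distrib sum_subtractf sum_distrib_left)
  qed
  have 2: "(\<Sum>j\<in>UNIV. \<Sum>i\<in>UNIV. G i j * H j i) = (\<Sum>i\<in>UNIV. \<Sum>j\<in>UNIV. G i j * H i j)"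
    by (intro sum.cong refl) (simp add: sym)
  have 3: "(\<Sum>j\<in>UNIV. \<Sum>i\<in>UNIV. dG j i * p i) = (\<Sum>k\<in>UNIV. p k * (\<Sum>j\<in>UNIV. dG j k))"
    by (subst sum.swap) (simp add: sum_distrib_left mult_ac)
  have 4: "(\<Sum>j\<in>UNIV. (\<Sum>i\<in>UNIV. G i j * p i) * b' j) = (\<Sum>k\<in>UNIV. p k * (\<Sum>j\<in>UNIV. G k j * b' j))"
    by (simp add: sum_distrib_left sum_distrib_right, subst sum.swap) (simp add: mult_ac)
  show ?thesis
    unfolding 1 sum.distrib sum_distrib_left[of b, symmetric] 2 3 4
    by (simp add: distrib_left sum.distrib sum_distrib_left[symmetric] right_diff_distrib mult.left_commute[of _ b])
qed

context heat_inequality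
begin

lemma ball_in: "k < n \<Longrightarrow> y \<in> cball (ce k) (ra k) \<Longrightarrow> y \<in> cimg (ch k)"
  using cover(3) by blast

lemma dx_bound:
  assumes k: "k < n"
  shows "\<exists>E\<ge>0. \<forall>t\<in>J. \<forall>y\<in>cball (ce k) (ra k). \<forall>i.
     \<bar>dx (ch k) i t (cinv (ch k) y)\<bar> \<le> E * sqrt (grad_sq t (cinv (ch k) y))"
proof -
  note c = cover(1)[OF k]
  obtain l where l: "l > 0"
    and ell: "\<forall>t\<in>J. \<forall>y\<in>cball (ce k) (ra k). \<forall>\<xi>. l * (\<xi> \<bullet> \<xi>) \<le> \<xi> \<bullet> (ginv (g t) (ch k) (cinv (ch k) y) *v \<xi>)"
    using uniform_ellipticity[OF c metric JS compact_cball cover(3)[OF k]] by blast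
  have "\<bar>dx (ch k) i t (cinv (ch k) y)\<bar> \<le> (1 / sqrt l) * sqrt (grad_sq t (cinv (ch k) y))"
    if t: "t \<in> J" and y: "y \<in> cball (ce k) (ra k)" for t y i
  proof -
    let ?x = "cinv (ch k) y"
    define p where "p = (\<chi> i. dx (ch k) i t ?x)"
    have "p \<bullet> (ginv (g t) (ch k) ?x *v p) = grad_form (ch k) t ?x"
      by (simp add: p_def grad_form_def inner_vec_def matrix_vector_mult_def sum_distrib_left mult_ac)
    also have "\<dots> = grad_sq t ?x" using grad_sq_eq_form[OF t c cinv_in[OF ball_in[OF k y]]] by simp
    finally have "l * (norm p)\<^sup>2 \<le> grad_sq t ?x"
      using ell t y by (metis power2_norm_eq_inner)
    then have "(norm p)\<^sup>2 \<le> grad_sq t ?x / l" using l by (simp add: field_simps)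
    then have "norm p \<le> sqrt (grad_sq t ?x / l)" by (rule real_le_rsqrt)
    moreover have "\<bar>p $ i\<bar> \<le> norm p" by (rule component_le_norm_cart)
    ultimately show ?thesis by (simp add: p_def real_sqrt_divide)
  qed
  then show ?thesis using l by (intro exI[of _ "1 / sqrt l"]) auto
qed

text \<open>
  The part of the time derivative of \<open>|\<nabla>v|\<^sup>2\<close> that comes from the change of the metric.
\<close>

definition metric_drift where
  "metric_drift k t y = (\<Sum>i\<in>UNIV. \<Sum>j\<in>UNIV. time_deriv J (\<gamma> (ch k) i j) t (cinv (ch k) y)
      * dx (ch k) i t (cinv (ch k) y) * dx (ch k) j t (cinv (ch k) y))"

lemma metric_drift_bound:
  assumes k: "k < n"
  shows "\<exists>C\<ge>0. \<forall>t\<in>J. \<forall>y\<in>cball (ce k) (ra k). \<bar>metric_drift k t y\<bar> \<le> C * grad_sq t (cinv (ch k) y)"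
proof -
  note c = cover(1)[OF k]
  obtain E where E: "E \<ge> 0" and dE: "\<forall>t\<in>J. \<forall>y\<in>cball (ce k) (ra k). \<forall>i.
     \<bar>dx (ch k) i t (cinv (ch k) y)\<bar> \<le> E * sqrt (grad_sq t (cinv (ch k) y))"
    using dx_bound[OF k] by blast
  have "\<forall>i j. \<exists>B\<ge>0. \<forall>t\<in>J. \<forall>y\<in>cball (ce k) (ra k). \<bar>time_deriv J (\<gamma> (ch k) i j) t (cinv (ch k) y)\<bar> \<le> B"
    using continuous_bounded_on_compact[OF continuous_on_time_deriv[OF t01 c \<gamma>_C1[OF c]] compact_cball cover(3)[OF k]]
    by simp
  then obtain B where B: "\<And>i j. B i j \<ge> 0"
    and dB: "\<And>i j t y. t \<in> J \<Longrightarrow> y \<in> cball (ce k) (ra k) \<Longrightarrow> \<bar>time_deriv J (\<gamma> (ch k) i j) t (cinv (ch k) y)\<bar> \<le> B i j"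
    by metis
  have "\<bar>metric_drift k t y\<bar> \<le> (\<Sum>i\<in>UNIV. \<Sum>j\<in>UNIV. B i j * E * E) * grad_sq t (cinv (ch k) y)"
    if t: "t \<in> J" and y: "y \<in> cball (ce k) (ra k)" for t y
  proof -
    let ?s = "sqrt (grad_sq t (cinv (ch k) y))"
    have "\<bar>time_deriv J (\<gamma> (ch k) i j) t (cinv (ch k) y) * dx (ch k) i t (cinv (ch k) y) * dx (ch k) j t (cinv (ch k) y)\<bar>
        \<le> B i j * (E * ?s) * (E * ?s)" for i j
      unfolding abs_mult using dE t y B E grad_sq_nonneg
      by (intro mult_mono dB) (auto intro!: mult_nonneg_nonneg)
    then have "\<bar>metric_drift k t y\<bar> \<le> (\<Sum>i\<in>UNIV. \<Sum>j\<in>UNIV. B i j * (E * ?s) * (E * ?s))"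
      unfolding metric_drift_def
      by (intro order_trans[OF sum_abs] sum_mono order_trans[OF sum_abs]) auto
    also have "\<dots> = (\<Sum>i\<in>UNIV. \<Sum>j\<in>UNIV. B i j * E * E) * (?s * ?s)"
      unfolding sum_distrib_right by (simp only: mult_ac)
    finally show ?thesis using grad_sq_nonneg by simp
  qed
  moreover have "0 \<le> (\<Sum>i\<in>UNIV. \<Sum>j\<in>UNIV. B i j * E * E)"
    using B E by (intro sum_nonneg mult_nonneg_nonneg) auto
  ultimately show ?thesis by blast
qed

lemma partial_flux:
  assumes t: "t \<in> J" and c: "c \<in> A" and x: "x \<in> cdom c"
  shows "partial c j (flux c j t) x = (\<Sum>i\<in>UNIV. partial c j (\<gamma> c i j t) x * dx c i t x
      + \<gamma> c i j t x * partial c j (dx c i t) x)"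
proof -
  have 1: "C1_grad (cimg c) (\<lambda>y. flux c j t (cinv c y)) (\<lambda>y. \<chi> l. partial c l (flux c j t) (cinv c y))"
    by (rule chart_C1_space[OF t01 c flux_C1[OF c] t])
  have 2: "C1_grad (cimg c) (\<lambda>y. flux c j t (cinv c y))
     (\<lambda>y. \<Sum>i\<in>UNIV. \<gamma> c i j t (cinv c y) *\<^sub>R (\<chi> l. partial c l (dx c i t) (cinv c y))
        + dx c i t (cinv c y) *\<^sub>R (\<chi> l. partial c l (\<gamma> c i j t) (cinv c y)))"
    unfolding flux_def
    by (intro C1_grad_sum C1_grad_mult chart_C1_space[OF t01 c _ t] \<gamma>_C1 dx_C1 c)
  from arg_cong[OF C1_grad_unique[OF 1 2 atlas(3)[OF c] cmap_in[OF x]], of "\<lambda>V. V $ j"]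
  show ?thesis by (simp add: cinv_cmap[OF c x] mult.commute add.commute)
qed

text \<open>
  The coefficients of the differential of \<open>v\<close> in \<open>first_order_remainder\<close>.
\<close>

definition drift where
  "drift k i t y = (let x = cinv (ch k) y in
     \<beta> k y * ((\<Sum>a\<in>UNIV. \<Sum>b\<in>UNIV. \<gamma> (ch k) a b t x * christoffel (g t) (ch k) i a b x)
              + (\<Sum>j\<in>UNIV. partial (ch k) j (\<gamma> (ch k) i j t) x))
     + (\<Sum>j\<in>UNIV. \<gamma> (ch k) i j t x * \<beta>' k y $ j))"

lemma drift_continuous:
  assumes k: "k < n"
  shows "continuous_on (J \<times> cimg (ch k)) (\<lambda>z. drift k i (fst z) (snd z))"
proof -
  note c = cover(1)[OF k]
  note pg = continuous_on_partial[OF t01 c smooth_metric_family_C1(1)[OF c metric JS]]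
  note cg = chart_C1_continuous[OF \<gamma>_C1[OF c]]
  have "continuous_on (J \<times> cimg (ch k)) (\<lambda>z. christoffel (g (fst z)) (ch k) i a b (cinv (ch k) (snd z)))" for a b
    unfolding christoffel_def by (intro continuous_intros pg cg)
  then show ?thesis
    unfolding drift_def Let_def
    by (intro continuous_on_sum continuous_on_add continuous_on_mult continuous_on_component
        continuous_on_partial[OF t01 c \<gamma>_C1[OF c]] cg
        continuous_on_compose2[OF \<beta>_continuous(1) continuous_on_snd[OF continuous_on_id]]
        continuous_on_compose2[OF \<beta>_continuous(2) continuous_on_snd[OF continuous_on_id]]) auto
qed

lemma laplacian_minus_flux_div:
  assumes k: "k < n" and t: "t \<in> J" and y: "y \<in> cimg (ch k)"
  shows "\<beta> k y * laplacian (g t) (v t) (ch k) (cinv (ch k) y) - flux_div k t y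
       = - (\<Sum>i\<in>UNIV. dx (ch k) i t (cinv (ch k) y) * drift k i t y)"
proof -
  note c = cover(1)[OF k]
  have x: "cinv (ch k) y \<in> cdom (ch k)" using cinv_in y by blast
  show ?thesis
    unfolding flux_div_def partial_flux[OF t c x] laplacian_def tensor_trace_def hessian_def drift_def Let_def
      flux_def
    by (simp only: vec_lambda_beta, rule first_order_remainder) (rule \<gamma>_sym[OF c x t])
qed

text \<open>
  Up to the bounded first order terms of \<open>laplacian_minus_flux_div\<close>, the left-hand side is \<open>\<beta> k\<close> times the
  quantity that the assumed inequality controls.
\<close>

lemma local_error_bound:
  assumes k: "k < n"
  shows "\<exists>C\<ge>0. \<forall>t\<in>J. \<forall>y\<in>cball (ce k) (ra k).
     \<bar>\<beta> k y * u t (cinv (ch k) y) - flux_div k t y\<bar> \<le> C * (\<bar>v t (cinv (ch k) y)\<bar> + sqrt (grad_sq t (cinv (ch k) y)))"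
proof -
  note c = cover(1)[OF k]
  obtain E where E: "E \<ge> 0" and dE: "\<forall>t\<in>J. \<forall>y\<in>cball (ce k) (ra k). \<forall>i.
     \<bar>dx (ch k) i t (cinv (ch k) y)\<bar> \<le> E * sqrt (grad_sq t (cinv (ch k) y))"
    using dx_bound[OF k] by blast
  have "\<forall>i. \<exists>B\<ge>0. \<forall>t\<in>J. \<forall>y\<in>cball (ce k) (ra k). \<bar>drift k i t y\<bar> \<le> B"
    using continuous_bounded_on_compact[OF drift_continuous[OF k] compact_cball cover(3)[OF k]] by simp
  then obtain B where B: "\<And>i. B i \<ge> 0"
    and dB: "\<And>i t y. t \<in> J \<Longrightarrow> y \<in> cball (ce k) (ra k) \<Longrightarrow> \<bar>drift k i t y\<bar> \<le> B i"
    by metis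
  have "continuous_on ({0..0} \<times> cimg (ch k)) (\<lambda>z. \<beta> k (snd z))"
    by (rule continuous_on_compose2[OF \<beta>_continuous(1) continuous_on_snd[OF continuous_on_id]]) auto
  from continuous_bounded_on_compact[OF this compact_cball cover(3)[OF k]]
  obtain b where b: "b \<ge> 0" "\<And>y. y \<in> cball (ce k) (ra k) \<Longrightarrow> \<beta> k y \<le> b" by (auto simp: abs_le_iff)
  define C where "C = b * C0 + (\<Sum>i\<in>UNIV. E * B i)"
  have C: "b * C0 \<ge> 0" "(\<Sum>i\<in>UNIV. E * B i) \<ge> 0"
    using b(1) C0 E B by (auto intro!: sum_nonneg)
  have "\<bar>\<beta> k y * u t (cinv (ch k) y) - flux_div k t y\<bar> \<le> C * (\<bar>v t (cinv (ch k) y)\<bar> + sqrt (grad_sq t (cinv (ch k) y)))"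
    if t: "t \<in> J" and y: "y \<in> cball (ce k) (ra k)" for t y
  proof -
    let ?x = "cinv (ch k) y"
    have x: "?x \<in> cdom (ch k)" using cinv_in ball_in[OF k y] by blast
    let ?N = "\<bar>v t ?x\<bar> + sqrt (grad_sq t ?x)"
    have N: "0 \<le> ?N" "sqrt (grad_sq t ?x) \<le> ?N" using grad_sq_nonneg by auto
    have "\<beta> k y * u t ?x - flux_div k t y = \<beta> k y * (u t ?x - laplacian (g t) (v t) (ch k) ?x)
        - (\<Sum>i\<in>UNIV. dx (ch k) i t ?x * drift k i t y)"
      using laplacian_minus_flux_div[OF k t ball_in[OF k y]] by (simp add: right_diff_distrib)
    moreover have "\<bar>\<beta> k y * (u t ?x - laplacian (g t) (v t) (ch k) ?x)\<bar> \<le> b * (C0 * ?N)"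
      unfolding abs_mult using ineq[OF t c x] b y \<beta>_nonneg grad_norm_eq_sqrt[OF t c x]
      by (intro mult_mono) auto
    moreover have "\<bar>\<Sum>i\<in>UNIV. dx (ch k) i t ?x * drift k i t y\<bar> \<le> (\<Sum>i\<in>UNIV. E * B i) * ?N"
    proof -
      have "\<bar>dx (ch k) i t ?x * drift k i t y\<bar> \<le> (E * B i) * ?N" for i
      proof -
        have "\<bar>dx (ch k) i t ?x * drift k i t y\<bar> \<le> (E * sqrt (grad_sq t ?x)) * B i"
          unfolding abs_mult using dE t y B E grad_sq_nonneg
          by (intro mult_mono dB) auto
        also have "\<dots> \<le> (E * ?N) * B i"
          using N E B by (intro mult_right_mono mult_left_mono) auto
        finally show ?thesis by (simp add: mult_ac)
      qed
      then show ?thesis unfolding sum_distrib_right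
        by (intro order_trans[OF sum_abs] sum_mono) auto
    qed
    ultimately show ?thesis
      unfolding C_def distrib_right by (simp only: mult.assoc)
  qed
  then show ?thesis using C by (intro exI[of _ C]) (auto simp: C_def)
qed

text \<open>
  Multiplied by \<open>\<Phi>\<close>, the difference is the sum over the charts of the differences in
  \<open>local_error_bound\<close>, each of which vanishes outside its coordinate ball.
\<close>

lemma error_bound:
  "\<exists>C\<ge>0. \<forall>t\<in>J. \<forall>x\<in>topspace M. \<bar>u t x - weighted_lap t x\<bar> \<le> C * (\<bar>v t x\<bar> + sqrt (grad_sq t x))"
proof -
  have "\<forall>k. \<exists>C. k < n \<longrightarrow> C \<ge> 0 \<and> (\<forall>t\<in>J. \<forall>x\<in>topspace M.
      \<bar>push (g t0) (ch k) (\<beta> k) x * u t x - push (g t0) (ch k) (flux_div k t) x\<bar> \<le> C * (\<bar>v t x\<bar> + sqrt (grad_sq t x)))"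
  proof (intro allI)
    fix k
    show "\<exists>C. k < n \<longrightarrow> C \<ge> 0 \<and> (\<forall>t\<in>J. \<forall>x\<in>topspace M.
      \<bar>push (g t0) (ch k) (\<beta> k) x * u t x - push (g t0) (ch k) (flux_div k t) x\<bar> \<le> C * (\<bar>v t x\<bar> + sqrt (grad_sq t x)))"
    proof (cases "k < n")
      case k: True
      note c = cover(1)[OF k]
      obtain C where C: "C \<ge> 0" and bound: "\<forall>t\<in>J. \<forall>y\<in>cball (ce k) (ra k).
          \<bar>\<beta> k y * u t (cinv (ch k) y) - flux_div k t y\<bar> \<le> C * (\<bar>v t (cinv (ch k) y)\<bar> + sqrt (grad_sq t (cinv (ch k) y)))"
        using local_error_bound[OF k] by blast
      let ?d = "\<lambda>y. sqrt (det (g t0 (ch k) (cinv (ch k) y)))"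
      have dpos: "0 < ?d y" if "y \<in> cimg (ch k)" for y using det0_pos[OF c cinv_in[OF that]] by simp
      have "continuous_on (cimg (ch k)) (\<lambda>y. 1 / ?d y)"
        by (intro continuous_on_divide continuous_on_const continuous_on_real_sqrt det0 c)
           (use dpos in \<open>metis less_irrefl\<close>)
      then have "continuous_on ({0..0} \<times> cimg (ch k)) (\<lambda>z. 1 / ?d (snd z))"
        by (rule continuous_on_compose2[OF _ continuous_on_snd[OF continuous_on_id]]) auto
      from continuous_bounded_on_compact[OF this compact_cball cover(3)[OF k]]
      obtain B where B: "B \<ge> 0" "\<And>y. y \<in> cball (ce k) (ra k) \<Longrightarrow> \<bar>1 / ?d y\<bar> \<le> B" by auto
      have "\<bar>push (g t0) (ch k) (\<beta> k) x * u t x - push (g t0) (ch k) (flux_div k t) x\<bar> \<le> (C * B) * (\<bar>v t x\<bar> + sqrt (grad_sq t x))"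
        if t: "t \<in> J" and x: "x \<in> topspace M" for t x
      proof -
        have N: "0 \<le> \<bar>v t x\<bar> + sqrt (grad_sq t x)" using grad_sq_nonneg by simp
        show ?thesis
        proof (cases "x \<in> cdom (ch k) \<and> cmap (ch k) x \<in> cball (ce k) (ra k)")
          case True
          let ?y = "cmap (ch k) x"
          have xx: "cinv (ch k) ?y = x" using cinv_cmap[OF c] True by blast
          have "\<bar>push (g t0) (ch k) (\<beta> k) x * u t x - push (g t0) (ch k) (flux_div k t) x\<bar>
              = \<bar>\<beta> k ?y * u t x - flux_div k t ?y\<bar> * \<bar>1 / ?d ?y\<bar>"
            unfolding abs_mult[symmetric] push_def xx using True by (simp add: diff_divide_distrib[symmetric] abs_divide)
          also have "\<dots> \<le> (C * (\<bar>v t x\<bar> + sqrt (grad_sq t x))) * B"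
            using bound[rule_format, OF t, of ?y] B(1) B(2)[of ?y] True C N unfolding xx by (intro mult_mono) auto
          finally show ?thesis by (simp only: mult_ac)
        next
          case False
          then have "push (g t0) (ch k) (\<beta> k) x = 0" "push (g t0) (ch k) (flux_div k t) x = 0"
            using \<beta>_outside[OF k] flux_div_local_weight[OF k t] unfolding push_def local_weight_def by auto
          then show ?thesis using C B(1) N by (simp del: abs_ge_zero)
        qed
      qed
      then show ?thesis using C B(1) by (intro exI[of _ "C * B"]) auto
    qed auto
  qed
  then obtain C where C: "\<And>k. k < n \<Longrightarrow> C k \<ge> 0" and bound: "\<And>k t x. k < n \<Longrightarrow> t \<in> J \<Longrightarrow> x \<in> topspace M \<Longrightarrow>
      \<bar>push (g t0) (ch k) (\<beta> k) x * u t x - push (g t0) (ch k) (flux_div k t) x\<bar> \<le> C k * (\<bar>v t x\<bar> + sqrt (grad_sq t x))"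
    by metis
  obtain \<delta> where \<delta>: "\<delta> > 0" "\<forall>x\<in>topspace M. \<delta> \<le> \<Phi> x" using \<Phi>_lower_bound by blast
  have "\<bar>u t x - weighted_lap t x\<bar> \<le> ((\<Sum>k<n. C k) / \<delta>) * (\<bar>v t x\<bar> + sqrt (grad_sq t x))"
    if t: "t \<in> J" and x: "x \<in> topspace M" for t x
  proof -
    let ?N = "\<bar>v t x\<bar> + sqrt (grad_sq t x)"
    have N: "0 \<le> ?N" using grad_sq_nonneg by simp
    have "\<Phi> x * weighted_lap t x = (\<Sum>k<n. push (g t0) (ch k) (flux_div k t) x)"
      unfolding weighted_lap_def using \<Phi>_pos[OF x] by simp
    moreover have "\<Phi> x * u t x = (\<Sum>k<n. push (g t0) (ch k) (\<beta> k) x * u t x)"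
      unfolding \<Phi>_def by (rule sum_distrib_right)
    ultimately have "\<Phi> x * (u t x - weighted_lap t x)
        = (\<Sum>k<n. push (g t0) (ch k) (\<beta> k) x * u t x - push (g t0) (ch k) (flux_div k t) x)"
      by (simp only: right_diff_distrib sum_subtractf)
    then have "\<Phi> x * \<bar>u t x - weighted_lap t x\<bar>
        = \<bar>\<Sum>k<n. push (g t0) (ch k) (\<beta> k) x * u t x - push (g t0) (ch k) (flux_div k t) x\<bar>"
      using \<Phi>_pos[OF x] by (metis abs_mult abs_of_pos)
    also have "\<dots> \<le> (\<Sum>k<n. C k * ?N)"
      by (intro order_trans[OF sum_abs] sum_mono bound t x) auto
    finally have "\<Phi> x * \<bar>u t x - weighted_lap t x\<bar> \<le> (\<Sum>k<n. C k) * ?N" by (simp only: sum_distrib_right)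
    moreover have "\<delta> * \<bar>u t x - weighted_lap t x\<bar> \<le> \<Phi> x * \<bar>u t x - weighted_lap t x\<bar>"
      using \<delta>(2) x by (intro mult_right_mono) auto
    ultimately show ?thesis using \<delta>(1) by (simp add: field_simps)
  qed
  moreover have "0 \<le> (\<Sum>k<n. C k) / \<delta>" using C \<delta>(1) by (intro divide_nonneg_pos sum_nonneg) auto
  ultimately show ?thesis by blast
qed

section \<open>Time derivatives of the energies\<close>

lemma \<beta>_integrable:
  assumes k: "k < n" and f: "continuous_on (cimg (ch k)) f"
  shows "integrable lborel (\<lambda>y. \<beta> k y * f y)"
proof (rule integrable_compact_support[where K = "cball (ce k) (ra k)"])
  show "continuous_on UNIV (\<lambda>y. \<beta> k y * f y)"
    by (rule continuous_on_extend_zero_UNIV[OF _ atlas(3)[OF cover(1)[OF k]] closed_cball cover(3)[OF k]])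
       (intro continuous_on_mult \<beta>_continuous f, simp add: \<beta>_outside(1)[OF k])
qed (simp_all add: \<beta>_outside(1)[OF k])

lemma time_slice_continuous:
  assumes "chart_C1 J c w" "t \<in> J" shows "continuous_on (cimg c) (\<lambda>y. w t (cinv c y))"
  by (rule continuous_on_time_slice[OF chart_C1_continuous[OF assms(1)] assms(2)])

definition dirichlet_rate where "dirichlet_rate t = (\<Sum>k<n. \<integral>y. \<beta> k y * time_deriv J (grad_form (ch k)) t (cinv (ch k) y) \<partial>lborel)"

lemma Dirichlet_energy_deriv:
  assumes t: "t \<in> J"
  shows "((\<lambda>t. \<Lambda> (grad_sq t)) has_vector_derivative dirichlet_rate t) (at t within J)"
proof -
  have "((\<lambda>t. \<Sum>k<n. \<integral>y. \<beta> k y * grad_form (ch k) t (cinv (ch k) y) \<partial>lborel) has_vector_derivative dirichlet_rate t) (at t within J)"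
    unfolding dirichlet_rate_def
    by (intro has_vector_derivative_sum chart_integral_deriv t01 t grad_form_C1 cover(1)) auto
  moreover have "(\<Sum>k<n. \<integral>y. \<beta> k y * grad_form (ch k) s (cinv (ch k) y) \<partial>lborel) = \<Lambda> (grad_sq s)" if s: "s \<in> J" for s
    unfolding \<Lambda>_charts(2)[OF grad_sq_continuous[OF s]]
  proof (intro sum.cong refl Bochner_Integration.integral_cong)
    fix k y assume "k \<in> {..<n}"
    then have k: "k < n" by simp
    show "\<beta> k y * grad_form (ch k) s (cinv (ch k) y) = \<beta> k y * grad_sq s (cinv (ch k) y)"
      using grad_sq_eq_form[OF s cover(1)[OF k] cinv_in] \<beta>_outside(1)[OF k] ball_in[OF k]
      by (cases "y \<in> cball (ce k) (ra k)") auto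
  qed
  ultimately show ?thesis
    by (auto intro: has_vector_derivative_transform[OF t, rotated])
qed

lemma Dirichlet_energy_deriv_le:
  "\<exists>C\<ge>0. \<forall>t\<in>J. dirichlet_rate t \<le> C * \<Lambda> (grad_sq t) - 2 * \<Lambda> (\<lambda>x. u t x * weighted_lap t x)"
proof -
  have "\<forall>k. \<exists>C. k < n \<longrightarrow> C \<ge> 0 \<and> (\<forall>t\<in>J. \<forall>y\<in>cball (ce k) (ra k). \<bar>metric_drift k t y\<bar> \<le> C * grad_sq t (cinv (ch k) y))"
    using metric_drift_bound by blast
  then obtain C where C: "\<And>k. k < n \<Longrightarrow> C k \<ge> 0" and bound: "\<And>k t y. k < n \<Longrightarrow> t \<in> J \<Longrightarrow>
     y \<in> cball (ce k) (ra k) \<Longrightarrow> \<bar>metric_drift k t y\<bar> \<le> C k * grad_sq t (cinv (ch k) y)"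
    by metis
  let ?C = "\<Sum>k<n. C k"
  have Ck: "C k \<le> ?C" if "k < n" for k
    by (rule member_le_sum) (use that C in auto)
  have "dirichlet_rate t \<le> ?C * \<Lambda> (grad_sq t) - 2 * \<Lambda> (\<lambda>x. u t x * weighted_lap t x)" if t: "t \<in> J" for t
  proof -
    let ?P = "\<lambda>k y. \<Sum>j\<in>UNIV. flux (ch k) j t (cinv (ch k) y) * partial (ch k) j (u t) (cinv (ch k) y)"
    have le: "(\<integral>y. \<beta> k y * time_deriv J (grad_form (ch k)) t (cinv (ch k) y) \<partial>lborel)
      \<le> ?C * (\<integral>y. \<beta> k y * grad_sq t (cinv (ch k) y) \<partial>lborel) + 2 * (\<integral>y. \<beta> k y * ?P k y \<partial>lborel)"
      if k: "k < n" for k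
    proof -
      note c = cover(1)[OF k]
      have i1: "integrable lborel (\<lambda>y. \<beta> k y * time_deriv J (grad_form (ch k)) t (cinv (ch k) y))"
        by (rule \<beta>_integrable[OF k continuous_on_time_slice[OF continuous_on_time_deriv[OF t01 c grad_form_C1[OF c]] t]])
      have i2: "integrable lborel (\<lambda>y. \<beta> k y * grad_sq t (cinv (ch k) y))"
        by (rule \<beta>_integrable[OF k continuous_on_chart[OF c grad_sq_continuous[OF t]]])
      have i3: "integrable lborel (\<lambda>y. \<beta> k y * ?P k y)"
        by (intro \<beta>_integrable[OF k] continuous_on_sum continuous_on_mult time_slice_continuous flux_C1 c t
            continuous_on_time_slice[OF continuous_on_partial[OF t01 c u_C1[OF c]] t])
      have "(\<integral>y. \<beta> k y * time_deriv J (grad_form (ch k)) t (cinv (ch k) y) \<partial>lborel)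
         \<le> (\<integral>y. ?C * (\<beta> k y * grad_sq t (cinv (ch k) y)) + 2 * (\<beta> k y * ?P k y) \<partial>lborel)"
      proof (intro integral_mono i1 Bochner_Integration.integrable_add integrable_mult_right i2 i3)
        fix y
        show "\<beta> k y * time_deriv J (grad_form (ch k)) t (cinv (ch k) y)
           \<le> ?C * (\<beta> k y * grad_sq t (cinv (ch k) y)) + 2 * (\<beta> k y * ?P k y)"
        proof (cases "y \<in> cball (ce k) (ra k)")
          case True
          have "metric_drift k t y \<le> ?C * grad_sq t (cinv (ch k) y)"
            using bound[OF k t True] mult_right_mono[OF Ck[OF k] grad_sq_nonneg[of t "cinv (ch k) y"]] by linarith
          moreover have "time_deriv J (grad_form (ch k)) t (cinv (ch k) y) = metric_drift k t y + 2 * ?P k y"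
            unfolding metric_drift_def by (rule grad_form_time_deriv[OF t c cinv_in[OF ball_in[OF k True]]])
          ultimately have "\<beta> k y * time_deriv J (grad_form (ch k)) t (cinv (ch k) y)
              \<le> \<beta> k y * (?C * grad_sq t (cinv (ch k) y) + 2 * ?P k y)"
            using \<beta>_nonneg by (intro mult_left_mono) auto
          then show ?thesis by (simp add: algebra_simps)
        next
          case False
          then show ?thesis using \<beta>_outside(1)[OF k] by simp
        qed
      qed
      also have "\<dots> = ?C * (\<integral>y. \<beta> k y * grad_sq t (cinv (ch k) y) \<partial>lborel) + 2 * (\<integral>y. \<beta> k y * ?P k y \<partial>lborel)"
        using i2 i3 by (subst Bochner_Integration.integral_add) (auto intro: integrable_mult_right)
      finally show ?thesis .
    qed
    have "dirichlet_rate t \<le> (\<Sum>k<n. ?C * (\<integral>y. \<beta> k y * grad_sq t (cinv (ch k) y) \<partial>lborel) + 2 * (\<integral>y. \<beta> k y * ?P k y \<partial>lborel))"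
      unfolding dirichlet_rate_def by (intro sum_mono le) auto
    also have "\<dots> = ?C * \<Lambda> (grad_sq t) + 2 * (\<Sum>k<n. \<integral>y. \<beta> k y * ?P k y \<partial>lborel)"
      unfolding \<Lambda>_charts(2)[OF grad_sq_continuous[OF t]] by (simp only: sum.distrib sum_distrib_left)
    also have "(\<Sum>k<n. \<integral>y. \<beta> k y * ?P k y \<partial>lborel) = - \<Lambda> (\<lambda>x. u t x * weighted_lap t x)"
      by (rule Dirichlet_identity[OF t u_C1])
    finally show ?thesis by simp
  qed
  moreover have "0 \<le> ?C" using C by (intro sum_nonneg) auto
  ultimately show ?thesis by blast
qed

lemma energy_deriv:
  assumes t: "t \<in> J"
  shows "((\<lambda>t. \<Lambda> (\<lambda>x. (v t x)\<^sup>2)) has_vector_derivative 2 * \<Lambda> (\<lambda>x. v t x * u t x)) (at t within J)"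
proof -
  have vv: "chart_C1 J c (\<lambda>t x. (v t x)\<^sup>2)" if "c \<in> A" for c
    unfolding power2_eq_square by (intro chart_C1_mult v_C1 that)
  have "((\<lambda>t. \<Sum>k<n. \<integral>y. \<beta> k y * (v t (cinv (ch k) y))\<^sup>2 \<partial>lborel) has_vector_derivative
      (\<Sum>k<n. \<integral>y. \<beta> k y * time_deriv J (\<lambda>t x. (v t x)\<^sup>2) t (cinv (ch k) y) \<partial>lborel)) (at t within J)"
    by (intro has_vector_derivative_sum chart_integral_deriv t01 t vv cover(1)) auto
  moreover have "(\<Sum>k<n. \<integral>y. \<beta> k y * time_deriv J (\<lambda>t x. (v t x)\<^sup>2) t (cinv (ch k) y) \<partial>lborel)
      = 2 * \<Lambda> (\<lambda>x. v t x * u t x)"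
  proof -
    have "\<beta> k y * time_deriv J (\<lambda>t x. (v t x)\<^sup>2) t (cinv (ch k) y)
        = 2 * (\<beta> k y * (v t (cinv (ch k) y) * u t (cinv (ch k) y)))" if k: "k < n" for k y
    proof (cases "y \<in> cball (ce k) (ra k)")
      case True
      note x = cinv_in[OF ball_in[OF k True]]
      have "((\<lambda>s. v s (cinv (ch k) y)) has_real_derivative u t (cinv (ch k) y)) (at t within J)"
        using chart_C1_time_deriv[OF t01 cover(1)[OF k] v_C1[OF cover(1)[OF k]] t x]
        by (simp add: has_real_derivative_iff_has_vector_derivative)
      then have "((\<lambda>s. (v s (cinv (ch k) y))\<^sup>2) has_real_derivative
          2 * (v t (cinv (ch k) y) * u t (cinv (ch k) y))) (at t within J)"
        by (auto intro!: derivative_eq_intros)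
      then have "time_deriv J (\<lambda>t x. (v t x)\<^sup>2) t (cinv (ch k) y) = 2 * (v t (cinv (ch k) y) * u t (cinv (ch k) y))"
        unfolding time_deriv_def has_real_derivative_iff_has_vector_derivative
        by (rule vector_derivative_within_closed_interval[OF t01 t])
      then show ?thesis by simp
    next
      case False
      then show ?thesis using \<beta>_outside(1)[OF k] by simp
    qed
    then have "(\<Sum>k<n. \<integral>y. \<beta> k y * time_deriv J (\<lambda>t x. (v t x)\<^sup>2) t (cinv (ch k) y) \<partial>lborel)
      = (\<Sum>k<n. 2 * (\<integral>y. \<beta> k y * (v t (cinv (ch k) y) * u t (cinv (ch k) y)) \<partial>lborel))"
      by (intro sum.cong refl) (simp only: lessThan_iff integral_mult_right_zero)
    also have "\<dots> = 2 * \<Lambda> (\<lambda>x. v t x * u t x)"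
      using \<Lambda>_charts(2)[OF continuous_map_real_mult[OF v_continuous[OF t] u_continuous[OF t]]]
      by (simp add: sum_distrib_left)
    finally show ?thesis .
  qed
  moreover have "(\<Sum>k<n. \<integral>y. \<beta> k y * (v s (cinv (ch k) y))\<^sup>2 \<partial>lborel) = \<Lambda> (\<lambda>x. (v s x)\<^sup>2)" if s: "s \<in> J" for s
    by (rule \<Lambda>_charts(2)[symmetric]) (intro continuous_map_real_pow v_continuous s)
  ultimately show ?thesis
    by (auto intro: has_vector_derivative_transform[OF t, rotated])
qed

end

section \<open>The frequency bound and backward uniqueness\<close>

text \<open>
  Suppose \<open>E s > 0\<close> and let \<open>r\<close> be the first zero of \<open>E\<close> after \<open>s\<close>.  Before \<open>r\<close>, the first inequality makes
  \<open>exp (-C t) (1 + D/E)\<close> nonincreasing, so \<open>E + D \<le> K E\<close> with a constant \<open>K\<close>.  The second one then gives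
  \<open>E' \<ge> -C K E\<close>, so \<open>exp (C K t) E\<close> is nondecreasing and cannot reach zero at \<open>r\<close>.
\<close>

lemma frequency_bound_imp_zero:
  fixes E D E' D' :: "real \<Rightarrow> real"
  assumes dE: "\<And>t. t \<in> {t0..t1} \<Longrightarrow> (E has_vector_derivative E' t) (at t within {t0..t1})"
    and dD: "\<And>t. t \<in> {t0..t1} \<Longrightarrow> (D has_vector_derivative D' t) (at t within {t0..t1})"
    and nn: "\<And>t. t \<in> {t0..t1} \<Longrightarrow> 0 \<le> E t" "\<And>t. t \<in> {t0..t1} \<Longrightarrow> 0 \<le> D t" "0 \<le> C"
    and freq: "\<And>t. t \<in> {t0..t1} \<Longrightarrow> D' t * E t - D t * E' t \<le> C * (E t + D t) * E t"
    and energy: "\<And>t. t \<in> {t0..t1} \<Longrightarrow> - C * (E t + D t) \<le> E' t"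
    and zero: "E t1 = 0" and s: "s \<in> {t0..t1}"
  shows "E s = 0"
proof (rule ccontr)
  assume "E s \<noteq> 0"
  then have Es: "E s > 0" using nn(1) s by force
  have cE: "continuous_on {t0..t1} E"
    using dE has_vector_derivative_continuous continuous_on_eq_continuous_within by blast
  have cD: "continuous_on {t0..t1} D"
    using dD has_vector_derivative_continuous continuous_on_eq_continuous_within by blast
  define Z where "Z = {t \<in> {s..t1}. E t = 0}"
  have "continuous_on {s..t1} E" using cE s by (auto elim: continuous_on_subset)
  then have "closed Z"
    unfolding Z_def using continuous_closed_preimage_constant[of "{s..t1}" E 0] by auto
  moreover have "t1 \<in> Z" "bdd_below Z"
    unfolding Z_def using zero s by (auto intro!: bdd_belowI[of _ s])
  ultimately have "Inf Z \<in> Z" using closed_contains_Inf by blast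
  define r where "r = Inf Z"
  have r: "E r = 0" "s \<le> r" "r \<le> t1" using \<open>Inf Z \<in> Z\<close> unfolding r_def Z_def by auto
  then have "s < r" using Es by (cases "s = r") auto
  have pos: "E t > 0" if "t \<in> {s..<r}" for t
  proof -
    have "t \<notin> Z" using that cInf_lower[OF _ \<open>bdd_below Z\<close>] unfolding r_def by force
    then show ?thesis using that r s nn(1)[of t] unfolding Z_def by force
  qed
  have dE': "(E has_real_derivative E' t) (at t)" and dD': "(D has_real_derivative D' t) (at t)"
    if "t \<in> {s<..<r}" for t
    using dE[of t] dD[of t] that r s at_within_Icc_at[of t0 t t1]
    by (auto simp: has_real_derivative_iff_has_vector_derivative)
  define N where "N t = exp (- C * t) * (1 + D t / E t)" for t
  \<comment> \<open>\<open>N\<close> is the frequency plus one with its largest possible growth factor divided out.\<close>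
  have Nmono: "N t \<le> N s" if t: "t \<in> {s..<r}" for t
  proof (cases "t = s")
    case False
    have "- N s \<le> - N t"
    proof (rule DERIV_nonneg_imp_increasing_open[where f = "\<lambda>x. - N x"])
      fix x assume x: "s < x" "x < t"
      have ex: "E x > 0" using pos x t by auto
      let ?d = "exp (- C * x) * ((D' x * E x - D x * E' x) / (E x)\<^sup>2) - C * N x"
      have "(N has_real_derivative ?d) (at x)"
        unfolding N_def using x t ex
        by (auto intro!: derivative_eq_intros dE' dD' simp: field_simps power2_eq_square)
      then have "((\<lambda>x. - N x) has_real_derivative - ?d) (at x)" by (rule DERIV_minus)
      moreover have "?d \<le> 0"
      proof -
        have "(D' x * E x - D x * E' x) / (E x)\<^sup>2 \<le> C * (E x + D x) * E x / (E x)\<^sup>2"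
          using freq[of x] x t r s by (intro divide_right_mono) auto
        also have "\<dots> = C * (1 + D x / E x)"
          using ex by (simp add: field_simps power2_eq_square)
        finally have "exp (- C * x) * ((D' x * E x - D x * E' x) / (E x)\<^sup>2)
            \<le> exp (- C * x) * (C * (1 + D x / E x))"
          by (rule mult_left_mono) simp
        then show ?thesis unfolding N_def by (simp add: mult.left_commute)
      qed
      ultimately show "\<exists>y. ((\<lambda>x. - N x) has_real_derivative y) (at x) \<and> 0 \<le> y" by force
    next
      have "E x \<noteq> 0" if "x \<in> {s..t}" for x using pos[of x] that t by auto
      then show "continuous_on {s..t} (\<lambda>x. - N x)"
        unfolding N_def using t r s
        by (intro continuous_intros continuous_on_subset[OF cE] continuous_on_subset[OF cD]) auto
    qed (use t in auto)
    then show ?thesis by simp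
  qed auto
  define K where "K = exp (C * t1) * N s"
  have K: "E t + D t \<le> K * E t" if t: "t \<in> {s..<r}" for t
  proof -
    have "1 + D t / E t = exp (C * t) * N t"
      unfolding N_def by (simp add: exp_minus field_simps)
    also have "\<dots> \<le> exp (C * t) * N s" using Nmono[OF t] by simp
    also have "\<dots> \<le> K"
    proof -
      have "C * t \<le> C * t1" using t r nn(3) by (intro mult_left_mono) auto
      moreover have "0 \<le> N s" unfolding N_def using nn(2)[OF s] Es by simp
      ultimately show ?thesis unfolding K_def by (intro mult_right_mono) auto
    qed
    finally show ?thesis using pos[OF t] by (simp add: field_simps)
  qed
  have "exp (C * K * s) * E s \<le> exp (C * K * r) * E r"
  proof (rule DERIV_nonneg_imp_increasing_open[where f = "\<lambda>t. exp (C * K * t) * E t"])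
    fix x assume x: "s < x" "x < r"
    have "((\<lambda>t. exp (C * K * t) * E t) has_real_derivative exp (C * K * x) * (E' x + C * K * E x)) (at x)"
      using x by (auto intro!: derivative_eq_intros dE' simp: algebra_simps)
    moreover have "0 \<le> E' x + C * (K * E x)"
      using energy[of x] mult_left_mono[OF K[of x] nn(3)] x r s by auto
    ultimately show "\<exists>y. ((\<lambda>t. exp (C * K * t) * E t) has_real_derivative y) (at x) \<and> 0 \<le> y"
      by (metis exp_ge_zero mult.assoc mult_nonneg_nonneg)
  next
    show "continuous_on {s..r} (\<lambda>t. exp (C * K * t) * E t)"
      using r s by (intro continuous_intros continuous_on_subset[OF cE]) auto
  qed (use r in auto)
  then show False using r Es by (simp add: mult_le_0_iff)
qed

context heat_inequality
begin

text \<open>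
  The computation in the introduction.  With the error \<open>w\<close> and
  \<open>z = (\<partial>\<^sub>tv + P v)/2\<close>, where \<open>P\<close> is \<open>weighted_lap\<close>, the quadratic terms without a sign combine to the defect in the Cauchy-Schwarz
  inequality for \<open>v\<close> and \<open>z\<close>.
\<close>

lemma frequency_inequalities:
  "\<exists>C\<ge>0. \<forall>t\<in>J.
     dirichlet_rate t * \<Lambda> (\<lambda>x. (v t x)\<^sup>2) - \<Lambda> (grad_sq t) * (2 * \<Lambda> (\<lambda>x. v t x * u t x))
       \<le> C * (\<Lambda> (\<lambda>x. (v t x)\<^sup>2) + \<Lambda> (grad_sq t)) * \<Lambda> (\<lambda>x. (v t x)\<^sup>2) \<and>
     - C * (\<Lambda> (\<lambda>x. (v t x)\<^sup>2) + \<Lambda> (grad_sq t)) \<le> 2 * \<Lambda> (\<lambda>x. v t x * u t x)"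
proof -
  obtain C1 where C1: "C1 \<ge> 0" "\<And>t. t \<in> J \<Longrightarrow> dirichlet_rate t \<le> C1 * \<Lambda> (grad_sq t) - 2 * \<Lambda> (\<lambda>x. u t x * weighted_lap t x)"
    using Dirichlet_energy_deriv_le by blast
  obtain C2 where C2: "C2 \<ge> 0"
    "\<And>t x. t \<in> J \<Longrightarrow> x \<in> topspace M \<Longrightarrow> \<bar>u t x - weighted_lap t x\<bar> \<le> C2 * (\<bar>v t x\<bar> + sqrt (grad_sq t x))"
    using error_bound by blast
  define C where "C = C1 + C2\<^sup>2 + 4 * C2 + 2"
  have C0: "0 \<le> C" unfolding C_def using C1(1) C2(1) by simp
  have "dirichlet_rate t * \<Lambda> (\<lambda>x. (v t x)\<^sup>2) - \<Lambda> (grad_sq t) * (2 * \<Lambda> (\<lambda>x. v t x * u t x))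
       \<le> C * (\<Lambda> (\<lambda>x. (v t x)\<^sup>2) + \<Lambda> (grad_sq t)) * \<Lambda> (\<lambda>x. (v t x)\<^sup>2) \<and>
     - C * (\<Lambda> (\<lambda>x. (v t x)\<^sup>2) + \<Lambda> (grad_sq t)) \<le> 2 * \<Lambda> (\<lambda>x. v t x * u t x)" if t: "t \<in> J" for t
  proof -
    note cont = v_continuous[OF t] u_continuous[OF t] weighted_lap_continuous[OF t] grad_sq_continuous[OF t]
    define w where "w x = u t x - weighted_lap t x" for x
    define z where "z x = (1/2) * (u t x + weighted_lap t x)" for x
    have cw: "continuous_map M euclideanreal w" unfolding w_def by (intro continuous_map_diff cont)
    have cz: "continuous_map M euclideanreal z"
      unfolding z_def by (intro continuous_map_real_mult_left continuous_map_add cont)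
    define E where "E = \<Lambda> (\<lambda>x. (v t x)\<^sup>2)"
    define D where "D = \<Lambda> (grad_sq t)"
    define a where "a = \<Lambda> (\<lambda>x. v t x * z x)"
    define b where "b = \<Lambda> (\<lambda>x. v t x * w x)"
    define Z where "Z = \<Lambda> (\<lambda>x. (z x)\<^sup>2)"
    define Y where "Y = \<Lambda> (\<lambda>x. (w x)\<^sup>2)"
    note cc = continuous_map_real_mult_left continuous_map_real_mult continuous_map_real_pow
      continuous_map_add cont cw cz
    have E0: "0 \<le> E" unfolding E_def by (intro \<Lambda>_nonneg cc) auto
    have D0: "0 \<le> D" unfolding D_def by (intro \<Lambda>_nonneg cc) (auto simp: grad_sq_nonneg)
    have vu: "\<Lambda> (\<lambda>x. v t x * u t x) = a + (1/2) * b"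
    proof -
      have "(\<lambda>x. v t x * u t x) = (\<lambda>x. v t x * z x + (1/2) * (v t x * w x))"
        by (simp add: fun_eq_iff z_def w_def algebra_simps)
      then show ?thesis unfolding a_def b_def by (simp only: \<Lambda>_add \<Lambda>_scale cc)
    qed
    have vL: "D = - a + (1/2) * b"
    proof -
      have "(\<lambda>x. v t x * weighted_lap t x) = (\<lambda>x. v t x * z x + (- (1/2)) * (v t x * w x))"
        by (simp add: fun_eq_iff z_def w_def algebra_simps)
      then have "\<Lambda> (\<lambda>x. v t x * weighted_lap t x) = a + (- (1/2)) * b"
        unfolding a_def b_def by (simp only: \<Lambda>_add \<Lambda>_scale cc)
      then show ?thesis unfolding D_def \<Lambda>_grad_sq[OF t] by simp
    qed
    have uL: "\<Lambda> (\<lambda>x. u t x * weighted_lap t x) = Z + (- (1/4)) * Y"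
    proof -
      have "(\<lambda>x. u t x * weighted_lap t x) = (\<lambda>x. (z x)\<^sup>2 + (- (1/4)) * (w x)\<^sup>2)"
        by (simp add: fun_eq_iff z_def w_def power2_eq_square algebra_simps)
      then show ?thesis unfolding Z_def Y_def by (simp only: \<Lambda>_add \<Lambda>_scale cc)
    qed
    \<comment> \<open>The term \<open>2 a\<^sup>2\<close> of \<open>- D E'\<close> is absorbed by the term \<open>- 2 Z E\<close> of \<open>D' E\<close>.\<close>
    have CS: "a\<^sup>2 \<le> E * Z"
      unfolding a_def E_def Z_def by (rule \<Lambda>_Cauchy_Schwarz[OF cont(1) cz])
    have wb: "\<bar>w x\<bar> \<le> C2 * (\<bar>v t x\<bar> + sqrt (grad_sq t x))" if "x \<in> topspace M" for x
      unfolding w_def using C2(2)[OF t that] .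
    have Yb: "Y \<le> (2 * C2\<^sup>2) * (E + D)"
    proof -
      have "Y \<le> \<Lambda> (\<lambda>x. (2 * C2\<^sup>2) * ((v t x)\<^sup>2 + grad_sq t x))"
        unfolding Y_def
      proof (intro \<Lambda>_mono cc)
        fix x assume x: "x \<in> topspace M"
        have "(w x)\<^sup>2 \<le> (C2 * (\<bar>v t x\<bar> + sqrt (grad_sq t x)))\<^sup>2"
          using power_mono[OF wb[OF x] abs_ge_zero, of 2] by simp
        also have "\<dots> = C2\<^sup>2 * (\<bar>v t x\<bar> + sqrt (grad_sq t x))\<^sup>2" by (simp add: power_mult_distrib)
        also have "\<dots> \<le> C2\<^sup>2 * (2 * ((v t x)\<^sup>2 + grad_sq t x))"
        proof (rule mult_left_mono)
          have "0 \<le> (\<bar>v t x\<bar> - sqrt (grad_sq t x))\<^sup>2" by simp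
          then show "(\<bar>v t x\<bar> + sqrt (grad_sq t x))\<^sup>2 \<le> 2 * ((v t x)\<^sup>2 + grad_sq t x)"
            using grad_sq_nonneg[of t x] by (simp add: power2_sum power2_diff)
        qed simp
        finally show "(w x)\<^sup>2 \<le> (2 * C2\<^sup>2) * ((v t x)\<^sup>2 + grad_sq t x)" by (simp only: mult_ac)
      qed
      also have "\<dots> = (2 * C2\<^sup>2) * (E + D)"
        unfolding E_def D_def by (simp only: \<Lambda>_add \<Lambda>_scale cc)
      finally show ?thesis .
    qed
    have bb: "- b \<le> C2 * (2 * E + D)"
    proof -
      have "- b = \<Lambda> (\<lambda>x. (-1) * (v t x * w x))" unfolding b_def by (simp only: \<Lambda>_scale)
      also have "\<dots> \<le> \<Lambda> (\<lambda>x. C2 * (2 * (v t x)\<^sup>2 + grad_sq t x))"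
      proof (intro \<Lambda>_mono cc)
        fix x assume x: "x \<in> topspace M"
        have "(-1) * (v t x * w x) \<le> \<bar>v t x\<bar> * \<bar>w x\<bar>"
          by (metis abs_ge_minus_self abs_mult mult_minus1)
        also have "\<dots> \<le> \<bar>v t x\<bar> * (C2 * (\<bar>v t x\<bar> + sqrt (grad_sq t x)))"
          by (intro mult_left_mono wb x) auto
        also have "\<dots> = C2 * (\<bar>v t x\<bar> * (\<bar>v t x\<bar> + sqrt (grad_sq t x)))" by (simp only: mult.left_commute)
        also have "\<dots> \<le> C2 * (2 * (v t x)\<^sup>2 + grad_sq t x)"
        proof (intro mult_left_mono C2)
          have "0 \<le> (\<bar>v t x\<bar> - sqrt (grad_sq t x))\<^sup>2" by simp
          then have "2 * (\<bar>v t x\<bar> * sqrt (grad_sq t x)) \<le> (v t x)\<^sup>2 + grad_sq t x"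
            using grad_sq_nonneg[of t x] by (simp add: power2_diff)
          moreover have "\<bar>v t x\<bar> * (\<bar>v t x\<bar> + sqrt (grad_sq t x)) = (v t x)\<^sup>2 + \<bar>v t x\<bar> * sqrt (grad_sq t x)"
            by (simp add: distrib_left power2_eq_square)
          ultimately show "\<bar>v t x\<bar> * (\<bar>v t x\<bar> + sqrt (grad_sq t x)) \<le> 2 * (v t x)\<^sup>2 + grad_sq t x"
            using grad_sq_nonneg[of t x] zero_le_power2[of "v t x"] by linarith
        qed
        finally show "(-1) * (v t x * w x) \<le> C2 * (2 * (v t x)\<^sup>2 + grad_sq t x)" .
      qed
      also have "\<dots> = C2 * (2 * E + D)"
        unfolding E_def D_def by (simp only: \<Lambda>_add \<Lambda>_scale cc)
      finally show ?thesis .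
    qed
    have D'b: "dirichlet_rate t \<le> C1 * D - 2 * Z + (1/2) * Y"
      using C1(2)[OF t] unfolding uL D_def by simp
    have "dirichlet_rate t * E - D * (2 * (a + (1/2) * b)) \<le> C * (E + D) * E"
    proof -
      have 1: "dirichlet_rate t * E \<le> (C1 * D - 2 * Z + (1/2) * Y) * E"
        using D'b E0 by (rule mult_right_mono)
      have 2: "Y * E \<le> (2 * C2\<^sup>2) * (E + D) * E" using Yb E0 by (rule mult_right_mono)
      \<comment> \<open>The product of \<open>D = b/2 - a\<close> and \<open>E' = 2a + b\<close> is a difference of squares.\<close>
      have 3: "D * (2 * (a + (1/2) * b)) = (1/2) * b\<^sup>2 - 2 * a\<^sup>2"
        unfolding vL by (simp add: power2_eq_square algebra_simps)
      have 4: "(C1 + C2\<^sup>2) * ((E + D) * E) \<le> C * ((E + D) * E)"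
        using E0 D0 C2(1) unfolding C_def by (intro mult_right_mono) auto
      have 5: "C1 * D * E \<le> C1 * ((E + D) * E)"
        using C1(1) E0 D0 unfolding mult.assoc by (intro mult_left_mono mult_right_mono) auto
      have "dirichlet_rate t * E - D * (2 * (a + (1/2) * b))
          \<le> C1 * D * E - 2 * (E * Z) + (1/2) * (Y * E) - (1/2) * b\<^sup>2 + 2 * a\<^sup>2"
        using 1 unfolding 3 by (simp add: algebra_simps)
      also have "\<dots> \<le> C1 * D * E + (1/2) * (Y * E)"
        using CS zero_le_power2[of b] by linarith
      also have "\<dots> \<le> (C1 + C2\<^sup>2) * ((E + D) * E)"
        using 2 5 by (simp add: algebra_simps)
      finally show ?thesis using 4 by (simp add: mult.assoc)
    qed
    moreover have "- C * (E + D) \<le> 2 * (a + (1/2) * b)"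
    proof -
      have "2 * (a + (1/2) * b) = 2 * b - 2 * D" unfolding vL by simp
      moreover have "2 * C2 * (2 * E + D) + 2 * D \<le> C * (E + D)"
      proof -
        have "2 * C2 * (2 * E + D) + 2 * D \<le> 4 * C2 * (E + D) + 2 * (E + D)"
          using C2(1) E0 D0 by (simp add: algebra_simps)
        also have "\<dots> = (4 * C2 + 2) * (E + D)" by (simp add: algebra_simps)
        also have "\<dots> \<le> C * (E + D)"
          using C1(1) E0 D0 unfolding C_def by (intro mult_right_mono) auto
        finally show ?thesis .
      qed
      ultimately show ?thesis using bb by (simp only: minus_mult_left[symmetric])
    qed
    ultimately show ?thesis unfolding vu E_def D_def by blast
  qed
  then show ?thesis using C0 by blast
qed

theorem backward_uniqueness:
  assumes end0: "\<And>x. x \<in> topspace M \<Longrightarrow> v t1 x = 0" and t: "t \<in> J" and x: "x \<in> topspace M"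
  shows "v t x = 0"
proof -
  obtain C where C: "C \<ge> 0"
    and f: "\<And>t. t \<in> J \<Longrightarrow> dirichlet_rate t * \<Lambda> (\<lambda>x. (v t x)\<^sup>2) - \<Lambda> (grad_sq t) * (2 * \<Lambda> (\<lambda>x. v t x * u t x))
       \<le> C * (\<Lambda> (\<lambda>x. (v t x)\<^sup>2) + \<Lambda> (grad_sq t)) * \<Lambda> (\<lambda>x. (v t x)\<^sup>2)"
    and e: "\<And>t. t \<in> J \<Longrightarrow> - C * (\<Lambda> (\<lambda>x. (v t x)\<^sup>2) + \<Lambda> (grad_sq t)) \<le> 2 * \<Lambda> (\<lambda>x. v t x * u t x)"
    using frequency_inequalities by blast
  have "\<Lambda> (\<lambda>x. (v t x)\<^sup>2) = 0"
  proof (rule frequency_bound_imp_zero[OF energy_deriv Dirichlet_energy_deriv _ _ C f e _ t])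
    show "0 \<le> \<Lambda> (\<lambda>x. (v t x)\<^sup>2)" if "t \<in> J" for t
      by (intro \<Lambda>_nonneg continuous_map_real_pow v_continuous that) auto
    show "0 \<le> \<Lambda> (grad_sq t)" if "t \<in> J" for t
      by (intro \<Lambda>_nonneg grad_sq_continuous that) (auto simp: grad_sq_nonneg)
    have "\<Lambda> (\<lambda>x. (v t1 x)\<^sup>2) = \<Lambda> (\<lambda>x. 0)" by (rule \<Lambda>_cong) (simp add: end0)
    then show "\<Lambda> (\<lambda>x. (v t1 x)\<^sup>2) = 0" by (simp add: \<Lambda>_def)
  qed
  then show ?thesis by (rule \<Lambda>_square_eq_0[OF v_continuous[OF t] _ x])
qed

end

section \<open>The conformal Ricci flow\<close>

context compact_smooth_manifold
begin

text \<open>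
  The volume at the initial time and a finite cover by coordinate balls provide the weighted integral for
  the frequency argument.
\<close>

lemma backward_uniqueness_heat_inequality:
  assumes t01: "t0 < t1" and J: "{t0..t1} \<subseteq> S"
    and metric: "smooth_metric_family A S g"
    and vol: "volume_measure M A (g t0) \<mu>"
    and v: "smooth_family A {t0..t1} v" and C0: "0 \<le> C0"
    and ineq: "\<And>t c x. t \<in> {t0..t1} \<Longrightarrow> c \<in> A \<Longrightarrow> x \<in> cdom c \<Longrightarrow>
          \<bar>time_deriv {t0..t1} v t x - laplacian (g t) (v t) c x\<bar>
            \<le> C0 * (\<bar>v t x\<bar> + grad_norm (g t) (v t) c x)"
    and end0: "\<And>x. x \<in> topspace M \<Longrightarrow> v t1 x = 0" and t: "t \<in> {t0..t1}" and x: "x \<in> topspace M"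
  shows "v t x = 0"
proof -
  obtain n :: nat and ch ce ra where
    cov1: "\<forall>k<n. ch k \<in> A \<and> 0 < ra k \<and> cball (ce k) (ra k) \<subseteq> cimg (ch k)" and
    cov2: "\<forall>x\<in>topspace M. \<exists>k<n. x \<in> cdom (ch k) \<and> cmap (ch k) x \<in> ball (ce k) (ra k)"
    using chart_cover_indexed by (elim exE conjE)
  have cov: "k < n \<Longrightarrow> ch k \<in> A" "k < n \<Longrightarrow> 0 < ra k" "k < n \<Longrightarrow> cball (ce k) (ra k) \<subseteq> cimg (ch k)" for k
    using cov1 by blast+
  have t0: "t0 \<in> {t0..t1}" using t01 by simp
  have "heat_inequality M A \<mu> g t0 n ch ce ra S t1 C0 v"
  proof (unfold_locales, goal_cases)
    case 1 show ?case using metric J t0 unfolding smooth_metric_family_def by blast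
  next
    case 3
    then show ?case
      using continuous_on_time_slice[where w = "\<lambda>t x. det (g t c x)" for c, OF smooth_metric_family_C1(3)[OF _ metric J] t0]
      by blast
  qed (use vol cov cov2 t01 metric J v C0 ineq in blast)+
  then show ?thesis
    by (rule heat_inequality.backward_uniqueness) (use end0 t x in auto)
qed

text \<open>
  In each of finitely many compact coordinate balls that cover the manifold, the function is continuous in
  time and coordinates, up to the ends of the time interval.
\<close>

lemma smooth_family_bounded:
  assumes t01: "t0 < t1" and J: "{t0..t1} \<subseteq> S" and p: "smooth_family A S p"
  shows "\<exists>B\<ge>0. \<forall>t\<in>{t0..t1}. \<forall>x\<in>topspace M. p t x \<le> B"
proof -
  obtain n :: nat and ch ce ra where
    cov1: "\<forall>k<n. ch k \<in> A \<and> 0 < ra k \<and> cball (ce k) (ra k) \<subseteq> cimg (ch k)" and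
    cov2: "\<forall>x\<in>topspace M. \<exists>k<n. x \<in> cdom (ch k) \<and> cmap (ch k) x \<in> ball (ce k) (ra k)"
    using chart_cover_indexed by (elim exE conjE)
  have cov: "k < n \<Longrightarrow> ch k \<in> A" "k < n \<Longrightarrow> 0 < ra k" "k < n \<Longrightarrow> cball (ce k) (ra k) \<subseteq> cimg (ch k)" for k
    using cov1 by blast+
  have "\<exists>B. k < n \<longrightarrow> 0 \<le> B \<and> (\<forall>t\<in>{t0..t1}. \<forall>y\<in>cball (ce k) (ra k). \<bar>p t (cinv (ch k) y)\<bar> \<le> B)" for k
  proof (cases "k < n")
    case k: True
    have "smooth_on (S \<times> cimg (ch k)) (\<lambda>(t, y). p t (cinv (ch k) y))"
      using p cov(1)[OF k] unfolding smooth_family_def by blast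
    then have "continuous_on (S \<times> cimg (ch k)) (\<lambda>(t, y). p t (cinv (ch k) y))"
      unfolding smooth_on_def using Ck_on_continuous by blast
    then have "continuous_on ({t0..t1} \<times> cimg (ch k)) (\<lambda>(t, y). p t (cinv (ch k) y))"
      by (rule continuous_on_subset) (use J in blast)
    from continuous_bounded_on_compact[OF this compact_cball cov(3)[OF k]] show ?thesis by auto
  qed auto
  then obtain B where B: "\<And>k. k < n \<Longrightarrow> 0 \<le> B k" and pB: "\<And>k t y. k < n \<Longrightarrow> t \<in> {t0..t1} \<Longrightarrow>
      y \<in> cball (ce k) (ra k) \<Longrightarrow> \<bar>p t (cinv (ch k) y)\<bar> \<le> B k"
    by metis
  have "p t x \<le> (\<Sum>k<n. B k)" if t: "t \<in> {t0..t1}" and x: "x \<in> topspace M" for t x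
  proof -
    obtain k where k: "k < n" "x \<in> cdom (ch k)" "cmap (ch k) x \<in> ball (ce k) (ra k)"
      using cov2 x by blast
    have "\<bar>p t (cinv (ch k) (cmap (ch k) x))\<bar> \<le> B k"
      by (rule pB[OF k(1) t]) (use k(3) in auto)
    then have "p t x \<le> B k" using cinv_cmap[OF cov(1)[OF k(1)] k(2)] by simp
    also have "B k \<le> (\<Sum>k<n. B k)" by (rule member_le_sum) (use k(1) B in auto)
    finally show ?thesis .
  qed
  moreover have "0 \<le> (\<Sum>k<n. B k)" using B by (intro sum_nonneg) auto
  ultimately show ?thesis by blast
qed

end

text \<open>
  The maximum of the pressure is bounded on the compact time interval, so \<open>backward_uniqueness_heat_inequality\<close>
  applies with this bound as its constant.
\<close>

theorem theorem4p1:
  fixes M :: "'a topology"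
    and A :: "('a, 'n::finite) chart set"
    and m :: nat
    and T t0 t1 :: real
    and g :: "real \<Rightarrow> ('a, 'n) tensor2"
    and p H f v :: "real \<Rightarrow> 'a \<Rightarrow> real"
    and \<mu> :: "real \<Rightarrow> 'a measure"
    and h k :: "real \<Rightarrow> real"
  assumes manifold: "closed_manifold M A" "connected_space M"
    and dimension: "CARD('n) = m + 1" "m + 1 \<ge> 3"
    and times: "0 < T" "t0 < t1" "{t0..t1} \<subseteq> {0..<T}"
    and flow: "conformal_ricci_flow A m T g p"
    and scalar: "\<And>t c x. t \<in> {0..<T} \<Longrightarrow> c \<in> A \<Longrightarrow> x \<in> cdom c \<Longrightarrow>
          scalar_curvature (g t) c x = - (real m * real (m + 1))"
    and volume: "\<And>t. t \<in> {0..<T} \<Longrightarrow> volume_measure M A (g t) (\<mu> t)"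
    and kernel: "conjugate_fundamental_solution M A m T g p \<mu> H"
    and potential: "\<And>t x. t \<in> {0..<T} \<Longrightarrow> x \<in> topspace M \<Longrightarrow>
          H t x = (4 * pi * (T - t)) powr (- (real (m + 1) / 2)) * exp (- f t x)"
    and mass: "\<And>t. t \<in> {0..<T} \<Longrightarrow> prob_space (weighted_measure (\<mu> t) (H t))"
    and hk: "smooth_on {t0..t1} h" "smooth_on {t0..t1} k" "\<And>t. t \<in> {t0..t1} \<Longrightarrow> h t > 0"
    and curvature: "\<And>t c x. t \<in> {t0..t1} \<Longrightarrow> c \<in> A \<Longrightarrow> x \<in> cdom c \<Longrightarrow>
          tensor_le (bakry_emery_ricci (g t) (f t) c x)
            ((k t / (2 * h t) + scalar_curvature (g t) c x / real (m + 1)) *\<^sub>R g t c x)"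
    and v_smooth: "smooth_family A {t0..t1} v"
    and v_W: "\<And>t. t \<in> {t0..t1} \<Longrightarrow>
          smooth_in_W22_0 M A (g t) (weighted_measure (\<mu> t) (H t)) (v t)"
    and dv_W: "\<And>t. t \<in> {t0..t1} \<Longrightarrow>
          smooth_in_W22_0 M A (g t) (weighted_measure (\<mu> t) (H t)) (time_deriv {t0..t1} v t)"
    and v_ineq: "\<And>t c x. t \<in> {t0..t1} \<Longrightarrow> c \<in> A \<Longrightarrow> x \<in> cdom c \<Longrightarrow>
          \<bar>time_deriv {t0..t1} v t x - laplacian (g t) (v t) c x\<bar>
            \<le> max_pressure M p t * (\<bar>v t x\<bar> + grad_norm (g t) (v t) c x)"
    and v_end: "\<And>x. x \<in> topspace M \<Longrightarrow> v t1 x = 0"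
  shows "\<forall>t\<in>{t0..t1}. \<forall>x\<in>topspace M. v t x = 0"
proof (intro ballI)
  fix t x assume t: "t \<in> {t0..t1}" and x: "x \<in> topspace M"
  interpret compact_smooth_manifold M A by unfold_locales (rule manifold(1))
  have g: "smooth_metric_family A {0..<T} g" and p: "smooth_family A {0..<T} p"
    using flow unfolding conformal_ricci_flow_def by blast+
  obtain B where B: "B \<ge> 0" "\<forall>t\<in>{t0..t1}. \<forall>x\<in>topspace M. p t x \<le> B"
    using smooth_family_bounded[OF times(2,3) p] by blast
  have P: "max_pressure M p t \<le> B" if "t \<in> {t0..t1}" for t
    unfolding max_pressure_def using B(2) that x by (intro cSUP_least) auto
  show "v t x = 0"
  proof (rule backward_uniqueness_heat_inequality[OF times(2,3) g volume v_smooth B(1) _ v_end t x])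
    show "t0 \<in> {0..<T}" using subsetD[OF times(3), of t0] times(2) by simp
    fix t c x assume a: "t \<in> {t0..t1}" "c \<in> A" "x \<in> cdom c"
    have "riemannian_metric A (g t)" using g a(1) times(3) unfolding smooth_metric_family_def by blast
    then have "0 \<le> grad_norm (g t) (v t) c x" by (rule grad_norm_nonneg[OF _ a(2,3)])
    then have "max_pressure M p t * (\<bar>v t x\<bar> + grad_norm (g t) (v t) c x)
        \<le> B * (\<bar>v t x\<bar> + grad_norm (g t) (v t) c x)"
      by (intro mult_right_mono P a) auto
    with v_ineq[OF a] show "\<bar>time_deriv {t0..t1} v t x - laplacian (g t) (v t) c x\<bar>
        \<le> B * (\<bar>v t x\<bar> + grad_norm (g t) (v t) c x)" by linarith
  qed
qed

end
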